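(* Let $s:(N,\mathcal{F})\to M$ be a locally trivial fiber bundle of foliations with connected fibers. Then the foliation $\mathcal{F}$ is strictly simple if and only if for each $x\in M$ the foliation $\mathcal{F}_x$ is strictly simple.
   Context: A locally trivial fiber bundle of foliations $s:(N,\mathcal{F})\to M$ is a surjective submersion $s:N\to M$ together with a foliation $\mathcal{F}$ of $N$ whose leaves lie in the fibers of $s$, such that for all $x_0,x\in M$ there are an open neighbourhood $U$ of $x$ and a diffeomorphism $s^{-1}(U)\to N_{x_0}\times U$ over $U$ mapping $\mathcal{F}|_{s^{-1}(U)}$ to $\mathcal{F}_{x_0}\times 0$ (leaves $L\times\{u\}$, $L$ a leaf of $\mathcal{F}_{x_0}$). Here $N_x=s^{-1}(x)$ and $\mathcal{F}_x$ is the restriction of $\mathcal{F}$ to $N_x$. A foliation $\mathcal{F}$ of $N$ is strictly simple if the leaf space $N/\mathcal{F}$ has a smooth structure of a Hausdorff manifold such that the quotient map $N\to N/\mathcal{F}$ is a submersion. *)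

theory Defs
  imports "HOL-Analysis.Analysis"
begin

text \<open>
  The sets \<open>S\<close> of interest are the relatively open subsets of the linear subspaces of a
  Euclidean space, so that all finite dimensions, including \<open>0\<close>, are available.  If \<open>S\<close> is
  open in the subspace \<open>V\<close>, the values \<open>f' x v\<close> are determined by \<open>f\<close> for \<open>v \<in> V\<close>, and the
  existential choice of \<open>f' x\<close> in directions outside \<open>V\<close> is immaterial (one may
  precompose \<open>f' x\<close> with the orthogonal projection onto \<open>V\<close>).
\<close>

primrec C_on :: "nat \<Rightarrow> 'a::euclidean_space set \<Rightarrow> ('a \<Rightarrow> 'b::euclidean_space) \<Rightarrow> bool" where
  "C_on 0 S f \<longleftrightarrow> continuous_on S f"
| "C_on (Suc k) S f \<longleftrightarrow>
     (\<exists>f'. (\<forall>x\<in>S. (f has_derivative f' x) (at x within S)) \<and> (\<forall>v. C_on k S (\<lambda>x. f' x v)))"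

definition smooth_on :: "'a::euclidean_space set \<Rightarrow> ('a \<Rightarrow> 'b::euclidean_space) \<Rightarrow> bool" where
  "smooth_on S f \<longleftrightarrow> (\<forall>k. C_on k S f)"

text \<open>
  A chart is a pair of its domain and its coordinate map.  A \<open>d\<close>-dimensional chart takes
  its values in some \<open>d\<close>-dimensional linear subspace of \<open>'e\<close> (in place of \<open>\<real>\<^sup>d\<close>).
\<close>

type_synonym ('a, 'e) chart = "'a set \<times> ('a \<Rightarrow> 'e)"

definition is_chart :: "nat \<Rightarrow> 'a topology \<Rightarrow> ('a, 'e::euclidean_space) chart \<Rightarrow> bool" where
  "is_chart d X = (\<lambda>(U, \<phi>). openin X U \<and>
     (\<exists>V. subspace V \<and> dim V = d \<and> openin (top_of_set V) (\<phi> ` U) \<and>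
          homeomorphic_map (subtopology X U) (top_of_set (\<phi> ` U)) \<phi>))"

text \<open>
  The subspace in which a chart with nonempty domain takes its values can be recovered
  from the chart; it represents the tangent spaces at the points of the domain.
\<close>

definition model_space :: "('a, 'e::euclidean_space) chart \<Rightarrow> 'e set" where
  "model_space = (\<lambda>(U, \<phi>). span (\<phi> ` U))"

lemma model_space_eq:
  assumes V: "subspace V" and op: "openin (top_of_set V) (\<phi> ` U)" and ne: "U \<noteq> {}"
  shows "model_space (U, \<phi>) = V"
proof -
  obtain a where a: "a \<in> \<phi> ` U"
    using ne by blast
  obtain e where e: "e > 0" "ball a e \<inter> V \<subseteq> \<phi> ` U"
    using op a by (auto simp: openin_contains_ball)
  have sub: "\<phi> ` U \<subseteq> V"
    using op openin_imp_subset by blast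
  have "v \<in> span (\<phi> ` U)" if v: "v \<in> V" for v
  proof (cases "v = 0")
    case True
    then show ?thesis
      by (simp add: span_zero)
  next
    case False
    define c where "c = e / (2 * norm v)"
    have c: "c > 0" "c * norm v < e"
      using False e by (auto simp: c_def field_simps)
    have "a + c *\<^sub>R v \<in> V"
      using a sub v V by (auto intro!: subspace_add subspace_scale)
    moreover have "a + c *\<^sub>R v \<in> ball a e"
      using c by (simp add: dist_norm)
    ultimately have "a + c *\<^sub>R v \<in> \<phi> ` U"
      using e by blast
    then have "(a + c *\<^sub>R v) - a \<in> span (\<phi> ` U)"
      using a by (intro span_diff span_base)
    then have "c *\<^sub>R v \<in> span (\<phi> ` U)"
      by simp
    then have "(1 / c) *\<^sub>R (c *\<^sub>R v) \<in> span (\<phi> ` U)"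
      by (rule span_scale)
    moreover have "(1 / c) *\<^sub>R (c *\<^sub>R v) = v"
      using c by simp
    ultimately show ?thesis
      by metis
  qed
  moreover have "span (\<phi> ` U) \<subseteq> V"
    using sub V by (rule span_minimal)
  ultimately show ?thesis
    by (auto simp: model_space_def)
qed

definition compatible ::
    "('a, 'e::euclidean_space) chart \<Rightarrow> ('a, 'e) chart \<Rightarrow> bool" where
  "compatible = (\<lambda>(U, \<phi>) (V, \<psi>).
     smooth_on (\<phi> ` (U \<inter> V)) (\<psi> \<circ> inv_into U \<phi>) \<and>
     smooth_on (\<psi> ` (U \<inter> V)) (\<phi> \<circ> inv_into V \<psi>))"

record ('a, 'e) mfd =
  top_space :: "'a topology"
  atlas :: "('a, 'e) chart set"

abbreviation points :: "('a, 'e) mfd \<Rightarrow> 'a set" where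
  "points M \<equiv> topspace (top_space M)"

definition smooth_manifold :: "nat \<Rightarrow> ('a, 'e::euclidean_space) mfd \<Rightarrow> bool" where
  "smooth_manifold d M \<longleftrightarrow>
     Hausdorff_space (top_space M) \<and> second_countable (top_space M) \<and>
     (\<forall>c \<in> atlas M. is_chart d (top_space M) c) \<and>
     (\<Union>(U, \<phi>) \<in> atlas M. U) = points M \<and>
     (\<forall>c \<in> atlas M. \<forall>c' \<in> atlas M. compatible c c')"

definition max_atlas :: "('a, 'e::euclidean_space) mfd \<Rightarrow> ('a, 'e) chart set" where
  "max_atlas M = {c. (\<exists>d. is_chart d (top_space M) c) \<and> (\<forall>c' \<in> atlas M. compatible c c')}"

definition smooth_map ::
    "('a, 'e::euclidean_space) mfd \<Rightarrow> ('b, 'f::euclidean_space) mfd \<Rightarrow> ('a \<Rightarrow> 'b) \<Rightarrow> bool" where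
  "smooth_map M N f \<longleftrightarrow> continuous_map (top_space M) (top_space N) f \<and>
     (\<forall>(U, \<phi>) \<in> atlas M. \<forall>(V, \<psi>) \<in> atlas N.
        smooth_on (\<phi> ` (U \<inter> f -` V)) (\<psi> \<circ> f \<circ> inv_into U \<phi>))"

definition diffeomorphism ::
    "('a, 'e::euclidean_space) mfd \<Rightarrow> ('b, 'f::euclidean_space) mfd \<Rightarrow> ('a \<Rightarrow> 'b) \<Rightarrow> bool" where
  "diffeomorphism M N f \<longleftrightarrow> bij_betw f (points M) (points N) \<and>
     smooth_map M N f \<and> smooth_map N M (inv_into (points M) f)"

definition submersion ::
    "('a, 'e::euclidean_space) mfd \<Rightarrow> ('b, 'f::euclidean_space) mfd \<Rightarrow> ('a \<Rightarrow> 'b) \<Rightarrow> bool" where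
  "submersion M N f \<longleftrightarrow> smooth_map M N f \<and>
     (\<forall>(U, \<phi>) \<in> atlas M. \<forall>(V, \<psi>) \<in> atlas N. \<forall>x \<in> U \<inter> f -` V.
        \<exists>D. ((\<psi> \<circ> f \<circ> inv_into U \<phi>) has_derivative D) (at (\<phi> x) within \<phi> ` (U \<inter> f -` V)) \<and>
            D ` model_space (U, \<phi>) = model_space (V, \<psi>))"

text \<open>
  The induced structure on an embedded submanifold \<open>S\<close>: the charts are the restrictions to \<open>S\<close>
  of the slice charts, that is, of the charts of the ambient manifold in which \<open>S\<close> is a
  linear subspace.  It is used for open subsets and for the fibres of submersions.
\<close>

definition submanifold :: "('a, 'e::euclidean_space) mfd \<Rightarrow> 'a set \<Rightarrow> ('a, 'e) mfd" where
  "submanifold M S =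
     \<lparr>top_space = subtopology (top_space M) S,
      atlas = {(U \<inter> S, \<phi>) | U \<phi>. (U, \<phi>) \<in> max_atlas M \<and>
                 (\<exists>W. subspace W \<and> \<phi> ` (U \<inter> S) = \<phi> ` U \<inter> W)}\<rparr>"

definition prod_mfd ::
    "('a, 'e::euclidean_space) mfd \<Rightarrow> ('b, 'f::euclidean_space) mfd \<Rightarrow> ('a \<times> 'b, 'e \<times> 'f) mfd" where
  "prod_mfd M N =
     \<lparr>top_space = prod_topology (top_space M) (top_space N),
      atlas = {(U \<times> V, map_prod \<phi> \<psi>) | U \<phi> V \<psi>. (U, \<phi>) \<in> atlas M \<and> (V, \<psi>) \<in> atlas N}\<rparr>"

text \<open>
  A foliation chart \<open>(U, \<phi>, A)\<close> is a chart together with a linear subspace \<open>A\<close> of its model space,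
  in place of \<open>\<real>\<^sup>p \<times> 0 \<subseteq> \<real>\<^sup>p \<times> \<real>\<^sup>q\<close>.  The sets \<open>\<real>\<^sup>p \<times> {y}\<close> become the cosets of \<open>A\<close>, and the last
  clause of \<open>foliation_atlas\<close> says that the coordinate changes are locally of the form
  \<open>(x, y) \<mapsto> (g (x, y), h y)\<close>.
\<close>

definition foliation_atlas ::
    "nat \<Rightarrow> ('a, 'e::euclidean_space) mfd \<Rightarrow> ('a set \<times> ('a \<Rightarrow> 'e) \<times> 'e set) set \<Rightarrow> bool" where
  "foliation_atlas p M \<A> \<longleftrightarrow>
     (\<forall>(U, \<phi>, A) \<in> \<A>. (U, \<phi>) \<in> max_atlas M \<and>
        subspace A \<and> dim A = p \<and> A \<subseteq> model_space (U, \<phi>)) \<and>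
     (\<Union>(U, \<phi>, A) \<in> \<A>. U) = points M \<and>
     (\<forall>(U, \<phi>, A) \<in> \<A>. \<forall>(V, \<psi>, B) \<in> \<A>. \<forall>x \<in> U \<inter> V.
        \<exists>W. openin (top_space M) W \<and> x \<in> W \<and> W \<subseteq> U \<inter> V \<and>
            (\<forall>a\<in>W. \<forall>b\<in>W. \<phi> a - \<phi> b \<in> A \<longrightarrow> \<psi> a - \<psi> b \<in> B))"

text \<open>
  Two points of \<open>U\<close> are related if they lie on the same plaque, a connected component of the
  preimage under \<open>\<phi>\<close> of a coset of \<open>A\<close>.  The leaves are the classes of the equivalence
  relation generated by all plaques.
\<close>

definition plaque_rel ::
    "'a topology \<Rightarrow> 'a set \<times> ('a \<Rightarrow> 'e::euclidean_space) \<times> 'e set \<Rightarrow> ('a \<times> 'a) set" where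
  "plaque_rel X = (\<lambda>(U, \<phi>, A).
     {(x, y). x \<in> U \<and> connected_component_of (subtopology X {z \<in> U. \<phi> z - \<phi> x \<in> A}) x y})"

definition leaves ::
    "('a, 'e::euclidean_space) mfd \<Rightarrow> ('a set \<times> ('a \<Rightarrow> 'e) \<times> 'e set) set \<Rightarrow> 'a set set" where
  "leaves M \<A> = points M // (\<Union>c \<in> \<A>. plaque_rel (top_space M) c)\<^sup>+"

text \<open>
  A \<open>p\<close>-dimensional foliation is represented by its set of leaves, which determines the maximal
  foliation atlas.
\<close>

definition foliation :: "nat \<Rightarrow> ('a, 'e::euclidean_space) mfd \<Rightarrow> 'a set set \<Rightarrow> bool" where
  "foliation p M F \<longleftrightarrow> (\<exists>\<A>. foliation_atlas p M \<A> \<and> F = leaves M \<A>)"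

definition leaf_of :: "'a set set \<Rightarrow> 'a \<Rightarrow> 'a set" where
  "leaf_of F x = (THE L. L \<in> F \<and> x \<in> L)"

text \<open>
  The restriction of a foliation to a subset \<open>S\<close> that is a union of leaves.  When the leaves lie
  in the fibres of \<open>s\<close>, this applies to the fibres and to the preimages of open sets.
\<close>

definition fol_restrict :: "'a set set \<Rightarrow> 'a set \<Rightarrow> 'a set set" where
  "fol_restrict F S = {L \<in> F. L \<subseteq> S}"

definition strictly_simple :: "('a, 'e::euclidean_space) mfd \<Rightarrow> 'a set set \<Rightarrow> bool" where
  "strictly_simple M F \<longleftrightarrow>
     (\<exists>(Q :: ('a set, 'e) mfd) d. smooth_manifold d Q \<and> points Q = F \<and>
        quotient_map (top_space M) (top_space Q) (leaf_of F) \<and>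
        submersion M Q (leaf_of F))"

definition fibre :: "('a, 'e) mfd \<Rightarrow> ('a \<Rightarrow> 'b) \<Rightarrow> 'b \<Rightarrow> 'a set" where
  "fibre N s x = {y \<in> points N. s y = x}"

definition fibre_mfd :: "('a, 'e::euclidean_space) mfd \<Rightarrow> ('a \<Rightarrow> 'b) \<Rightarrow> 'b \<Rightarrow> ('a, 'e) mfd" where
  "fibre_mfd N s x = submanifold N (fibre N s x)"

definition fibre_fol :: "('a, 'e) mfd \<Rightarrow> 'a set set \<Rightarrow> ('a \<Rightarrow> 'b) \<Rightarrow> 'b \<Rightarrow> 'a set set" where
  "fibre_fol N F s x = fol_restrict F (fibre N s x)"

definition locally_trivial_bundle ::
    "nat \<Rightarrow> ('a, 'e::euclidean_space) mfd \<Rightarrow> 'a set set \<Rightarrow> ('b, 'f::euclidean_space) mfd \<Rightarrow>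
       ('a \<Rightarrow> 'b) \<Rightarrow> bool" where
  "locally_trivial_bundle p N F M s \<longleftrightarrow>
     submersion N M s \<and> s ` points N = points M \<and>
     foliation p N F \<and> (\<forall>L\<in>F. \<exists>x \<in> points M. L \<subseteq> fibre N s x) \<and>
     (\<forall>x\<^sub>0 \<in> points M. \<forall>x \<in> points M. \<exists>U h.
        openin (top_space M) U \<and> x \<in> U \<and>
        diffeomorphism (submanifold N {y \<in> points N. s y \<in> U})
          (prod_mfd (fibre_mfd N s x\<^sub>0) (submanifold M U)) h \<and>
        (\<forall>y \<in> points N. s y \<in> U \<longrightarrow> snd (h y) = s y) \<and>
        (`) h ` fol_restrict F {y \<in> points N. s y \<in> U} =
          {L \<times> {u} | L u. L \<in> fibre_fol N F s x\<^sub>0 \<and> u \<in> U})"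

end

theory Submission
  imports Defs
begin

text \<open>
  A foliation \<open>F\<close> with Hausdorff leaf space is strictly simple as soon as every point has a
  saturated neighbourhood with a submersion into a vector space of fixed dimension whose fibres
  are the leaves.  The charts of the leaf space are the maps induced by such submersions, and they
  are compatible because a submersion has smooth local sections.

  If \<open>F\<close> is strictly simple, the projection \<open>s\<close> factors through the leaf space as a submersion, so
  in suitable charts of the leaf space \<open>s\<close> is a linear map \<open>P\<close>, and the leaf space of a fibre of \<open>s\<close>
  is locally a coset of the kernel of \<open>P\<close>.  Conversely, a local trivialization over \<open>U\<close> composed with
  charts of the leaf space of a single fibre and of \<open>U\<close> gives the required submersions.
\<close>

section \<open>Maps of class \<open>C\<^sup>k\<close>\<close>

text \<open>The Hausdorff property is the one condition on a leaf space that cannot be checked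
  locally, so leaves have to be separated by hand. For a fibre the separating sets come from the
  leaf space of the total space. For the total space they come from the base when the leaves lie
  over different points, and from the leaf space of the fixed fibre when they lie over the same
  point.

  The analytic core is that a submersion becomes linear after a smooth change of coordinates of its
  source; local sections, openness and slice charts are read off from this. It rests on an inverse
  function theorem for every order of differentiability, hence on inverting families of linear maps.
  As all models are subspaces, a derivative is determined only along the subspace, and each
  statement about derivatives has to be restricted accordingly. Submersions are mostly treated as
  maps into a subspace \<open>W\<close>, so that they are available before the leaf space is known
  to be a manifold.\<close>

lemma C_on_cong:
  assumes "C_on k S f" "\<And>x. x \<in> S \<Longrightarrow> f x = g x"
  shows "C_on k S g"
proof (cases k)
  case 0
  then show ?thesis
    using assms continuous_on_cong by force
next
  case (Suc j)
  then obtain f' where f': "\<forall>x\<in>S. (f has_derivative f' x) (at x within S)"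
      "\<forall>v. C_on j S (\<lambda>x. f' x v)"
    using assms by auto
  have "\<forall>x\<in>S. (g has_derivative f' x) (at x within S)"
    using f' assms by (metis has_derivative_transform)
  then show ?thesis
    using Suc f' by auto
qed

lemma C_on_subset: "C_on k S f \<Longrightarrow> T \<subseteq> S \<Longrightarrow> C_on k T f"
proof (induction k arbitrary: f)
  case 0
  then show ?case
    using continuous_on_subset by auto
next
  case (Suc k)
  then obtain f' where "\<forall>x\<in>S. (f has_derivative f' x) (at x within S)"
      "\<forall>v. C_on k S (\<lambda>x. f' x v)"
    by auto
  then have "\<forall>x\<in>T. (f has_derivative f' x) (at x within T)" "\<forall>v. C_on k T (\<lambda>x. f' x v)"
    using Suc by (blast intro: has_derivative_subset)+
  then show ?case
    by auto
qed

lemma C_on_SucD: "C_on (Suc k) S f \<Longrightarrow> C_on k S f"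
proof (induction k arbitrary: f)
  case 0
  then show ?case
    by (auto simp: continuous_on_eq_continuous_within intro: has_derivative_continuous)
next
  case (Suc k)
  then obtain f' where "\<forall>x\<in>S. (f has_derivative f' x) (at x within S)"
      "\<forall>v. C_on (Suc k) S (\<lambda>x. f' x v)"
    by auto
  then show ?case
    using Suc.IH by auto
qed

lemma C_on_imp_continuous_on: "C_on k S f \<Longrightarrow> continuous_on S f"
  by (induction k) (simp, metis C_on_SucD)

lemma C_on_const: "C_on k S (\<lambda>x. c)"
proof (induction k arbitrary: c)
  case (Suc k)
  then show ?case
    by (auto intro!: exI[of _ "\<lambda>x v. 0"])
qed simp

lemma C_on_bounded_linear: "bounded_linear f \<Longrightarrow> C_on k S f"
  by (cases k)
    (auto intro!: exI[of _ "\<lambda>x. f"] C_on_const bounded_linear_imp_has_derivative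
      linear_continuous_on)

lemma C_on_add: "C_on k S f \<Longrightarrow> C_on k S g \<Longrightarrow> C_on k S (\<lambda>x. f x + g x)"
proof (induction k arbitrary: f g)
  case 0
  then show ?case
    by (auto intro: continuous_intros)
next
  case (Suc k)
  then obtain f' g' where "\<forall>x\<in>S. (f has_derivative f' x) (at x within S)"
      "\<forall>v. C_on k S (\<lambda>x. f' x v)"
      "\<forall>x\<in>S. (g has_derivative g' x) (at x within S)"
      "\<forall>v. C_on k S (\<lambda>x. g' x v)"
    by auto
  then show ?case
    using Suc.IH by (auto intro!: exI[of _ "\<lambda>x v. f' x v + g' x v"] derivative_eq_intros)
qed

lemma C_on_sum:
  "finite I \<Longrightarrow> (\<And>i. i \<in> I \<Longrightarrow> C_on k S (f i)) \<Longrightarrow> C_on k S (\<lambda>x. \<Sum>i\<in>I. f i x)"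
  by (induction I rule: finite_induct) (auto intro: C_on_const C_on_add)

text \<open>The product rule yields two expressions of the same form with one factor differentiated,
  so the induction runs over both factors at once.\<close>

lemma C_on_bilinear:
  assumes "bounded_bilinear p" "C_on k S f" "C_on k S g"
  shows "C_on k S (\<lambda>x. p (f x) (g x))"
  using assms(2,3)
proof (induction k arbitrary: f g)
  case 0
  then show ?case
    using bounded_bilinear.continuous_on[OF assms(1)] by auto
next
  case (Suc k)
  obtain f' where f': "\<And>x. x \<in> S \<Longrightarrow> (f has_derivative f' x) (at x within S)"
      "\<And>v. C_on k S (\<lambda>x. f' x v)"
    using Suc.prems by auto
  obtain g' where g': "\<And>x. x \<in> S \<Longrightarrow> (g has_derivative g' x) (at x within S)"
      "\<And>v. C_on k S (\<lambda>x. g' x v)"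
    using Suc.prems by auto
  have "((\<lambda>x. p (f x) (g x)) has_derivative
      (\<lambda>v. p (f x) (g' x v) + p (f' x v) (g x))) (at x within S)" if "x \<in> S" for x
    by (rule bounded_bilinear.FDERIV[OF assms(1) f'(1)[OF that] g'(1)[OF that]])
  moreover have "C_on k S (\<lambda>x. p (f x) (g' x v) + p (f' x v) (g x))" for v
    by (rule C_on_add[OF Suc.IH[OF C_on_SucD[OF Suc.prems(1)] g'(2)]
          Suc.IH[OF f'(2) C_on_SucD[OF Suc.prems(2)]]])
  ultimately show ?case
    unfolding C_on.simps(2) by (intro exI[of _ "\<lambda>x v. p (f x) (g' x v) + p (f' x v) (g x)"]) blast
qed

lemma linear_eq_sum_Basis:
  fixes f :: "'a::euclidean_space \<Rightarrow> 'b::real_vector"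
  assumes "linear f"
  shows "f x = (\<Sum>b\<in>Basis. (x \<bullet> b) *\<^sub>R f b)"
proof -
  have "f x = f (\<Sum>b\<in>Basis. (x \<bullet> b) *\<^sub>R b)"
    by (simp add: euclidean_representation)
  then show ?thesis
    by (simp add: linear_sum[OF assms] linear_scale[OF assms])
qed

text \<open>\<open>C_on\<close> controls derivatives only in fixed directions, whereas the chain
  rule applies \<open>g' (f x)\<close> to the moving vector \<open>f' x v\<close>. Expanding that
  vector in \<open>Basis\<close> leaves fixed directions \<open>b\<close> with coefficients
  depending on \<open>x\<close>, to which \<open>C_on_bilinear\<close> and the induction hypothesis
  for \<open>\<lambda>y. g' y b\<close> apply.\<close>

lemma C_on_compose:
  assumes f: "C_on k S f" and g: "C_on k T g" and sub: "f ` S \<subseteq> T"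
  shows "C_on k S (g \<circ> f)"
  using f g
proof (induction k arbitrary: g)
  case 0
  then show ?case
    using sub continuous_on_compose[of S f g] continuous_on_subset[of T g] by auto
next
  case (Suc k)
  obtain f' where f': "\<And>x. x \<in> S \<Longrightarrow> (f has_derivative f' x) (at x within S)"
      "\<And>v. C_on k S (\<lambda>x. f' x v)"
    using Suc.prems by auto
  obtain g' where g': "\<And>x. x \<in> T \<Longrightarrow> (g has_derivative g' x) (at x within T)"
      "\<And>v. C_on k T (\<lambda>x. g' x v)"
    using Suc.prems by auto
  have "((g \<circ> f) has_derivative (g' (f x) \<circ> f' x)) (at x within S)" if "x \<in> S" for x
    using f'(1)[OF that] g'(1)[of "f x"] sub that
    by (intro diff_chain_within) (auto intro: has_derivative_subset)
  moreover have "C_on k S (\<lambda>x. (g' (f x) \<circ> f' x) v)" for v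
  proof -
    have "C_on k S (\<lambda>x. \<Sum>b\<in>Basis. (f' x v \<bullet> b) *\<^sub>R ((\<lambda>y. g' y b) \<circ> f) x)"
      using Suc.IH[OF C_on_SucD[OF Suc.prems(1)] g'(2)] f'(2)
      by (intro C_on_sum C_on_bilinear[OF bounded_bilinear_scaleR]
          C_on_bilinear[OF bounded_bilinear_inner]) (auto intro: C_on_const)
    moreover have "(\<Sum>b\<in>Basis. (f' x v \<bullet> b) *\<^sub>R ((\<lambda>y. g' y b) \<circ> f) x) = (g' (f x) \<circ> f' x) v"
      if "x \<in> S" for x
    proof -
      have "linear (g' (f x))"
        using g'(1)[of "f x"] that sub has_derivative_linear by blast
      then show ?thesis
        using linear_eq_sum_Basis[of "g' (f x)" "f' x v"] by simp
    qed
    ultimately show ?thesis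
      by (rule C_on_cong)
  qed
  ultimately show ?case
    unfolding C_on.simps(2) by (intro exI[of _ "\<lambda>x. g' (f x) \<circ> f' x"]) blast
qed

text \<open>A product rule with \<open>g\<close> merely continuous at \<open>x\<close>: as
  \<open>f\<close> vanishes there, the increment of \<open>g\<close> enters only multiplied by a
  term of order \<open>norm (y - x)\<close>. It serves where differentiability of the second factor
  is the very thing to be proved.\<close>

lemma has_derivative_scaleR_vanishing:
  fixes g :: "'a::real_normed_vector \<Rightarrow> 'b::real_normed_vector"
  assumes f: "(f has_derivative f') (at x within S)" and 0: "f x = 0"
    and g: "(g \<longlongrightarrow> g x) (at x within S)"
  shows "((\<lambda>z. f z *\<^sub>R g z) has_derivative (\<lambda>h. f' h *\<^sub>R g x)) (at x within S)"
proof -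
  obtain K where K: "\<And>h. \<bar>f' h\<bar> \<le> norm h * K"
    using bounded_linear.bounded[OF has_derivative_bounded_linear[OF f]] by auto
  define R where "R y = \<bar>f y - f x - f' (y - x)\<bar> / norm (y - x)" for y
  have R: "(R \<longlongrightarrow> 0) (at x within S)"
    using f unfolding has_derivative_iff_norm R_def by simp
  show ?thesis
  proof (rule has_derivativeI_sandwich[of 1])
    show "bounded_linear (\<lambda>h. f' h *\<^sub>R g x)"
      using has_derivative_bounded_linear[OF f] bounded_linear_scaleR_const by blast
    show "((\<lambda>y. R y * norm (g y) + K * norm (g y - g x)) \<longlongrightarrow> 0) (at x within S)"
      by (rule tendsto_eq_intros R g tendsto_norm | simp)+
    fix y assume "y \<noteq> x"
    have "f y *\<^sub>R g y - f x *\<^sub>R g x - f' (y - x) *\<^sub>R g x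
        = (f y - f x - f' (y - x)) *\<^sub>R g y + f' (y - x) *\<^sub>R (g y - g x)"
      by (simp add: 0 algebra_simps)
    also have "norm \<dots> \<le> \<bar>f y - f x - f' (y - x)\<bar> * norm (g y) + (norm (y - x) * K) * norm (g y - g x)"
      by (intro norm_triangle_mono) (auto intro: mult_right_mono K)
    finally show "norm (f y *\<^sub>R g y - f x *\<^sub>R g x - f' (y - x) *\<^sub>R g x) / norm (y - x)
        \<le> R y * norm (g y) + K * norm (g y - g x)"
      using \<open>y \<noteq> x\<close> by (simp add: R_def field_simps)
  qed auto
qed

text \<open>Injectivity of \<open>A x\<close> gives a bound
  \<open>c * norm w \<le> norm (A x w)\<close>, which survives with \<open>c / 2\<close> for
  \<open>A z\<close> near \<open>A x\<close>. Applied to \<open>inv (A z) v - u\<close>, whose image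
  under \<open>A z\<close> is \<open>A x u - A z u\<close>, it bounds the error by a quantity that
  tends to \<open>0\<close>.\<close>

lemma continuous_inv_linear:
  fixes A :: "'a::euclidean_space \<Rightarrow> 'b::euclidean_space \<Rightarrow> 'b"
  assumes lin: "\<And>x. x \<in> S \<Longrightarrow> linear (A x)" and bij: "\<And>x. x \<in> S \<Longrightarrow> bij (A x)"
    and C: "\<And>v. continuous_on S (\<lambda>x. A x v)"
  shows "continuous_on S (\<lambda>x. inv (A x) v)"
  unfolding continuous_on_def
proof
  fix x assume x: "x \<in> S"
  define u where "u = inv (A x) v"
  have u: "A x u = v"
    by (simp add: u_def bij[OF x] bij_is_surj surj_f_inv_f)
  obtain c where c: "c > 0" "\<And>w. c * norm w \<le> norm (A x w)"
    using linear_inj_bounded_below_pos[OF lin[OF x]] bij[OF x] by (metis bij_is_inj mult.commute)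
  have T: "((\<lambda>z. A z w) \<longlongrightarrow> A x w) (at x within S)" for w
    using C x by (auto simp: continuous_on_def)
  \<comment> \<open>Convergence is known only for each fixed vector; summing over
    \<open>Basis\<close> gives a bound of \<open>A z - A x\<close> that is uniform over
    directions.\<close>
  define D where "D z = (\<Sum>b\<in>Basis. norm (A z b - A x b))" for z
  have "(D \<longlongrightarrow> 0) (at x within S)"
    unfolding D_def using T by (intro tendsto_null_sum) (simp add: LIM_zero tendsto_norm_zero)
  then have "\<forall>\<^sub>F z in at x within S. D z < c / 2"
    using c(1) by (intro order_tendstoD) auto
  moreover have "\<forall>\<^sub>F z in at x within S. z \<in> S"
    by (simp add: eventually_at_filter)
  ultimately have ev: "\<forall>\<^sub>F z in at x within S.
      norm (inv (A z) v - u) \<le> (2 / c) * norm (A z u - A x u)"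
  proof eventually_elim
    case (elim z)
    have low: "c / 2 * norm w \<le> norm (A z w)" for w
    proof -
      have "linear (\<lambda>w. A z w - A x w)"
        using lin elim x by (intro linear_compose_sub) auto
      from linear_eq_sum_Basis[OF this, of w]
      have "norm (A z w - A x w) \<le> (\<Sum>b\<in>Basis. norm ((w \<bullet> b) *\<^sub>R (A z b - A x b)))"
        using norm_sum by metis
      also have "\<dots> \<le> (\<Sum>b\<in>Basis. norm w * norm (A z b - A x b))"
        by (intro sum_mono) (auto intro!: mult_right_mono Basis_le_norm)
      also have "\<dots> = norm w * D z"
        by (simp add: D_def sum_distrib_left)
      also have "\<dots> \<le> norm w * (c / 2)"
        using elim by (intro mult_left_mono) auto
      finally have "norm (A z w - A x w) \<le> norm w * (c / 2)" .
      moreover have "norm (A x w) \<le> norm (A z w) + norm (A z w - A x w)"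
        using norm_triangle_ineq2[of "A x w" "A z w"] by (simp add: norm_minus_commute)
      ultimately show ?thesis
        using c(2)[of w] by (simp add: field_simps)
    qed
    have "A z (inv (A z) v) = v"
      using bij elim by (simp add: bij_is_surj surj_f_inv_f)
    then have "A z (inv (A z) v - u) = A x u - A z u"
      using linear_diff[OF lin] elim u by metis
    then have "c / 2 * norm (inv (A z) v - u) \<le> norm (A x u - A z u)"
      using low[of "inv (A z) v - u"] by simp
    then show ?case
      using c(1) by (simp add: field_simps norm_minus_commute)
  qed
  moreover have "((\<lambda>z. (2 / c) * norm (A z u - A x u)) \<longlongrightarrow> 0) (at x within S)"
    using T[of u] by (intro tendsto_mult_right_zero) (simp add: LIM_zero tendsto_norm_zero)
  ultimately have "((\<lambda>z. inv (A z) v - u) \<longlongrightarrow> 0) (at x within S)"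
    by (rule Lim_null_comparison)
  then show "((\<lambda>z. inv (A z) v) \<longlongrightarrow> inv (A x) v) (at x within S)"
    unfolding u_def by (rule LIM_zero_cancel)
qed

text \<open>
  The derivative of \<open>x \<mapsto> (A x)\<inverse> v\<close> is \<open>- (A x)\<inverse> \<circ> (A' x) \<circ> (A x)\<inverse>\<close> applied to \<open>v\<close>, so each
  further derivative of \<open>A\<close> yields one of the inverse.
\<close>

lemma C_on_inv_linear:
  fixes A :: "'a::euclidean_space \<Rightarrow> 'b::euclidean_space \<Rightarrow> 'b"
  assumes lin: "\<And>x. x \<in> S \<Longrightarrow> linear (A x)" and bij: "\<And>x. x \<in> S \<Longrightarrow> bij (A x)"
    and C: "\<And>v. C_on k S (\<lambda>x. A x v)"
  shows "C_on k S (\<lambda>x. inv (A x) v)"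
  using C
proof (induction k arbitrary: v)
  case 0
  then show ?case
    by (simp add: continuous_inv_linear[OF lin bij])
next
  case (Suc k)
  have IH: "C_on k S (\<lambda>x. inv (A x) w)" for w
    using Suc.IH Suc.prems C_on_SucD by blast
  have cont: "continuous_on S (\<lambda>x. inv (A x) w)" for w
  proof (rule continuous_inv_linear[OF lin bij])
    show "continuous_on S (\<lambda>x. A x v)" for v
      using Suc.prems[of v] by (rule C_on_imp_continuous_on)
  qed
  have lini: "linear (inv (A x))" if "x \<in> S" for x
  proof -
    obtain g where g: "linear g" "g \<circ> A x = id"
      using linear_injective_left_inverse[OF lin bij_is_inj[OF bij]] \<open>x \<in> S\<close> by blast
    have "g = inv (A x)"
      using g(2) bij[OF that] by (metis bij_is_surj comp_assoc comp_id id_comp surj_iff)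
    then show ?thesis
      using g by simp
  qed
  have "\<forall>v. \<exists>A'. (\<forall>x\<in>S. ((\<lambda>x. A x v) has_derivative A' x) (at x within S)) \<and>
      (\<forall>h. C_on k S (\<lambda>x. A' x h))"
    using Suc.prems by simp
  then obtain A' where A': "\<And>v x. x \<in> S \<Longrightarrow> ((\<lambda>x. A x v) has_derivative A' v x) (at x within S)"
      "\<And>v h. C_on k S (\<lambda>x. A' v x h)"
    by metis
  \<comment> \<open>\<open>G x h\<close> is the derivative of \<open>A\<close> at \<open>x\<close>
    along \<open>h\<close>, applied to \<open>inv (A x) v\<close>, and \<open>B x h\<close> is minus
    its image under \<open>inv (A x)\<close>. Both are expanded in \<open>Basis\<close>, so that
    every term is a product of functions already known to be \<open>C_on k\<close>.\<close>
  define G where "G x h = (\<Sum>b\<in>Basis. (inv (A x) v \<bullet> b) *\<^sub>R A' b x h)" for x h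
  define B where "B x h = - (\<Sum>b\<in>Basis. (G x h \<bullet> b) *\<^sub>R inv (A x) b)" for x h
  have "((\<lambda>x. inv (A x) v) has_derivative B x) (at x within S)" if x: "x \<in> S" for x
  proof -
    define u where "u = inv (A x) v"
    have Axu: "A x u = v"
      by (simp add: u_def bij[OF x] bij_is_surj surj_f_inv_f)
    have "((\<lambda>z. \<Sum>b\<in>Basis. (u \<bullet> b) *\<^sub>R A z b) has_derivative G x) (at x within S)"
      unfolding G_def u_def[symmetric] using A'(1)[OF x]
      by (intro has_derivative_sum has_derivative_scaleR_right)
    then have dA: "((\<lambda>z. A z u) has_derivative G x) (at x within S)"
      using x linear_eq_sum_Basis[OF lin, of _ u]
      by (elim has_derivative_transform[rotated 2]) auto
    have Bx: "B x = (\<lambda>h. 0 - (\<Sum>b\<in>Basis. (G x h \<bullet> b) *\<^sub>R inv (A x) b))"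
      by (simp add: B_def fun_eq_iff)
    \<comment> \<open>The identity \<open>inv (A z) v = u - inv (A z) (A z u - A x u)\<close> is
      differentiated. Its coefficients \<open>(A z u - A x u) \<bullet> b\<close> vanish at
      \<open>z = x\<close>, so continuity of \<open>inv (A z) b\<close> is enough.\<close>
    have d: "((\<lambda>z. inv (A x) v - (\<Sum>b\<in>Basis. ((A z u - A x u) \<bullet> b) *\<^sub>R inv (A z) b))
        has_derivative B x) (at x within S)"
      unfolding Bx
    proof (intro has_derivative_diff has_derivative_const has_derivative_sum)
      fix b :: 'b
      have "((\<lambda>z. (A z u - A x u) \<bullet> b) has_derivative (\<lambda>h. G x h \<bullet> b)) (at x within S)"
        using dA by (auto intro!: derivative_eq_intros)
      then show "((\<lambda>z. ((A z u - A x u) \<bullet> b) *\<^sub>R inv (A z) b) has_derivative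
          (\<lambda>h. (G x h \<bullet> b) *\<^sub>R inv (A x) b)) (at x within S)"
        using cont x by (intro has_derivative_scaleR_vanishing) (auto simp: continuous_on_def)
    qed
    have e: "inv (A x) v - (\<Sum>b\<in>Basis. ((A z u - A x u) \<bullet> b) *\<^sub>R inv (A z) b) = inv (A z) v"
      if z: "z \<in> S" for z
    proof -
      have "(\<Sum>b\<in>Basis. ((A z u - A x u) \<bullet> b) *\<^sub>R inv (A z) b) = inv (A z) (A z u - A x u)"
        using linear_eq_sum_Basis[OF lini[OF z]] by metis
      also have "\<dots> = u - inv (A z) v"
        using bij[OF z] by (simp add: linear_diff[OF lini[OF z]] Axu bij_is_inj)
      finally show ?thesis
        by (simp add: u_def)
    qed
    show ?thesis
      by (rule has_derivative_transform[OF x _ d]) (simp add: e)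
  qed
  moreover have "C_on k S (\<lambda>x. B x h)" for h
  proof -
    have "C_on k S (\<lambda>x. G x h)"
      unfolding G_def
      by (intro C_on_sum C_on_bilinear[OF bounded_bilinear_scaleR]
          C_on_bilinear[OF bounded_bilinear_inner] C_on_const IH A') auto
    then have "C_on k S (\<lambda>x. \<Sum>b\<in>Basis. ((-1) * (G x h \<bullet> b)) *\<^sub>R inv (A x) b)"
      by (intro C_on_sum C_on_bilinear[OF bounded_bilinear_scaleR] C_on_bilinear[OF bounded_bilinear_mult]
          C_on_bilinear[OF bounded_bilinear_inner] C_on_const IH) auto
    then show ?thesis
      by (simp add: B_def sum_negf)
  qed
  ultimately show ?case
    unfolding C_on.simps(2) by (intro exI[of _ B]) blast
qed

lemma smooth_on_cong: "smooth_on S f \<Longrightarrow> (\<And>x. x \<in> S \<Longrightarrow> f x = g x) \<Longrightarrow> smooth_on S g"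
  unfolding smooth_on_def using C_on_cong by blast

lemma smooth_on_subset: "smooth_on S f \<Longrightarrow> T \<subseteq> S \<Longrightarrow> smooth_on T f"
  unfolding smooth_on_def using C_on_subset by blast

lemma smooth_on_compose: "smooth_on S f \<Longrightarrow> smooth_on T g \<Longrightarrow> f ` S \<subseteq> T \<Longrightarrow> smooth_on S (g \<circ> f)"
  unfolding smooth_on_def using C_on_compose by blast

lemma smooth_on_const: "smooth_on S (\<lambda>x. c)"
  unfolding smooth_on_def using C_on_const by blast

lemma smooth_on_linear: "linear f \<Longrightarrow> smooth_on S f" for f :: "'a::euclidean_space \<Rightarrow> 'b::euclidean_space"
  unfolding smooth_on_def using C_on_bounded_linear linear_conv_bounded_linear by blast

lemma smooth_on_add: "smooth_on S f \<Longrightarrow> smooth_on S g \<Longrightarrow> smooth_on S (\<lambda>x. f x + g x)"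
  unfolding smooth_on_def using C_on_add by blast

lemma smooth_on_diff:
  assumes "smooth_on S f" "smooth_on S g"
  shows "smooth_on S (\<lambda>x. f x - g x)"
proof -
  have "smooth_on S (uminus \<circ> g)"
    using assms(2) smooth_on_linear[OF linear_uminus, of UNIV] by (rule smooth_on_compose) simp
  from smooth_on_add[OF assms(1) this] show ?thesis
    by (rule smooth_on_cong) simp
qed

lemma smooth_on_imp_continuous_on: "smooth_on S f \<Longrightarrow> continuous_on S f"
  unfolding smooth_on_def using C_on_imp_continuous_on by blast

lemma smooth_on_has_derivative:
  assumes "smooth_on S f"
  obtains f' where "\<And>x. x \<in> S \<Longrightarrow> (f has_derivative f' x) (at x within S)"
proof -
  have "C_on (Suc 0) S f"
    using assms by (auto simp: smooth_on_def simp del: C_on.simps)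
  then show ?thesis
    using that by auto
qed

section \<open>Differentiation within a linear subspace\<close>

lemma subspace_projection:
  assumes "subspace (V :: 'a::euclidean_space set)"
  obtains p where "linear p" "range p \<subseteq> V" "\<And>x. x \<in> V \<Longrightarrow> p x = x"
  using linear_exists_left_inverse_on[OF linear_ident assms] by (auto simp: inj_on_def)

lemma at_within_openin_subspace:
  assumes "openin (top_of_set V) S" "a \<in> S"
  shows "at a within S = at a within V"
proof -
  obtain O' where "open O'" "S = V \<inter> O'"
    using assms(1) by (auto simp: openin_open)
  then show ?thesis
    using assms(2) by (intro at_within_nhd[of a O']) auto
qed

text \<open>Restricting \<open>f\<close> to the line through \<open>a\<close> in direction
  \<open>v\<close>, which stays in \<open>V\<close>, reduces the claim to uniqueness of an ordinary
  derivative at \<open>0\<close>.\<close>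

lemma has_derivative_unique_subspace:
  assumes V: "subspace V" "a \<in> V"
    and D: "(f has_derivative D) (at a within V)" and E: "(f has_derivative E) (at a within V)"
    and v: "v \<in> V"
  shows "D v = E v"
proof -
  have *: "((f \<circ> (\<lambda>t. a + t *\<^sub>R v)) has_derivative (D' \<circ> (\<lambda>t. t *\<^sub>R v))) (at 0)"
    if D': "(f has_derivative D') (at a within V)" for D'
  proof (rule diff_chain_within)
    show "((\<lambda>t. a + t *\<^sub>R v) has_derivative (\<lambda>t. t *\<^sub>R v)) (at 0)"
      by (auto intro!: derivative_eq_intros)
    show "(f has_derivative D') (at (a + 0 *\<^sub>R v) within range (\<lambda>t. a + t *\<^sub>R v))"
      using D' V v by (auto intro!: has_derivative_subset[OF D'] subspace_add subspace_scale)
  qed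
  from has_derivative_unique[OF *[OF D] *[OF E]] show ?thesis
    by (metis comp_apply scaleR_one)
qed

text \<open>For a projection \<open>p\<close> onto \<open>V'\<close> one has
  \<open>f = p \<circ> f\<close> on \<open>S\<close>, so \<open>D\<close> and
  \<open>p \<circ> D\<close> are both derivatives of \<open>f\<close> and agree on
  \<open>V\<close>.\<close>

lemma has_derivative_into_subspace:
  fixes f :: "'a::euclidean_space \<Rightarrow> 'b::euclidean_space"
  assumes V: "subspace V" "openin (top_of_set V) S" "a \<in> S" and V': "subspace V'"
    and D: "(f has_derivative D) (at a within V)" and f: "f ` S \<subseteq> V'"
    and v: "v \<in> V"
  shows "D v \<in> V'"
proof -
  obtain p where p: "linear p" "range p \<subseteq> V'" "\<And>x. x \<in> V' \<Longrightarrow> p x = x"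
    using subspace_projection[OF V'] by blast
  have aV: "a \<in> V"
    using V openin_imp_subset by blast
  have D': "(f has_derivative D) (at a within S)"
    using D at_within_openin_subspace[OF V(2,3)] by simp
  have "((p \<circ> f) has_derivative (p \<circ> D)) (at a within S)"
    using D' by (rule diff_chain_within) (simp add: linear_imp_has_derivative p(1))
  moreover have "f x = (p \<circ> f) x" if "x \<in> S" for x
    using that f p(3) by force
  ultimately have "(f has_derivative (p \<circ> D)) (at a within S)"
    using has_derivative_transform[OF V(3)] by blast
  then have "(f has_derivative (p \<circ> D)) (at a within V)"
    using at_within_openin_subspace[OF V(2,3)] by simp
  from has_derivative_unique_subspace[OF V(1) aV D this v] show ?thesis
    using p by (metis comp_apply rangeI subsetD)
qed

text \<open>Derivatives provided by different neighbourhoods may disagree in directions outside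
  \<open>V\<close> and cannot be glued as they are. Precomposing with a projection \<open>p\<close>
  onto \<open>V\<close> removes the ambiguity, since derivatives are unique along
  \<open>V\<close>.\<close>

lemma C_on_local:
  assumes V: "subspace V" and S: "openin (top_of_set V) S"
    and loc: "\<And>a. a \<in> S \<Longrightarrow> \<exists>T. openin (top_of_set V) T \<and> a \<in> T \<and> C_on k T f"
  shows "C_on k S f"
  using loc
proof (induction k arbitrary: f)
  case 0
  then have "\<exists>T. openin (top_of_set V) T \<and> a \<in> T \<and> continuous_on T f" if "a \<in> S" for a
    using that by auto
  then have "\<exists>T. openin (top_of_set V) T \<and> a \<in> T \<and> continuous (at a within T) f" if "a \<in> S" for a
    using that continuous_on_eq_continuous_within by metis
  then have "continuous (at a within V) f" if "a \<in> S" for a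
    using that at_within_openin_subspace continuous_within by metis
  then show ?case
    using at_within_openin_subspace[OF S] by (auto simp: continuous_on_eq_continuous_within continuous_within)
next
  case (Suc k)
  obtain p where p: "linear p" "range p \<subseteq> V" "\<And>x. x \<in> V \<Longrightarrow> p x = x"
    using subspace_projection[OF V] by blast
  have SV: "S \<subseteq> V"
    using S openin_imp_subset by blast
  have "\<exists>T f'. openin (top_of_set V) T \<and> a \<in> T \<and>
      (\<forall>x\<in>T. (f has_derivative f' x) (at x within V)) \<and> (\<forall>v. C_on k T (\<lambda>x. f' x v))"
    if "a \<in> S" for a
    using Suc.prems[OF that] at_within_openin_subspace[of V] by (metis C_on.simps(2))
  then obtain T f' where T: "\<And>a. a \<in> S \<Longrightarrow> openin (top_of_set V) (T a)" "\<And>a. a \<in> S \<Longrightarrow> a \<in> T a"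
    and f': "\<And>a x. a \<in> S \<Longrightarrow> x \<in> T a \<Longrightarrow> (f has_derivative f' a x) (at x within V)"
      "\<And>a v. a \<in> S \<Longrightarrow> C_on k (T a) (\<lambda>x. f' a x v)"
    by metis
  \<comment> \<open>At each \<open>x\<close> the derivative is taken from the neighbourhood chosen
    for \<open>x\<close> itself. Near \<open>a\<close> it coincides with
    \<open>f' a x \<circ> p\<close>, which is \<open>C_on k\<close> there.\<close>
  define g where "g x = f' x x \<circ> p" for x
  have "(f has_derivative g x) (at x within S)" if x: "x \<in> S" for x
  proof -
    have "(p has_derivative p) (at x within V)"
      by (simp add: linear_imp_has_derivative p(1))
    moreover have "(f has_derivative f' x x) (at (p x) within p ` V)"
      using f'(1)[OF x T(2)[OF x]] p x SV by (auto intro: has_derivative_subset)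
    ultimately have "((f \<circ> p) has_derivative g x) (at x within V)"
      unfolding g_def by (rule diff_chain_within)
    then have "(f has_derivative g x) (at x within V)"
      using has_derivative_transform[of x V f "f \<circ> p"] p(3) x SV by auto
    then show ?thesis
      using SV has_derivative_subset by blast
  qed
  moreover have "C_on k S (\<lambda>x. g x v)" for v
  proof (rule Suc.IH)
    fix a assume a: "a \<in> S"
    have "C_on k (T a \<inter> S) (\<lambda>x. f' a x (p v))"
      using f'(2)[OF a] by (rule C_on_subset) auto
    moreover have "f' a x (p v) = g x v" if "x \<in> T a \<inter> S" for x
    proof -
      have "f' a x (p v) = f' x x (p v)"
        using that a f'(1) T SV p(2)
        by (intro has_derivative_unique_subspace[OF V, of x f]) auto
      then show ?thesis
        by (simp add: g_def)
    qed
    ultimately have "C_on k (T a \<inter> S) (\<lambda>x. g x v)"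
      by (rule C_on_cong)
    then show "\<exists>T. openin (top_of_set V) T \<and> a \<in> T \<and> C_on k T (\<lambda>x. g x v)"
      using T[OF a] S a by (intro exI[of _ "T a \<inter> S"]) auto
  qed
  ultimately show ?case
    unfolding C_on.simps(2) by (intro exI[of _ g]) blast
qed

lemma smooth_on_local:
  assumes "subspace V" "openin (top_of_set V) S"
    and "\<And>a. a \<in> S \<Longrightarrow> \<exists>T. openin (top_of_set V) T \<and> a \<in> T \<and> smooth_on T f"
  shows "smooth_on S f"
  unfolding smooth_on_def
proof
  show "C_on k S f" for k
    using assms(3) by (intro C_on_local[OF assms(1,2)]) (metis smooth_on_def)
qed

text \<open>The inverse satisfies \<open>g' y = inv (f' (g y))\<close>: if \<open>g\<close> is
  \<open>C_on k\<close>, then \<open>C_on_inv_linear\<close> makes \<open>g'\<close> so, and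
  \<open>g\<close> is \<open>C_on (Suc k)\<close>. With derivative \<open>id\<close> at
  \<open>x0\<close>, the left inverse that starts the inverse function theorem is the
  identity.\<close>

lemma smooth_inverse_function:
  fixes f :: "'a::euclidean_space \<Rightarrow> 'a"
  assumes U: "open U" "x0 \<in> U" and f: "smooth_on U f"
    and D: "(f has_derivative id) (at x0)"
  obtains U' V g where "open U'" "U' \<subseteq> U" "x0 \<in> U'" "open V" "homeomorphism U' V f g"
    "smooth_on V g"
proof -
  obtain f' where f': "\<And>x. x \<in> U \<Longrightarrow> (f has_derivative f' x) (at x)"
    using smooth_on_has_derivative[OF f] U(1) by (metis at_within_open)
  \<comment> \<open>\<open>C_on\<close> picks a derivative anew for every order. On the open set
    \<open>U\<close> derivatives are unique, so the single \<open>f'\<close> has all orders of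
    smoothness.\<close>
  have Cf': "C_on k U (\<lambda>x. f' x v)" for k v
  proof -
    have "C_on (Suc k) U f"
      using f smooth_on_def by blast
    then obtain h where h: "\<And>x. x \<in> U \<Longrightarrow> (f has_derivative h x) (at x within U)"
        "\<And>v. C_on k U (\<lambda>x. h x v)"
      by auto
    then have "h x = f' x" if "x \<in> U" for x
      using that f' U(1) by (metis at_within_open has_derivative_unique)
    then show ?thesis
      using C_on_cong[OF h(2)[of v]] by simp
  qed
  define F where "F x = Blinfun (f' x)" for x
  have F: "blinfun_apply (F x) = f' x" if "x \<in> U" for x
    unfolding F_def using f'[OF that] has_derivative_bounded_linear bounded_linear_Blinfun_apply by blast
  have 1: "(f has_derivative blinfun_apply (F x)) (at x)" if "x \<in> U" for x
    using F f' that by simp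
  have "continuous_on U (\<lambda>x. blinfun_apply (F x) i)" for i
    using Cf'[of 0 i] F continuous_on_cong[of U U "\<lambda>x. blinfun_apply (F x) i" "\<lambda>x. f' x i"] by simp
  then have 2: "continuous_on U F"
    by (rule continuous_on_blinfun_componentwise)
  have "f' x0 = id"
    using f'[OF U(2)] D has_derivative_unique by blast
  then have 3: "id_blinfun o\<^sub>L F x0 = id_blinfun"
    using F[OF U(2)] by (auto intro!: blinfun_eqI)
  obtain U' V g g' where *: "open U'" "U' \<subseteq> U" "x0 \<in> U'" "open V" "f x0 \<in> V"
     and hom: "homeomorphism U' V f g"
     and g: "\<And>y. y \<in> V \<Longrightarrow> (g has_derivative (g' y)) (at y)"
     and g': "\<And>y. y \<in> V \<Longrightarrow> g' y = inv (blinfun_apply (F (g y)))"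
     and bij: "\<And>y. y \<in> V \<Longrightarrow> bij (blinfun_apply (F (g y)))"
    using inverse_function_theorem[OF U(1) 1 2 U(2) 3] by blast
  have gV: "g ` V \<subseteq> U"
    using hom *(2) by (auto simp: homeomorphism_def)
  have "C_on k V g" for k
  proof (induction k)
    case 0
    then show ?case
      using hom by (simp add: homeomorphism_def)
  next
    case (Suc k)
    have "C_on k V (\<lambda>y. inv (f' (g y)) v)" for v
    proof (rule C_on_inv_linear)
      show "linear (f' (g y))" if "y \<in> V" for y
        using gV f' that has_derivative_linear by (meson image_subset_iff)
      show "bij (f' (g y))" if "y \<in> V" for y
        using gV bij[OF that] F that by (metis image_subset_iff)
      show "C_on k V (\<lambda>y. f' (g y) v)" for v
        using C_on_compose[OF Suc Cf' gV] by (simp add: o_def)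
    qed
    then have "C_on k V (\<lambda>y. g' y v)" for v
      by (rule C_on_cong) (use g' F gV in \<open>simp add: image_subset_iff\<close>)
    then show ?case
      unfolding C_on.simps(2) using g has_derivative_at_withinI by (intro exI[of _ g']) blast
  qed
  then show ?thesis
    using that * hom by (simp add: smooth_on_def)
qed

section \<open>Local submersions between vector spaces\<close>

text \<open>Surjectivity is asked of the derivative at \<open>a\<close> alone, and only as a map
  from \<open>W\<close> onto \<open>W'\<close>, because its values outside \<open>W\<close> carry no
  information. Values near \<open>a\<close> must lie in \<open>W'\<close>, so that openness relative
  to \<open>W'\<close> and composition make sense.\<close>

definition local_submersion ::
    "'a::euclidean_space set \<Rightarrow> 'b::euclidean_space set \<Rightarrow> ('a \<Rightarrow> 'b) \<Rightarrow> 'a \<Rightarrow> bool" where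
  "local_submersion W W' f a \<longleftrightarrow>
     (\<exists>T D. openin (top_of_set W) T \<and> a \<in> T \<and> smooth_on T f \<and> f ` T \<subseteq> W' \<and>
        (f has_derivative D) (at a within W) \<and> D ` W = W')"

lemma openin_preimage_smooth:
  assumes "openin (top_of_set W) T" "smooth_on T f" "f ` T \<subseteq> W'" "openin (top_of_set W') T'"
  shows "openin (top_of_set W) (T \<inter> f -` T')"
  using assms continuous_openin_preimage[OF smooth_on_imp_continuous_on[OF assms(2)] _ assms(4)]
    openin_trans by blast

lemma local_submersion_subspace: "local_submersion W W' f a \<Longrightarrow> subspace W \<Longrightarrow> subspace W'"
  unfolding local_submersion_def using has_derivative_linear linear_subspace_image by blast

lemma local_submersion_dim_le: "local_submersion W W' f a \<Longrightarrow> dim W' \<le> dim W"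
  unfolding local_submersion_def using has_derivative_linear dim_image_le by blast

lemma local_submersion_in:
  assumes "local_submersion W W' f a"
  shows "a \<in> W" "f a \<in> W'"
  using assms openin_imp_subset unfolding local_submersion_def by blast+

lemma local_submersion_compose:
  assumes f: "local_submersion W W' f a" and g: "local_submersion W' W'' g (f a)"
  shows "local_submersion W W'' (g \<circ> f) a"
proof -
  obtain T D where T: "openin (top_of_set W) T" "a \<in> T" "smooth_on T f" "f ` T \<subseteq> W'"
      "(f has_derivative D) (at a within W)" "D ` W = W'"
    using f unfolding local_submersion_def by blast
  obtain T' D' where T': "openin (top_of_set W') T'" "f a \<in> T'" "smooth_on T' g" "g ` T' \<subseteq> W''"
      "(g has_derivative D') (at (f a) within W')" "D' ` W' = W''"
    using g unfolding local_submersion_def by blast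
  define S where "S = T \<inter> f -` T'"
  have S: "openin (top_of_set W) S" "a \<in> S"
    using openin_preimage_smooth[OF T(1,3,4) T'(1)] T(2) T'(2) by (auto simp: S_def)
  have "smooth_on S (g \<circ> f)"
    by (rule smooth_on_compose[OF smooth_on_subset[OF T(3)] T'(3)]) (auto simp: S_def)
  moreover have "((g \<circ> f) has_derivative (D' \<circ> D)) (at a within S)"
  proof (rule diff_chain_within)
    show "(f has_derivative D) (at a within S)"
      using T(5) by (rule has_derivative_subset) (use S openin_imp_subset in blast)
    show "(g has_derivative D') (at (f a) within f ` S)"
      using T'(5) by (rule has_derivative_subset) (use S_def T(4) in blast)
  qed
  moreover have "(D' \<circ> D) ` W = W''"
    using T(6) T'(6) by (simp flip: image_image)
  moreover have "(g \<circ> f) ` S \<subseteq> W''"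
    using T'(4) by (auto simp: S_def)
  ultimately show ?thesis
    using S at_within_openin_subspace[OF S] unfolding local_submersion_def by metis
qed

lemma local_submersion_cong:
  assumes f: "local_submersion W W' f a"
    and T0: "openin (top_of_set W) T0" "a \<in> T0" "\<And>x. x \<in> T0 \<Longrightarrow> f x = g x"
  shows "local_submersion W W' g a"
proof -
  obtain T D where T: "openin (top_of_set W) T" "a \<in> T" "smooth_on T f" "f ` T \<subseteq> W'"
      "(f has_derivative D) (at a within W)" "D ` W = W'"
    using f unfolding local_submersion_def by blast
  have S: "openin (top_of_set W) (T \<inter> T0)" "a \<in> T \<inter> T0"
    using T T0 by auto
  have "smooth_on (T \<inter> T0) g"
    by (rule smooth_on_cong[OF smooth_on_subset[OF T(3)]]) (use T0 in auto)
  moreover have "g ` (T \<inter> T0) \<subseteq> W'"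
    using T(4) T0(3) by force
  moreover have "(f has_derivative D) (at a within T \<inter> T0)"
    using T(5) at_within_openin_subspace[OF S] by simp
  then have "(g has_derivative D) (at a within T \<inter> T0)"
    using has_derivative_transform[of a "T \<inter> T0" g f] S(2) T0(3) by auto
  ultimately show ?thesis
    using S T(6) at_within_openin_subspace[OF S] unfolding local_submersion_def by metis
qed

lemma local_submersion_affine:
  assumes "linear P" "P ` W = W'" "subspace W" "a \<in> W" "c \<in> W'"
  shows "local_submersion W W' (\<lambda>x. P x + c) a"
proof -
  have "subspace W'"
    using assms linear_subspace_image by blast
  then have "(\<lambda>x. P x + c) ` W \<subseteq> W'"
    using assms by (auto intro: subspace_add)
  moreover have "((\<lambda>x. P x + c) has_derivative P) (at a within W)"
    using has_derivative_add[OF linear_imp_has_derivative[OF assms(1)] has_derivative_const] by simp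
  moreover have "smooth_on W (\<lambda>x. P x + c)"
    by (intro smooth_on_add smooth_on_linear smooth_on_const assms)
  ultimately show ?thesis
    unfolding local_submersion_def using assms by (intro exI[of _ W] exI[of _ P]) auto
qed

lemma local_submersion_linear:
  assumes "linear P" "P ` W = W'" "subspace W" "a \<in> W"
  shows "local_submersion W W' P a"
  using local_submersion_affine[OF assms, of 0] assms linear_subspace_image subspace_0 by fastforce

lemma smooth_on_map_prod:
  assumes "smooth_on S f" "smooth_on T g"
  shows "smooth_on (S \<times> T) (map_prod f g)"
proof -
  have 1: "smooth_on (S \<times> T) (f \<circ> fst)"
    by (rule smooth_on_compose[OF smooth_on_linear[OF linear_fst] assms(1)]) auto
  have 2: "smooth_on (S \<times> T) (g \<circ> snd)"
    by (rule smooth_on_compose[OF smooth_on_linear[OF linear_snd] assms(2)]) auto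
  have l1: "linear (\<lambda>x. (x, 0))" and l2: "linear (\<lambda>x. (0, x))"
    by (auto intro!: linearI)
  have "smooth_on (S \<times> T) (\<lambda>x. ((\<lambda>x. (x, 0)) \<circ> (f \<circ> fst)) x + ((\<lambda>x. (0, x)) \<circ> (g \<circ> snd)) x)"
    by (intro smooth_on_add smooth_on_compose[OF 1 smooth_on_linear[OF l1, of UNIV]]
        smooth_on_compose[OF 2 smooth_on_linear[OF l2, of UNIV]]) auto
  then show ?thesis
    by (rule smooth_on_cong) auto
qed

lemma local_submersion_map_prod:
  assumes f: "local_submersion W W' f a" and g: "local_submersion V V' g b"
  shows "local_submersion (W \<times> V) (W' \<times> V') (map_prod f g) (a, b)"
proof -
  obtain T D where T: "openin (top_of_set W) T" "a \<in> T" "smooth_on T f" "f ` T \<subseteq> W'"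
      "(f has_derivative D) (at a within W)" "D ` W = W'"
    using f unfolding local_submersion_def by blast
  obtain S E where S: "openin (top_of_set V) S" "b \<in> S" "smooth_on S g" "g ` S \<subseteq> V'"
      "(g has_derivative E) (at b within V)" "E ` V = V'"
    using g unfolding local_submersion_def by blast
  have "openin (top_of_set (W \<times> V)) (T \<times> S)"
    using T S by (intro openin_Times)
  moreover have "smooth_on (T \<times> S) (map_prod f g)"
    by (intro smooth_on_map_prod T S)
  moreover have "(map_prod f g has_derivative map_prod D E) (at (a, b) within W \<times> V)"
  proof -
    have fst: "(f has_derivative D) (at (fst (a, b)) within fst ` (W \<times> V))"
      using T(5) by (auto intro: has_derivative_subset)
    have snd: "(g has_derivative E) (at (snd (a, b)) within snd ` (W \<times> V))"
      using S(5) by (auto intro: has_derivative_subset)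
    have "((f \<circ> fst) has_derivative (D \<circ> fst)) (at (a, b) within W \<times> V)"
      by (rule diff_chain_within[OF has_derivative_fst[OF has_derivative_ident] fst])
    moreover have "((g \<circ> snd) has_derivative (E \<circ> snd)) (at (a, b) within W \<times> V)"
      by (rule diff_chain_within[OF has_derivative_snd[OF has_derivative_ident] snd])
    ultimately have "((\<lambda>x. ((f \<circ> fst) x, (g \<circ> snd) x)) has_derivative
        (\<lambda>x. ((D \<circ> fst) x, (E \<circ> snd) x))) (at (a, b) within W \<times> V)"
      by (rule has_derivative_Pair)
    moreover have "(\<lambda>x. ((f \<circ> fst) x, (g \<circ> snd) x)) = map_prod f g"
        "(\<lambda>x. ((D \<circ> fst) x, (E \<circ> snd) x)) = map_prod D E"
      by auto
    ultimately show ?thesis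
      by simp
  qed
  moreover have "map_prod D E ` (W \<times> V) = W' \<times> V'"
    using T(6) S(6) by (auto simp: map_prod_def image_iff)
  ultimately show ?thesis
    using T S unfolding local_submersion_def
    by (intro exI[of _ "T \<times> S"] exI[of _ "map_prod D E"]) auto
qed

text \<open>Differentiating \<open>f (g y) = y\<close> gives \<open>D (E w) = w\<close> for
  \<open>w \<in> W'\<close>. As \<open>E\<close> maps \<open>W'\<close> into \<open>W\<close> and
  \<open>D\<close> maps \<open>W\<close> into \<open>W'\<close>, the map \<open>D\<close> is onto
  \<open>W'\<close>. Equality of the dimensions is not presupposed; it results from using the lemma
  in both directions.\<close>

lemma local_submersion_inverse:
  assumes W: "subspace W" "subspace W'"
    and T: "openin (top_of_set W) T" "openin (top_of_set W') T'" "a \<in> T"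
    and f: "smooth_on T f" "f ` T \<subseteq> T'" and g: "smooth_on T' g" "g ` T' \<subseteq> T"
    and gf: "\<And>x. x \<in> T \<Longrightarrow> g (f x) = x" and fg: "\<And>y. y \<in> T' \<Longrightarrow> f (g y) = y"
  shows "local_submersion W W' f a"
proof -
  have fa: "f a \<in> T'"
    using T f by blast
  note within = at_within_openin_subspace[OF T(1,3)] at_within_openin_subspace[OF T(2) fa]
  have sub: "T \<subseteq> W" "T' \<subseteq> W'"
    using T openin_imp_subset by blast+
  obtain D where D: "(f has_derivative D) (at a within T)"
    using smooth_on_has_derivative[OF f(1)] T by metis
  obtain E where E: "(g has_derivative E) (at (f a) within T')"
    using smooth_on_has_derivative[OF g(1)] fa by metis
  have E': "(g has_derivative E) (at (f a) within W')"
    using E within by simp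
  have "((f \<circ> g) has_derivative (D \<circ> E)) (at (f a) within T')"
    by (rule diff_chain_within[OF E])
      (use D gf[OF T(3)] g(2) in \<open>auto intro: has_derivative_subset\<close>)
  then have "((\<lambda>x. x) has_derivative (D \<circ> E)) (at (f a) within W')"
    using has_derivative_transform[of "f a" T' "\<lambda>x. x" "f \<circ> g"] fg fa within by simp
  then have DE: "D (E w) = w" if "w \<in> W'" for w
    using has_derivative_unique_subspace[OF W(2) _ _ has_derivative_ident that, of "f a" "D \<circ> E"] fa sub
    by auto
  have "D v \<in> W'" if "v \<in> W" for v
    using has_derivative_into_subspace[OF W(1) T(1,3) W(2) _ _ that] D within f(2) sub by auto
  moreover have "E w \<in> W" if "w \<in> W'" for w
    using has_derivative_into_subspace[OF W(2) T(2) fa W(1) _ _ that] E within g(2) sub by auto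
  ultimately have "D ` W = W'"
    using DE by (auto simp: image_iff) metis
  then show ?thesis
    unfolding local_submersion_def using T D within f sub by (intro exI[of _ T] exI[of _ D]) auto
qed

text \<open>
  If \<open>D\<close> is the derivative of \<open>f\<close> at \<open>a\<close> and \<open>R\<close> a linear right inverse of \<open>D\<close>, then
  \<open>\<theta> x = x + R (f x - D x)\<close> satisfies \<open>D (\<theta> x) = f x\<close> and has derivative \<open>id\<close> at \<open>a\<close>.
\<close>

lemma local_submersion_normal_form:
  assumes W: "subspace W" and f: "local_submersion W W' f a"
  obtains P T T' \<theta> \<theta>' where "linear P" "P ` W = W'"
    "openin (top_of_set W) T" "a \<in> T" "openin (top_of_set W) T'"
    "homeomorphism T T' \<theta> \<theta>'" "smooth_on T \<theta>" "smooth_on T' \<theta>'" "\<And>x. x \<in> T \<Longrightarrow> f x = P (\<theta> x)"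
proof -
  obtain T0 D where T0: "openin (top_of_set W) T0" "a \<in> T0" "smooth_on T0 f" "f ` T0 \<subseteq> W'"
      and D: "(f has_derivative D) (at a within W)" "D ` W = W'"
    using f unfolding local_submersion_def by blast
  have lD: "linear D"
    using D has_derivative_linear by blast
  obtain R where R: "range R \<subseteq> W" "linear R" "\<And>w. w \<in> W' \<Longrightarrow> D (R w) = w"
    using linear_exists_right_inverse_on[OF lD W] D(2) by auto
  have sW': "subspace W'"
    using f W local_submersion_subspace by blast
  obtain p where p: "linear p" "range p \<subseteq> W" "\<And>x. x \<in> W \<Longrightarrow> p x = x"
    using subspace_projection[OF W] by blast
  obtain O' where O': "open O'" "T0 = W \<inter> O'"
    using T0(1) by (auto simp: openin_open)
  \<comment> \<open>The inverse function theorem lives on an open subset of the whole space. The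
    composite \<open>f \<circ> p\<close> extends \<open>f\<close> to one, with derivative
    \<open>D \<circ> p\<close> at \<open>a\<close>.\<close>
  define U where "U = p -` O'"
  have U: "open U"
    unfolding U_def using O'(1) linear_continuous_on[of p UNIV] p(1)
    by (simp add: continuous_on_open_vimage linear_conv_bounded_linear)
  have aW: "a \<in> W"
    using T0 openin_imp_subset by blast
  then have aU: "a \<in> U"
    using T0 O' p by (auto simp: U_def)
  have pU: "p ` U \<subseteq> T0"
    using p O' by (auto simp: U_def)
  define \<theta> where "\<theta> x = x + R ((f \<circ> p) x - (D \<circ> p) x)" for x
  have fp: "smooth_on U (f \<circ> p)"
    by (rule smooth_on_compose[OF smooth_on_linear[OF p(1)] T0(3) pU])
  have Dp: "smooth_on U (D \<circ> p)"
    by (intro smooth_on_linear linear_compose lD p)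
  have sm: "smooth_on U \<theta>"
  proof -
    have "smooth_on U (\<lambda>x. x + (R \<circ> (\<lambda>x. (f \<circ> p) x - (D \<circ> p) x)) x)"
      by (intro smooth_on_add smooth_on_linear[OF linear_ident]
          smooth_on_compose[OF smooth_on_diff[OF fp Dp] smooth_on_linear[OF R(2), of UNIV]]) auto
    then show ?thesis
      by (simp add: \<theta>_def[abs_def] o_def)
  qed
  have "((f \<circ> p) has_derivative (D \<circ> p)) (at a)"
  proof (rule diff_chain_within[OF linear_imp_has_derivative[OF p(1)]])
    show "(f has_derivative D) (at (p a) within range p)"
      using D(1) p(2) by (simp add: p(3)[OF aW] has_derivative_subset)
  qed
  moreover have "((D \<circ> p) has_derivative (D \<circ> p)) (at a)"
    by (intro linear_imp_has_derivative linear_compose lD p)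
  ultimately have "((\<lambda>x. (f \<circ> p) x - (D \<circ> p) x) has_derivative (\<lambda>v. (D \<circ> p) v - (D \<circ> p) v)) (at a)"
    by (rule has_derivative_diff)
  from has_derivative_add[OF has_derivative_ident
      has_derivative_compose[OF this linear_imp_has_derivative[OF R(2)]]]
  have der: "(\<theta> has_derivative id) (at a)"
    by (simp add: \<theta>_def[abs_def] id_def linear_0[OF R(2)])
  obtain U' V \<theta>' where U': "open U'" "U' \<subseteq> U" "a \<in> U'" "open V" "homeomorphism U' V \<theta> \<theta>'"
    "smooth_on V \<theta>'"
    using smooth_inverse_function[OF U aU sm der] by blast
  \<comment> \<open>\<open>\<theta>\<close> moves points by vectors of \<open>range R\<close>, which
    lies in \<open>W\<close>; hence it preserves both \<open>W\<close> and its complement, and the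
    homeomorphism can be restricted to \<open>W\<close>.\<close>
  have inW: "\<theta> x \<in> W \<longleftrightarrow> x \<in> W" for x
  proof -
    have "R ((f \<circ> p) x - (D \<circ> p) x) \<in> W"
      using R(1) by blast
    then show ?thesis
      unfolding \<theta>_def using W subspace_add subspace_diff by (metis add_diff_cancel_right')
  qed
  have "homeomorphism (W \<inter> U') (W \<inter> V) \<theta> \<theta>'"
  proof (rule homeomorphism_of_subsets[OF U'(5)])
    have "\<theta> ` U' = V"
      using U'(5) by (simp add: homeomorphism_def)
    then show "\<theta> ` (W \<inter> U') = W \<inter> V"
      using inW by blast
  qed auto
  moreover have "smooth_on (W \<inter> U') \<theta>" "smooth_on (W \<inter> V) \<theta>'"
    using sm U'(2,6) smooth_on_subset by blast+
  moreover have "f x = D (\<theta> x)" if "x \<in> W \<inter> U'" for x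
  proof -
    have x: "p x = x" "x \<in> T0"
      using that U'(2) O'(2) p by (auto simp: U_def)
    have "f x \<in> W'" "D x \<in> W'"
      using T0(4) x D(2) that by auto
    then have "D (R (f x - D x)) = f x - D x"
      using R(3) sW' subspace_diff by blast
    then show ?thesis
      by (simp add: \<theta>_def x linear_add[OF lD])
  qed
  moreover have "openin (top_of_set W) (W \<inter> U')" "openin (top_of_set W) (W \<inter> V)"
    using U' by auto
  ultimately show ?thesis
    using that[OF lD D(2)] aW U'(3) by blast
qed

text \<open>In coordinates where \<open>f\<close> is the linear map \<open>P\<close>, an affine
  right inverse of \<open>P\<close> is a section, and \<open>\<theta>'\<close> carries it
  back.\<close>

lemma local_submersion_section:
  assumes W: "subspace W" and f: "local_submersion W W' f a"
    and S: "openin (top_of_set W) S" "a \<in> S"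
  obtains \<sigma> T' where "openin (top_of_set W') T'" "f a \<in> T'" "smooth_on T' \<sigma>" "\<sigma> (f a) = a"
    "\<sigma> ` T' \<subseteq> S" "\<And>w. w \<in> T' \<Longrightarrow> f (\<sigma> w) = w"
proof -
  obtain P T U \<theta> \<theta>' where P: "linear P" "P ` W = W'"
    and T: "openin (top_of_set W) T" "a \<in> T" "openin (top_of_set W) U"
    and hom: "homeomorphism T U \<theta> \<theta>'" and sm: "smooth_on T \<theta>" "smooth_on U \<theta>'"
    and fP: "\<And>x. x \<in> T \<Longrightarrow> f x = P (\<theta> x)"
    using local_submersion_normal_form[OF W f] by metis
  obtain R where R: "range R \<subseteq> W" "linear R" "\<And>w. w \<in> W' \<Longrightarrow> P (R w) = w"
    using linear_exists_right_inverse_on[OF P(1) W] P(2) by auto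
  have sW': "subspace W'"
    using f W local_submersion_subspace by blast
  have fa: "f a \<in> W'"
    using f local_submersion_in by blast
  have \<theta>a: "\<theta> a \<in> U" "\<theta> a \<in> W"
    using hom T openin_imp_subset unfolding homeomorphism_def by blast+
  \<comment> \<open>The translation makes \<open>\<tau> (f a) = \<theta> a\<close>, so that the
    section passes through \<open>a\<close>. It preserves \<open>P (\<tau> w) = w\<close>, because
    \<open>P (\<theta> a) = f a = P (R (f a))\<close>.\<close>
  define \<tau> where "\<tau> w = R w + (\<theta> a - R (f a))" for w
  have \<tau>: "smooth_on W' \<tau>"
    unfolding \<tau>_def by (intro smooth_on_add smooth_on_linear[OF R(2)] smooth_on_const)
  have \<tau>W: "\<tau> ` W' \<subseteq> W"
    unfolding \<tau>_def using R(1) \<theta>a W by (auto intro!: subspace_add subspace_diff)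
  define T1 where "T1 = W' \<inter> \<tau> -` U"
  have T1: "openin (top_of_set W') T1" "f a \<in> T1"
    using openin_preimage_smooth[OF _ \<tau> \<tau>W T(3)] fa \<theta>a by (auto simp: T1_def \<tau>_def)
  have sm': "smooth_on T1 (\<theta>' \<circ> \<tau>)"
    by (rule smooth_on_compose[OF smooth_on_subset[OF \<tau>] sm(2)]) (auto simp: T1_def)
  have \<theta>'U: "\<theta>' u \<in> T" "\<theta> (\<theta>' u) = u" if "u \<in> U" for u
    using hom that by (auto simp: homeomorphism_def)
  have into: "(\<theta>' \<circ> \<tau>) ` T1 \<subseteq> W"
    using \<theta>'U(1) T(1) openin_imp_subset by (fastforce simp: T1_def)
  define T' where "T' = T1 \<inter> (\<theta>' \<circ> \<tau>) -` S"
  have a: "(\<theta>' \<circ> \<tau>) (f a) = a"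
    using hom T(2) by (simp add: \<tau>_def homeomorphism_def)
  have "openin (top_of_set W') T'" "f a \<in> T'"
    using openin_preimage_smooth[OF T1(1) sm' into S(1)] T1(2) a S(2) by (auto simp: T'_def)
  moreover have "smooth_on T' (\<theta>' \<circ> \<tau>)"
    using sm' by (rule smooth_on_subset) (auto simp: T'_def)
  moreover have "(\<theta>' \<circ> \<tau>) ` T' \<subseteq> S"
    by (auto simp: T'_def)
  moreover have "f ((\<theta>' \<circ> \<tau>) w) = w" if "w \<in> T'" for w
  proof -
    have w: "\<tau> w \<in> U" "w \<in> W'"
      using that by (auto simp: T'_def T1_def)
    have "f ((\<theta>' \<circ> \<tau>) w) = P (\<tau> w)"
      using fP \<theta>'U w by simp
    also have "\<dots> = P (R w) + (P (\<theta> a) - P (R (f a)))"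
      by (simp add: \<tau>_def linear_add[OF P(1)] linear_diff[OF P(1)])
    also have "\<dots> = w"
      using R(3) w fa fP[OF T(2)] by simp
    finally show ?thesis .
  qed
  ultimately show ?thesis
    using that a by blast
qed

lemma local_submersion_openin_image:
  assumes "subspace W" "local_submersion W W' f a" "openin (top_of_set W) S" "a \<in> S"
  obtains T' where "openin (top_of_set W') T'" "f a \<in> T'" "T' \<subseteq> f ` S"
  using local_submersion_section[OF assms] by (metis image_eqI image_subset_iff subsetI)

text \<open>Near \<open>f a\<close> the factor \<open>k\<close> equals
  \<open>h \<circ> \<sigma>\<close> for a local section \<open>\<sigma>\<close> of \<open>f\<close>,
  so it is smooth although no regularity of it is given. From \<open>E (D1 v) = D2 v\<close> on
  \<open>W\<close> its derivative is onto \<open>W''\<close>. Smoothness of the transition maps of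
  the leaf space is obtained in this way.\<close>

lemma local_submersion_factor:
  assumes W: "subspace W" and f: "local_submersion W W' f a" and h: "local_submersion W W'' h a"
    and S: "openin (top_of_set W) S" "a \<in> S" and hk: "\<And>x. x \<in> S \<Longrightarrow> h x = k (f x)"
  shows "local_submersion W' W'' k (f a)"
proof -
  obtain T1 D1 where T1: "openin (top_of_set W) T1" "a \<in> T1" "smooth_on T1 f" "f ` T1 \<subseteq> W'"
      "(f has_derivative D1) (at a within W)" "D1 ` W = W'"
    using f unfolding local_submersion_def by blast
  obtain T2 D2 where T2: "openin (top_of_set W) T2" "a \<in> T2" "smooth_on T2 h" "h ` T2 \<subseteq> W''"
      "(h has_derivative D2) (at a within W)" "D2 ` W = W''"
    using h unfolding local_submersion_def by blast
  have "openin (top_of_set W) (S \<inter> T2)" "a \<in> S \<inter> T2"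
    using S T2 by auto
  then obtain \<sigma> T' where T': "openin (top_of_set W') T'" "f a \<in> T'"
    and \<sigma>: "smooth_on T' \<sigma>" "\<sigma> (f a) = a" "\<sigma> ` T' \<subseteq> S \<inter> T2" "\<And>w. w \<in> T' \<Longrightarrow> f (\<sigma> w) = w"
    using local_submersion_section[OF W f] by metis
  have hs: "(h \<circ> \<sigma>) w = k w" if "w \<in> T'" for w
    using hk[of "\<sigma> w"] \<sigma>(3,4) that by auto
  have "smooth_on T' (h \<circ> \<sigma>)"
    by (rule smooth_on_compose[OF \<sigma>(1) T2(3)]) (use \<sigma> in auto)
  then have k: "smooth_on T' k"
    using hs by (rule smooth_on_cong)
  have kT: "k ` T' \<subseteq> W''"
  proof
    fix y assume "y \<in> k ` T'"
    then obtain w where "w \<in> T'" "y = h (\<sigma> w)"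
      using hs by auto
    then show "y \<in> W''"
      using T2(4) \<sigma>(3) by blast
  qed
  obtain E where E: "(k has_derivative E) (at (f a) within T')"
    using smooth_on_has_derivative[OF k] T' by metis
  define S' where "S' = T1 \<inter> f -` T' \<inter> S"
  have S': "openin (top_of_set W) S'" "a \<in> S'"
    using openin_preimage_smooth[OF T1(1,3,4) T'(1)] T1(2) T'(2) S by (auto simp: S'_def)
  have aW: "a \<in> W"
    using f local_submersion_in by blast
  have "((k \<circ> f) has_derivative (E \<circ> D1)) (at a within S')"
  proof (rule diff_chain_within)
    show "(f has_derivative D1) (at a within S')"
      using T1(5) at_within_openin_subspace[OF S'] by simp
    show "(k has_derivative E) (at (f a) within f ` S')"
      using E by (rule has_derivative_subset) (auto simp: S'_def)
  qed
  then have "(h has_derivative (E \<circ> D1)) (at a within W)"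
    using has_derivative_transform[of a S' h "k \<circ> f"] S'(2) hk at_within_openin_subspace[OF S']
    by (auto simp: S'_def)
  then have "E (D1 v) = D2 v" if "v \<in> W" for v
    using has_derivative_unique_subspace[OF W aW _ T2(5) that] by simp
  then have "E ` W' = W''"
    unfolding T1(6)[symmetric] T2(6)[symmetric] by (auto simp: image_iff)
  then show ?thesis
    unfolding local_submersion_def using T' k kT E at_within_openin_subspace[OF T'] by metis
qed

text \<open>With \<open>\<theta> a = 0\<close> the level set of \<open>f\<close> through
  \<open>a\<close> corresponds to the kernel of \<open>P\<close> and not to another coset of it. The
  slice charts of \<open>submanifold\<close> ask for a linear subspace.\<close>

lemma local_submersion_centred_normal_form:
  assumes W: "subspace W" and f: "local_submersion W W' f a"
  obtains P T T' \<theta> \<theta>' where "linear P" "P ` W = W'"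
    "openin (top_of_set W) T" "a \<in> T" "openin (top_of_set W) T'"
    "homeomorphism T T' \<theta> \<theta>'" "smooth_on T \<theta>" "smooth_on T' \<theta>'"
    "\<theta> a = 0" "\<And>x. x \<in> T \<Longrightarrow> f x = P (\<theta> x) + f a"
proof -
  obtain P T T' \<theta> \<theta>' where P: "linear P" "P ` W = W'"
    and T: "openin (top_of_set W) T" "a \<in> T" "openin (top_of_set W) T'"
    and hom: "homeomorphism T T' \<theta> \<theta>'" and sm: "smooth_on T \<theta>" "smooth_on T' \<theta>'"
    and fP: "\<And>x. x \<in> T \<Longrightarrow> f x = P (\<theta> x)"
    using local_submersion_normal_form[OF W f] by metis
  define c where "c = \<theta> a"
  define S where "S = W \<inter> (\<lambda>x. x + c) -` T'"
  have cW: "c \<in> W"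
    using hom T openin_imp_subset unfolding homeomorphism_def c_def by blast
  have T'W: "T' \<subseteq> W"
    using T openin_imp_subset by blast
  have plus: "smooth_on A (\<lambda>x. x + d)" for A and d :: 'a
    by (intro smooth_on_add smooth_on_linear[OF linear_ident] smooth_on_const)
  have S: "openin (top_of_set W) S"
    unfolding S_def
    by (rule openin_preimage_smooth[OF _ plus _ T(3)]) (use cW W subspace_add in auto)
  have S_iff: "x - c \<in> S \<longleftrightarrow> x \<in> T'" for x
    using T'W cW W subspace_diff by (auto simp: S_def)
  have "smooth_on T ((\<lambda>x. x + (- c)) \<circ> \<theta>)"
    by (rule smooth_on_compose[OF sm(1) plus[of UNIV]]) auto
  then have sm1: "smooth_on T (\<lambda>x. \<theta> x - c)"
    by (simp add: o_def)
  have "smooth_on S (\<theta>' \<circ> (\<lambda>x. x + c))"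
    by (rule smooth_on_compose[OF plus sm(2)]) (auto simp: S_def)
  then have sm2: "smooth_on S (\<lambda>x. \<theta>' (x + c))"
    by (simp add: o_def)
  have "homeomorphism T S (\<lambda>x. \<theta> x - c) (\<lambda>x. \<theta>' (x + c))"
    unfolding homeomorphism_def
  proof (intro conjI ballI smooth_on_imp_continuous_on sm1 sm2)
    show "(\<lambda>x. \<theta> x - c) ` T = S"
    proof -
      have "\<theta> ` T = T'"
        using hom by (simp add: homeomorphism_def)
      moreover have "S = (\<lambda>x. x - c) ` T'"
      proof
        show "S \<subseteq> (\<lambda>x. x - c) ` T'"
          by (rule subsetI, rule_tac x = "x + c" in image_eqI) (auto simp: S_def)
      qed (use S_iff in auto)
      moreover have "(\<lambda>x. \<theta> x - c) ` T = (\<lambda>x. x - c) ` (\<theta> ` T)"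
        by (simp only: image_image)
      ultimately show ?thesis
        by (simp only:)
    qed
    show "(\<lambda>x. \<theta>' (x + c)) ` S = T"
    proof -
      have "(\<lambda>x. x + c) ` S = T'"
      proof
        show "T' \<subseteq> (\<lambda>x. x + c) ` S"
          by (rule subsetI, rule_tac x = "x - c" in image_eqI) (auto simp: S_iff)
      qed (auto simp: S_def)
      moreover have "(\<lambda>x. \<theta>' (x + c)) ` S = \<theta>' ` ((\<lambda>x. x + c) ` S)"
        by (simp only: image_image)
      ultimately show ?thesis
        using hom by (simp only: homeomorphism_def)
    qed
  qed (use hom in \<open>auto simp: homeomorphism_def S_def\<close>)
  moreover have "f x = P (\<theta> x - c) + f a" if "x \<in> T" for x
    using fP that T(2) by (simp add: c_def linear_diff[OF P(1)])
  moreover have "\<theta> a - c = 0"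
    by (simp add: c_def)
  ultimately show ?thesis
    using that P T(1,2) S sm1 sm2 by blast
qed

section \<open>Charts and submersions of manifolds\<close>

lemma subspace_model_space [simp]: "subspace (model_space c)"
  by (simp add: model_space_def split: prod.split)

lemma is_chart_openin: "is_chart d X (U, \<phi>) \<Longrightarrow> openin X U"
  by (simp add: is_chart_def)

lemma is_chart_inj: "is_chart d X (U, \<phi>) \<Longrightarrow> inj_on \<phi> U"
  using openin_subset[of X U]
  by (auto simp: is_chart_def homeomorphic_eq_everything_map Int_absorb1 topspace_subtopology)

text \<open>With an empty domain \<open>model_space\<close> is \<open>{0}\<close> while
  \<open>d\<close> need not be \<open>0\<close>, so dimensions can be compared only for charts that
  contain a point.\<close>

lemma is_chart_dim:
  assumes "is_chart d X (U, \<phi>)" "U \<noteq> {}"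
  shows "dim (model_space (U, \<phi>)) = d"
  using assms model_space_eq[of _ \<phi> U] by (auto simp: is_chart_def)

lemma is_chart_openin_image:
  assumes c: "is_chart d X (U, \<phi>)" and A: "openin X A" "A \<subseteq> U"
  shows "openin (top_of_set (model_space (U, \<phi>))) (\<phi> ` A)"
proof (cases "U = {}")
  case True
  then show ?thesis
    using A by simp
next
  case False
  obtain V where V: "subspace V" "openin (top_of_set V) (\<phi> ` U)"
      "homeomorphic_map (subtopology X U) (top_of_set (\<phi> ` U)) \<phi>"
    using c by (auto simp: is_chart_def)
  have "openin (subtopology X U) A"
    using A by (metis inf.absorb_iff2 openin_subtopology_Int2)
  then have "openin (top_of_set (\<phi> ` U)) (\<phi> ` A)"
    using homeomorphic_imp_open_map[OF V(3)] by (simp add: open_map_def)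
  then show ?thesis
    using V(2) model_space_eq[OF V(1,2) False] openin_trans by metis
qed

lemma is_chart_openin_vimage:
  assumes c: "is_chart d X (U, \<phi>)" and S: "openin (top_of_set (model_space (U, \<phi>))) S"
  shows "openin X {z \<in> U. \<phi> z \<in> S}"
proof (cases "U = {}")
  case True
  then show ?thesis
    by simp
next
  case False
  obtain V where V: "subspace V" "openin (top_of_set V) (\<phi> ` U)"
      "homeomorphic_map (subtopology X U) (top_of_set (\<phi> ` U)) \<phi>"
    using c by (auto simp: is_chart_def)
  obtain T where T: "open T" "S = V \<inter> T"
    using S model_space_eq[OF V(1,2) False] by (auto simp: openin_open)
  have U: "openin X U"
    using c by (rule is_chart_openin)
  then have top: "topspace (subtopology X U) = U"
    using openin_subset by (auto simp: topspace_subtopology)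
  have "continuous_map (subtopology X U) euclidean \<phi>"
    using homeomorphic_imp_continuous_map[OF V(3)] by (simp add: continuous_map_in_subtopology)
  then have "openin (subtopology X U) {z \<in> topspace (subtopology X U). \<phi> z \<in> T}"
    using T(1) openin_continuous_map_preimage by fastforce
  then have "openin X {z \<in> U. \<phi> z \<in> T}"
    using U openin_trans_full unfolding top by blast
  moreover have "{z \<in> U. \<phi> z \<in> S} = {z \<in> U. \<phi> z \<in> T}"
    using T(2) V(2) openin_imp_subset by blast
  ultimately show ?thesis
    by simp
qed

lemma is_chartI:
  assumes U: "openin X U" and V: "subspace V" "dim V = d" and inj: "inj_on \<phi> U"
    and cont: "\<And>S. open S \<Longrightarrow> openin X {z \<in> U. \<phi> z \<in> S}"
    and op: "\<And>A. openin X A \<Longrightarrow> A \<subseteq> U \<Longrightarrow> openin (top_of_set V) (\<phi> ` A)"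
  shows "is_chart d X (U, \<phi>)"
proof -
  have top: "topspace (subtopology X U) = U"
    using U openin_subset by (auto simp: topspace_subtopology)
  have sub: "openin (subtopology X U) A \<longleftrightarrow> openin X A \<and> A \<subseteq> U" for A
    using U openin_open_subtopology by blast
  have "homeomorphic_map (subtopology X U) (top_of_set (\<phi> ` U)) \<phi>"
  proof (rule bijective_open_imp_homeomorphic_map)
    show "continuous_map (subtopology X U) (top_of_set (\<phi> ` U)) \<phi>"
    proof -
      have "continuous_map (subtopology X U) euclidean \<phi>"
        unfolding continuous_map_def top sub using cont by auto
      then show ?thesis
        by (simp add: continuous_map_in_subtopology top image_subset_iff_funcset)
    qed
    show "open_map (subtopology X U) (top_of_set (\<phi> ` U)) \<phi>"
      unfolding open_map_def
    proof (intro allI impI)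
      fix A assume "openin (subtopology X U) A"
      then have A: "openin X A" "A \<subseteq> U"
        using sub by auto
      then have "openin (top_of_set V) (\<phi> ` A)"
        by (rule op)
      moreover have "\<phi> ` U \<subseteq> V"
        using op[OF U] openin_imp_subset by blast
      ultimately show "openin (top_of_set (\<phi> ` U)) (\<phi> ` A)"
        using A(2) by (intro openin_subset_trans[of V "\<phi> ` A" "\<phi> ` U"]) auto
    qed
  qed (simp_all add: top inj del: topspace_subtopology)
  then show ?thesis
    using U V op[OF U] unfolding is_chart_def by blast
qed

lemma compatible_sym: "compatible c c' \<Longrightarrow> compatible c' c"
  by (auto simp: compatible_def Int_commute split: prod.splits)

lemma max_atlas_compatible_atlas:
  assumes "c \<in> max_atlas N" "c' \<in> atlas N"
  shows "compatible c c'" "compatible c' c"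
proof -
  show "compatible c c'"
    using assms by (simp add: max_atlas_def)
  then show "compatible c' c"
    by (rule compatible_sym)
qed

lemma compatible_smooth: "compatible (U, \<phi>) (V, \<psi>) \<Longrightarrow> smooth_on (\<phi> ` (U \<inter> V)) (\<psi> \<circ> inv_into U \<phi>)"
  by (simp add: compatible_def)

lemma local_submersion_transition:
  assumes c: "is_chart d X (U, \<phi>)" "is_chart d' X (V, \<psi>)" "compatible (U, \<phi>) (V, \<psi>)"
    and y: "y \<in> U" "y \<in> V"
  shows "local_submersion (model_space (U, \<phi>)) (model_space (V, \<psi>)) (\<psi> \<circ> inv_into U \<phi>) (\<phi> y)"
proof (rule local_submersion_inverse[where g = "\<phi> \<circ> inv_into V \<psi>" and
      T = "\<phi> ` (U \<inter> V)" and T' = "\<psi> ` (U \<inter> V)"])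
  have "openin X (U \<inter> V)"
    using c is_chart_openin by blast
  then show "openin (top_of_set (model_space (U, \<phi>))) (\<phi> ` (U \<inter> V))"
      "openin (top_of_set (model_space (V, \<psi>))) (\<psi> ` (U \<inter> V))"
    using is_chart_openin_image c by blast+
  show "smooth_on (\<phi> ` (U \<inter> V)) (\<psi> \<circ> inv_into U \<phi>)" "smooth_on (\<psi> ` (U \<inter> V)) (\<phi> \<circ> inv_into V \<psi>)"
    using c(3) by (auto simp: compatible_def)
qed (use is_chart_inj[OF c(1)] is_chart_inj[OF c(2)] y in auto)

lemma local_submersion_chart_change:
  assumes c: "is_chart d X (U, \<phi>)" "is_chart d' X (V, \<psi>)" "compatible (U, \<phi>) (V, \<psi>)"
    and y: "y \<in> U" "y \<in> V"
    and g: "local_submersion (model_space (V, \<psi>)) W (g \<circ> inv_into V \<psi>) (\<psi> y)"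
  shows "local_submersion (model_space (U, \<phi>)) W (g \<circ> inv_into U \<phi>) (\<phi> y)"
proof (rule local_submersion_cong)
  note inj = is_chart_inj[OF c(1)] is_chart_inj[OF c(2)]
  have "(\<psi> \<circ> inv_into U \<phi>) (\<phi> y) = \<psi> y"
    using inj y by simp
  then show "local_submersion (model_space (U, \<phi>)) W
      ((g \<circ> inv_into V \<psi>) \<circ> (\<psi> \<circ> inv_into U \<phi>)) (\<phi> y)"
    using local_submersion_compose[OF local_submersion_transition[OF c y]] g by simp
  have "openin X (U \<inter> V)"
    using c is_chart_openin by blast
  then show "openin (top_of_set (model_space (U, \<phi>))) (\<phi> ` (U \<inter> V))"
    using is_chart_openin_image c by blast
  show "((g \<circ> inv_into V \<psi>) \<circ> (\<psi> \<circ> inv_into U \<phi>)) x = (g \<circ> inv_into U \<phi>) x"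
    if "x \<in> \<phi> ` (U \<inter> V)" for x
    using that inj by auto
qed (use y in auto)

section \<open>Atlases and maximal atlases\<close>

lemma smooth_manifold_is_chart: "smooth_manifold n N \<Longrightarrow> c \<in> atlas N \<Longrightarrow> is_chart n (top_space N) c"
  by (simp add: smooth_manifold_def)

lemma smooth_manifold_chart_at:
  assumes "smooth_manifold n N" "y \<in> points N"
  obtains U \<phi> where "(U, \<phi>) \<in> atlas N" "y \<in> U"
proof -
  have "y \<in> (\<Union>(U, \<phi>) \<in> atlas N. U)"
    using assms unfolding smooth_manifold_def by blast
  then show ?thesis
    using that by auto
qed

lemma atlas_subset_max_atlas: "smooth_manifold n N \<Longrightarrow> atlas N \<subseteq> max_atlas N"
  by (auto simp: smooth_manifold_def max_atlas_def)

text \<open>\<open>max_atlas\<close> leaves the dimension of a chart open. Around a point of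
  \<open>U\<close> the transition maps to and from a chart of \<open>atlas N\<close> are both
  submersions, so neither model space has the smaller dimension.\<close>

lemma max_atlas_is_chart:
  assumes N: "smooth_manifold n N" and c: "(U, \<phi>) \<in> max_atlas N" and U: "U \<noteq> {}"
  shows "is_chart n (top_space N) (U, \<phi>)"
proof -
  obtain d where d: "is_chart d (top_space N) (U, \<phi>)"
    using c by (auto simp: max_atlas_def)
  obtain y where y: "y \<in> U"
    using U by blast
  then have "y \<in> points N"
    using openin_subset[OF is_chart_openin[OF d]] by blast
  then obtain V \<psi> where V: "(V, \<psi>) \<in> atlas N" "y \<in> V"
    using smooth_manifold_chart_at[OF N] by metis
  note V' = smooth_manifold_is_chart[OF N V(1)]
  have "compatible (U, \<phi>) (V, \<psi>)" "compatible (V, \<psi>) (U, \<phi>)"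
    using max_atlas_compatible_atlas c V(1) by blast+
  from local_submersion_dim_le[OF local_submersion_transition[OF d V' this(1) y V(2)]]
    local_submersion_dim_le[OF local_submersion_transition[OF V' d this(2) V(2) y]]
  have "dim (model_space (U, \<phi>)) = dim (model_space (V, \<psi>))"
    by simp
  then show ?thesis
    using d U is_chart_dim[OF d U] is_chart_dim[OF V'] V(2) by auto
qed

text \<open>Membership in \<open>max_atlas\<close> gives compatibility with \<open>atlas N\<close>
  only. Near each common point a chart \<open>\<alpha>\<close> of the atlas is inserted between
  \<open>\<phi>\<close> and \<open>\<psi>\<close>, and smoothness is local.\<close>

lemma max_atlas_compatible:
  assumes N: "smooth_manifold n N" and c: "c \<in> max_atlas N" "c' \<in> max_atlas N"
  shows "compatible c c'"
proof -
  have *: "smooth_on (\<phi> ` (U \<inter> V)) (\<psi> \<circ> inv_into U \<phi>)"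
    if U: "(U, \<phi>) \<in> max_atlas N" and V: "(V, \<psi>) \<in> max_atlas N" for U \<phi> V \<psi>
  proof (rule smooth_on_local)
    obtain d d' where d: "is_chart d (top_space N) (U, \<phi>)" and d': "is_chart d' (top_space N) (V, \<psi>)"
      using U V by (auto simp: max_atlas_def)
    note op = is_chart_openin[OF d] is_chart_openin[OF d']
    show "openin (top_of_set (model_space (U, \<phi>))) (\<phi> ` (U \<inter> V))"
      using is_chart_openin_image[OF d] op by blast
    fix a assume "a \<in> \<phi> ` (U \<inter> V)"
    then obtain y where y: "y \<in> U" "y \<in> V" "a = \<phi> y"
      by blast
    then have "y \<in> points N"
      using openin_subset[OF op(1)] by blast
    then obtain A \<alpha> where A: "(A, \<alpha>) \<in> atlas N" "y \<in> A"
      using smooth_manifold_chart_at[OF N] by metis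
    note A' = smooth_manifold_is_chart[OF N A(1)]
    have comp: "compatible (U, \<phi>) (A, \<alpha>)" "compatible (A, \<alpha>) (V, \<psi>)"
      using max_atlas_compatible_atlas U V A(1) by blast+
    define T where "T = \<phi> ` (U \<inter> V \<inter> A)"
    have "openin (top_of_set (model_space (U, \<phi>))) T"
      unfolding T_def
      by (intro is_chart_openin_image[OF d] openin_Int op is_chart_openin[OF A']) auto
    moreover have "a \<in> T"
      using y A by (auto simp: T_def)
    moreover have "smooth_on T ((\<psi> \<circ> inv_into A \<alpha>) \<circ> (\<alpha> \<circ> inv_into U \<phi>))"
      using is_chart_inj[OF d]
      by (intro smooth_on_compose[OF smooth_on_subset[OF compatible_smooth[OF comp(1)]]
            compatible_smooth[OF comp(2)]]) (auto simp: T_def)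
    then have "smooth_on T (\<psi> \<circ> inv_into U \<phi>)"
      by (rule smooth_on_cong) (use is_chart_inj[OF d] is_chart_inj[OF A'] in \<open>auto simp: T_def\<close>)
    ultimately show "\<exists>T. openin (top_of_set (model_space (U, \<phi>))) T \<and> a \<in> T \<and>
        smooth_on T (\<psi> \<circ> inv_into U \<phi>)"
      by blast
  qed simp
  obtain U \<phi> V \<psi> where eq: "c = (U, \<phi>)" "c' = (V, \<psi>)"
    by (cases c, cases c') simp
  have "smooth_on (\<psi> ` (U \<inter> V)) (\<phi> \<circ> inv_into V \<psi>)"
    using *[of V \<psi> U \<phi>] c eq by (metis Int_commute)
  then show ?thesis
    using *[of U \<phi> V \<psi>] c eq by (simp add: compatible_def)
qed

text \<open>With \<open>\<theta>\<close> from a normal form this yields charts in which a given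
  submersion is affine; with the identity as \<open>\<theta>\<close> it yields restrictions to open
  subsets.\<close>

lemma max_atlas_reparametrize:
  assumes N: "smooth_manifold n N" and V: "(V, \<psi>) \<in> max_atlas N" "V \<noteq> {}"
    and T: "openin (top_of_set (model_space (V, \<psi>))) T" "openin (top_of_set (model_space (V, \<psi>))) T'"
    and hom: "homeomorphism T T' \<theta> \<theta>'" and sm: "smooth_on T \<theta>" "smooth_on T' \<theta>'"
    and U: "openin (top_space N) U" "U \<subseteq> V" "\<psi> ` U \<subseteq> T"
  shows "(U, \<theta> \<circ> \<psi>) \<in> max_atlas N" "U \<noteq> {} \<Longrightarrow> model_space (U, \<theta> \<circ> \<psi>) = model_space (V, \<psi>)"
proof -
  let ?M = "model_space (V, \<psi>)"
  note V' = max_atlas_is_chart[OF N V]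
  note inj = is_chart_inj[OF V']
  have inv: "\<theta>' (\<theta> t) = t" if "t \<in> T" for t
    using hom that by (simp add: homeomorphism_def)
  have inj': "inj_on (\<theta> \<circ> \<psi>) U"
  proof (rule comp_inj_on)
    show "inj_on \<psi> U"
      using inj U(2) inj_on_subset by blast
    show "inj_on \<theta> (\<psi> ` U)"
      by (rule inj_on_inverseI[of _ \<theta>']) (use inv U(3) in auto)
  qed
  have TM: "T \<subseteq> ?M"
    using T openin_imp_subset by blast
  have op: "openin (top_of_set ?M) ((\<theta> \<circ> \<psi>) ` A)" if "openin (top_space N) A" "A \<subseteq> U" for A
  proof -
    have "openin (top_of_set ?M) (\<psi> ` A)"
      using is_chart_openin_image[OF V'] that U by blast
    then have "openin (top_of_set T) (\<psi> ` A)"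
      using TM U(3) that by (elim openin_subset_trans) auto
    then have "openin (top_of_set T') (\<theta> ` \<psi> ` A)"
      by (rule homeomorphism_imp_open_map[OF hom])
    then have "openin (top_of_set ?M) (\<theta> ` \<psi> ` A)"
      using T(2) openin_trans by blast
    then show ?thesis
      by (simp only: image_comp)
  qed
  have chart: "is_chart n (top_space N) (U, \<theta> \<circ> \<psi>)"
  proof (rule is_chartI[OF U(1) subspace_model_space is_chart_dim[OF V' V(2)] inj' _ op])
    fix S :: "'b set" assume S: "open S"
    have "openin (top_of_set ?M) (T \<inter> \<theta> -` S)"
      using continuous_openin_preimage_gen[OF smooth_on_imp_continuous_on[OF sm(1)] S] T(1)
        openin_trans by blast
    then have "openin (top_space N) ({z \<in> V. \<psi> z \<in> T \<inter> \<theta> -` S} \<inter> U)"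
      using is_chart_openin_vimage[OF V'] U(1) by blast
    moreover have "{z \<in> V. \<psi> z \<in> T \<inter> \<theta> -` S} \<inter> U = {z \<in> U. (\<theta> \<circ> \<psi>) z \<in> S}"
      using U by auto
    ultimately show "openin (top_space N) {z \<in> U. (\<theta> \<circ> \<psi>) z \<in> S}"
      by simp
  qed
  show "model_space (U, \<theta> \<circ> \<psi>) = ?M" if "U \<noteq> {}"
    using model_space_eq[OF subspace_model_space op[OF U(1)] that] by simp
  have "compatible (U, \<theta> \<circ> \<psi>) (A, \<alpha>)" if A: "(A, \<alpha>) \<in> atlas N" for A \<alpha>
  proof -
    note A' = smooth_manifold_is_chart[OF N A]
    have comp: "compatible (A, \<alpha>) (V, \<psi>)" "compatible (V, \<psi>) (A, \<alpha>)"
      using max_atlas_compatible_atlas V(1) A by blast+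
    have "smooth_on ((\<theta> \<circ> \<psi>) ` (U \<inter> A)) \<theta>'"
      using sm(2) by (rule smooth_on_subset) (use U hom in \<open>auto simp: homeomorphism_def\<close>)
    then have "smooth_on ((\<theta> \<circ> \<psi>) ` (U \<inter> A)) ((\<alpha> \<circ> inv_into V \<psi>) \<circ> \<theta>')"
      by (rule smooth_on_compose[OF _ compatible_smooth[OF comp(2)]]) (use U inv in auto)
    then have 1: "smooth_on ((\<theta> \<circ> \<psi>) ` (U \<inter> A)) (\<alpha> \<circ> inv_into U (\<theta> \<circ> \<psi>))"
    proof (rule smooth_on_cong)
      fix x assume "x \<in> (\<theta> \<circ> \<psi>) ` (U \<inter> A)"
      then obtain z where z: "z \<in> U" "z \<in> A" "x = (\<theta> \<circ> \<psi>) z"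
        by blast
      then have "inv_into U (\<theta> \<circ> \<psi>) x = z"
        using inj' by (simp del: comp_apply)
      moreover have "inv_into V \<psi> (\<theta>' x) = z"
        using z inv[of "\<psi> z"] U inj by (simp add: image_subset_iff subset_iff)
      ultimately show "((\<alpha> \<circ> inv_into V \<psi>) \<circ> \<theta>') x = (\<alpha> \<circ> inv_into U (\<theta> \<circ> \<psi>)) x"
        by simp
    qed
    have "smooth_on (\<alpha> ` (U \<inter> A)) (\<psi> \<circ> inv_into A \<alpha>)"
      using compatible_smooth[OF comp(1)] by (rule smooth_on_subset) (use U in auto)
    then have "smooth_on (\<alpha> ` (U \<inter> A)) (\<theta> \<circ> (\<psi> \<circ> inv_into A \<alpha>))"
      by (rule smooth_on_compose[OF _ sm(1)]) (use U is_chart_inj[OF A'] in auto)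
    then show ?thesis
      using 1 by (simp add: compatible_def comp_assoc)
  qed
  then show "(U, \<theta> \<circ> \<psi>) \<in> max_atlas N"
    using chart by (auto simp: max_atlas_def)
qed

lemma max_atlas_restrict:
  assumes N: "smooth_manifold n N" and V: "(V, \<psi>) \<in> max_atlas N"
    and U: "openin (top_space N) U" "U \<subseteq> V"
  shows "(U, \<psi>) \<in> max_atlas N"
proof (cases "V = {}")
  case True
  then show ?thesis
    using U V by simp
next
  case False
  note V' = max_atlas_is_chart[OF N V False]
  have "openin (top_of_set (model_space (V, \<psi>))) (\<psi> ` V)"
    using is_chart_openin_image[OF V'] is_chart_openin[OF V'] by blast
  moreover have "homeomorphism (\<psi> ` V) (\<psi> ` V) id id"
    by (simp add: homeomorphism_def)
  moreover have "smooth_on (\<psi> ` V) id"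
    using smooth_on_linear linear_id by blast
  ultimately show ?thesis
    using max_atlas_reparametrize(1)[OF N V False, of "\<psi> ` V" "\<psi> ` V" id id U] U by auto
qed

text \<open>The target is a subspace \<open>W\<close>, not a manifold, so that maps can be tested
  before the leaf space carries charts. One chart of the atlas suffices, since by
  \<open>submersive_at_max_atlas\<close> the condition does not depend on the chart.\<close>

definition submersive_at ::
    "('a, 'e::euclidean_space) mfd \<Rightarrow> 'g::euclidean_space set \<Rightarrow> ('a \<Rightarrow> 'g) \<Rightarrow> 'a \<Rightarrow> bool" where
  "submersive_at N W g y \<longleftrightarrow>
     (\<exists>(U, \<phi>) \<in> atlas N. y \<in> U \<and> local_submersion (model_space (U, \<phi>)) W (g \<circ> inv_into U \<phi>) (\<phi> y))"

lemma submersive_at_max_atlas: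
  assumes N: "smooth_manifold n N" and g: "submersive_at N W g y"
    and U: "(U, \<phi>) \<in> max_atlas N" "y \<in> U"
  shows "local_submersion (model_space (U, \<phi>)) W (g \<circ> inv_into U \<phi>) (\<phi> y)"
proof -
  obtain V \<psi> where V: "(V, \<psi>) \<in> atlas N" "y \<in> V"
      and l: "local_submersion (model_space (V, \<psi>)) W (g \<circ> inv_into V \<psi>) (\<psi> y)"
    using g by (auto simp: submersive_at_def)
  have "is_chart n (top_space N) (U, \<phi>)"
    using max_atlas_is_chart[OF N U(1)] U(2) by blast
  from local_submersion_chart_change[OF this smooth_manifold_is_chart[OF N V(1)]
      max_atlas_compatible_atlas(1)[OF U(1) V(1)] U(2) V(2) l]
  show ?thesis .
qed

lemma submersive_atI:
  assumes N: "smooth_manifold n N" and U: "(U, \<phi>) \<in> max_atlas N" "y \<in> U"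
    and l: "local_submersion (model_space (U, \<phi>)) W (g \<circ> inv_into U \<phi>) (\<phi> y)"
  shows "submersive_at N W g y"
proof -
  have c: "is_chart n (top_space N) (U, \<phi>)"
    using max_atlas_is_chart[OF N U(1)] U(2) by blast
  then have "y \<in> points N"
    using openin_subset[OF is_chart_openin] U(2) by blast
  then obtain V \<psi> where V: "(V, \<psi>) \<in> atlas N" "y \<in> V"
    using smooth_manifold_chart_at[OF N] by metis
  from local_submersion_chart_change[OF smooth_manifold_is_chart[OF N V(1)] c
      max_atlas_compatible_atlas(2)[OF U(1) V(1)] V(2) U(2) l]
  show ?thesis
    using V by (auto simp: submersive_at_def)
qed

lemma submersive_at_point:
  assumes "smooth_manifold n N" "submersive_at N W g y"
  shows "y \<in> points N" "g y \<in> W" "subspace W"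
proof -
  obtain V \<psi> where V: "(V, \<psi>) \<in> atlas N" "y \<in> V"
      and l: "local_submersion (model_space (V, \<psi>)) W (g \<circ> inv_into V \<psi>) (\<psi> y)"
    using assms(2) by (auto simp: submersive_at_def)
  note c = smooth_manifold_is_chart[OF assms(1) V(1)]
  show "y \<in> points N"
    using openin_subset[OF is_chart_openin[OF c]] V(2) by blast
  show "g y \<in> W"
    using local_submersion_in(2)[OF l] V(2) is_chart_inj[OF c] by simp
  show "subspace W"
    using local_submersion_subspace[OF l] by simp
qed

lemma submersive_at_cong:
  assumes N: "smooth_manifold n N" and g: "submersive_at N W g y"
    and A: "openin (top_space N) A" "y \<in> A" "\<And>z. z \<in> A \<Longrightarrow> g z = h z"
  shows "submersive_at N W h y"
proof -
  obtain V \<psi> where V: "(V, \<psi>) \<in> atlas N" "y \<in> V"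
      and l: "local_submersion (model_space (V, \<psi>)) W (g \<circ> inv_into V \<psi>) (\<psi> y)"
    using g by (auto simp: submersive_at_def)
  note c = smooth_manifold_is_chart[OF N V(1)]
  have "openin (top_of_set (model_space (V, \<psi>))) (\<psi> ` (V \<inter> A))"
    by (intro is_chart_openin_image[OF c] openin_Int is_chart_openin[OF c] A) auto
  then have "local_submersion (model_space (V, \<psi>)) W (h \<circ> inv_into V \<psi>) (\<psi> y)"
    by (rule local_submersion_cong[OF l]) (use V A is_chart_inj[OF c] in auto)
  then show ?thesis
    using V by (auto simp: submersive_at_def)
qed

lemma submersive_at_compose:
  assumes N: "smooth_manifold n N" and g: "submersive_at N W g y"
    and k: "local_submersion W W' k (g y)"
  shows "submersive_at N W' (k \<circ> g) y"
proof -
  obtain V \<psi> where V: "(V, \<psi>) \<in> atlas N" "y \<in> V"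
      and l: "local_submersion (model_space (V, \<psi>)) W (g \<circ> inv_into V \<psi>) (\<psi> y)"
    using g by (auto simp: submersive_at_def)
  have "(g \<circ> inv_into V \<psi>) (\<psi> y) = g y"
    using V(2) is_chart_inj[OF smooth_manifold_is_chart[OF N V(1)]] by simp
  then have "local_submersion (model_space (V, \<psi>)) W' (k \<circ> (g \<circ> inv_into V \<psi>)) (\<psi> y)"
    using local_submersion_compose[OF l] k by simp
  then show ?thesis
    using V by (auto simp: submersive_at_def comp_assoc)
qed

lemma submersive_at_factor:
  assumes N: "smooth_manifold n N" and g: "submersive_at N W g y" and h: "submersive_at N W' h y"
    and A: "openin (top_space N) A" "y \<in> A" "\<And>z. z \<in> A \<Longrightarrow> h z = k (g z)"
  shows "local_submersion W W' k (g y)"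
proof -
  obtain V \<psi> where V: "(V, \<psi>) \<in> atlas N" "y \<in> V"
      and l: "local_submersion (model_space (V, \<psi>)) W (g \<circ> inv_into V \<psi>) (\<psi> y)"
    using g by (auto simp: submersive_at_def)
  note c = smooth_manifold_is_chart[OF N V(1)]
  have V': "(V, \<psi>) \<in> max_atlas N"
    using atlas_subset_max_atlas[OF N] V by blast
  have "openin (top_of_set (model_space (V, \<psi>))) (\<psi> ` (V \<inter> A))"
    by (intro is_chart_openin_image[OF c] openin_Int is_chart_openin[OF c] A) auto
  then have "local_submersion W W' k ((g \<circ> inv_into V \<psi>) (\<psi> y))"
    by (rule local_submersion_factor[OF subspace_model_space l submersive_at_max_atlas[OF N h V' V(2)]])
      (use V A is_chart_inj[OF c] in auto)
  then show ?thesis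
    using V(2) is_chart_inj[OF c] by simp
qed

lemma submersive_at_openin_image:
  assumes N: "smooth_manifold n N" and g: "submersive_at N W g y"
    and A: "openin (top_space N) A" "y \<in> A"
  obtains T where "openin (top_of_set W) T" "g y \<in> T" "T \<subseteq> g ` A"
proof -
  obtain V \<psi> where V: "(V, \<psi>) \<in> atlas N" "y \<in> V"
      and l: "local_submersion (model_space (V, \<psi>)) W (g \<circ> inv_into V \<psi>) (\<psi> y)"
    using g by (auto simp: submersive_at_def)
  note c = smooth_manifold_is_chart[OF N V(1)]
  have "openin (top_of_set (model_space (V, \<psi>))) (\<psi> ` (V \<inter> A))"
    by (intro is_chart_openin_image[OF c] openin_Int is_chart_openin[OF c] A) auto
  then obtain T where T: "openin (top_of_set W) T" "(g \<circ> inv_into V \<psi>) (\<psi> y) \<in> T"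
      "T \<subseteq> (g \<circ> inv_into V \<psi>) ` \<psi> ` (V \<inter> A)"
    using local_submersion_openin_image[OF subspace_model_space l] V A by blast
  moreover have "(g \<circ> inv_into V \<psi>) ` \<psi> ` (V \<inter> A) \<subseteq> g ` A"
    using is_chart_inj[OF c] by auto
  ultimately show ?thesis
    using that[OF T(1)] T V is_chart_inj[OF c] by auto
qed

lemma submersive_on_openin_image:
  assumes N: "smooth_manifold n N" and A: "openin (top_space N) A"
    and g: "\<And>y. y \<in> A \<Longrightarrow> submersive_at N W g y"
  shows "openin (top_of_set W) (g ` A)"
  using submersive_at_openin_image[OF N g A] by (subst openin_subopen) blast

lemma submersive_on_openin_vimage:
  assumes N: "smooth_manifold n N" and A: "openin (top_space N) A"
    and g: "\<And>y. y \<in> A \<Longrightarrow> submersive_at N W g y" and S: "openin (top_of_set W) S"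
  shows "openin (top_space N) {z \<in> A. g z \<in> S}"
proof (subst openin_subopen, intro ballI)
  fix y assume y: "y \<in> {z \<in> A. g z \<in> S}"
  obtain V \<psi> where V: "(V, \<psi>) \<in> atlas N" "y \<in> V"
      and l: "local_submersion (model_space (V, \<psi>)) W (g \<circ> inv_into V \<psi>) (\<psi> y)"
    using g[of y] y by (auto simp: submersive_at_def)
  note c = smooth_manifold_is_chart[OF N V(1)]
  obtain T where T: "openin (top_of_set (model_space (V, \<psi>))) T" "\<psi> y \<in> T"
      "smooth_on T (g \<circ> inv_into V \<psi>)" "(g \<circ> inv_into V \<psi>) ` T \<subseteq> W"
    using l by (auto simp: local_submersion_def)
  from openin_preimage_smooth[OF T(1,3,4) S]
  have "openin (top_space N) ({z \<in> V. \<psi> z \<in> T \<inter> (g \<circ> inv_into V \<psi>) -` S} \<inter> A)"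
    using is_chart_openin_vimage[OF c] A by blast
  moreover have "{z \<in> V. \<psi> z \<in> T \<inter> (g \<circ> inv_into V \<psi>) -` S} \<inter> A \<subseteq> {z \<in> A. g z \<in> S}"
    using is_chart_inj[OF c] by auto
  moreover have "y \<in> {z \<in> V. \<psi> z \<in> T \<inter> (g \<circ> inv_into V \<psi>) -` S} \<inter> A"
    using y V(2) T(2) is_chart_inj[OF c] by auto
  ultimately show "\<exists>T. openin (top_space N) T \<and> y \<in> T \<and> T \<subseteq> {z \<in> A. g z \<in> S}"
    by blast
qed

text \<open>The change of coordinates comes from the centred normal form of \<open>g\<close> in an
  arbitrary chart. Because \<open>\<phi> y = 0\<close>, the level set through \<open>y\<close> of
  \<open>g\<close>, or of a linear function of \<open>g\<close>, is a linear slice in the new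
  chart.\<close>

lemma submersive_at_adapted_chart:
  assumes N: "smooth_manifold n N" and g: "submersive_at N W g y"
    and A: "openin (top_space N) A" "y \<in> A"
  obtains U \<phi> G where "(U, \<phi>) \<in> max_atlas N" "y \<in> U" "U \<subseteq> A" "\<phi> y = 0" "linear G"
    "G ` model_space (U, \<phi>) = W" "\<And>z. z \<in> U \<Longrightarrow> g z = G (\<phi> z) + g y"
proof -
  obtain V \<psi> where V: "(V, \<psi>) \<in> atlas N" "y \<in> V"
      and l: "local_submersion (model_space (V, \<psi>)) W (g \<circ> inv_into V \<psi>) (\<psi> y)"
    using g by (auto simp: submersive_at_def)
  note c = smooth_manifold_is_chart[OF N V(1)]
  have V': "(V, \<psi>) \<in> max_atlas N" "V \<noteq> {}"
    using atlas_subset_max_atlas[OF N] V by blast+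
  obtain P T T' \<theta> \<theta>' where P: "linear P" "P ` model_space (V, \<psi>) = W"
    and T: "openin (top_of_set (model_space (V, \<psi>))) T" "\<psi> y \<in> T"
      "openin (top_of_set (model_space (V, \<psi>))) T'"
    and hom: "homeomorphism T T' \<theta> \<theta>'" and sm: "smooth_on T \<theta>" "smooth_on T' \<theta>'"
    and 0: "\<theta> (\<psi> y) = 0"
    and gP: "\<And>x. x \<in> T \<Longrightarrow> (g \<circ> inv_into V \<psi>) x = P (\<theta> x) + (g \<circ> inv_into V \<psi>) (\<psi> y)"
    using local_submersion_centred_normal_form[OF subspace_model_space l] by metis
  define U where "U = {z \<in> V. \<psi> z \<in> T} \<inter> A"
  have U: "openin (top_space N) U" "U \<subseteq> V" "\<psi> ` U \<subseteq> T" "y \<in> U"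
    using is_chart_openin_vimage[OF c T(1)] A T(2) V(2) by (auto simp: U_def)
  note rep = max_atlas_reparametrize[OF N V' T(1,3) hom sm U(1-3)]
  have "g z = P ((\<theta> \<circ> \<psi>) z) + g y" if "z \<in> U" for z
    using gP[of "\<psi> z"] that U V(2) is_chart_inj[OF c] by (auto simp: subset_iff image_subset_iff)
  then show ?thesis
    using that[OF rep(1) U(4), of P] 0 P rep(2) U(4) by (auto simp: U_def)
qed

lemma submersion_imp_submersive_at:
  assumes N: "smooth_manifold n N" and Q: "smooth_manifold m Q" and f: "submersion N Q f"
    and y: "y \<in> points N" and V: "(V, \<psi>) \<in> atlas Q" "f y \<in> V"
  shows "submersive_at N (model_space (V, \<psi>)) (\<psi> \<circ> f) y"
proof -
  obtain U \<phi> where U: "(U, \<phi>) \<in> atlas N" "y \<in> U"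
    using smooth_manifold_chart_at[OF N y] by metis
  note c = smooth_manifold_is_chart[OF N U(1)]
  note c' = smooth_manifold_is_chart[OF Q V(1)]
  have sm: "smooth_map N Q f"
    using f by (simp add: submersion_def)
  define T where "T = \<phi> ` (U \<inter> f -` V)"
  have "openin (top_space N) {x \<in> points N. f x \<in> V}"
    using sm by (intro openin_continuous_map_preimage[OF _ is_chart_openin[OF c']]) (simp add: smooth_map_def)
  moreover have "U \<inter> f -` V = U \<inter> {x \<in> points N. f x \<in> V}"
    using openin_subset[OF is_chart_openin[OF c]] by auto
  ultimately have T: "openin (top_of_set (model_space (U, \<phi>))) T"
    unfolding T_def using is_chart_openin[OF c] by (intro is_chart_openin_image[OF c]) auto
  have yT: "\<phi> y \<in> T"
    using U V by (auto simp: T_def)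
  have smT: "smooth_on T ((\<psi> \<circ> f) \<circ> inv_into U \<phi>)"
    using sm U V by (auto simp: smooth_map_def T_def)
  have "((\<psi> \<circ> f) \<circ> inv_into U \<phi>) ` T \<subseteq> model_space (V, \<psi>)"
    using is_chart_inj[OF c] by (auto simp: T_def model_space_def intro: span_base)
  moreover obtain D where "((\<psi> \<circ> f \<circ> inv_into U \<phi>) has_derivative D) (at (\<phi> y) within T)"
      "D ` model_space (U, \<phi>) = model_space (V, \<psi>)"
    using f U V unfolding submersion_def T_def by blast
  ultimately have "local_submersion (model_space (U, \<phi>)) (model_space (V, \<psi>))
      ((\<psi> \<circ> f) \<circ> inv_into U \<phi>) (\<phi> y)"
    using T yT smT at_within_openin_subspace[OF T yT] unfolding local_submersion_def by metis
  then show ?thesis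
    using U by (auto simp: submersive_at_def)
qed

text \<open>\<open>submersive_at\<close> contains smoothness near each point, and
  \<open>smooth_on_local\<close> assembles these neighbourhoods over the whole chart.\<close>

lemma submersionI:
  assumes N: "smooth_manifold n N" and Q: "smooth_manifold m Q"
    and cont: "continuous_map (top_space N) (top_space Q) f"
    and sub: "\<And>y V \<psi>. y \<in> points N \<Longrightarrow> (V, \<psi>) \<in> atlas Q \<Longrightarrow> f y \<in> V \<Longrightarrow>
      submersive_at N (model_space (V, \<psi>)) (\<psi> \<circ> f) y"
  shows "submersion N Q f"
proof -
  have main: "smooth_on (\<phi> ` (U \<inter> f -` V)) (\<psi> \<circ> f \<circ> inv_into U \<phi>) \<and>
     (\<forall>y \<in> U \<inter> f -` V. \<exists>D. ((\<psi> \<circ> f \<circ> inv_into U \<phi>) has_derivative D)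
          (at (\<phi> y) within \<phi> ` (U \<inter> f -` V)) \<and> D ` model_space (U, \<phi>) = model_space (V, \<psi>))"
    if U: "(U, \<phi>) \<in> atlas N" and V: "(V, \<psi>) \<in> atlas Q" for U \<phi> V \<psi>
  proof -
    note c = smooth_manifold_is_chart[OF N U]
    note c' = smooth_manifold_is_chart[OF Q V]
    define T where "T = \<phi> ` (U \<inter> f -` V)"
    have UN: "U \<subseteq> points N"
      using openin_subset[OF is_chart_openin[OF c]] .
    have "openin (top_space N) {x \<in> points N. f x \<in> V}"
      by (rule openin_continuous_map_preimage[OF cont is_chart_openin[OF c']])
    moreover have "U \<inter> f -` V = U \<inter> {x \<in> points N. f x \<in> V}"
      using UN by auto
    ultimately have T: "openin (top_of_set (model_space (U, \<phi>))) T"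
      unfolding T_def using is_chart_openin[OF c] by (intro is_chart_openin_image[OF c]) auto
    have l: "local_submersion (model_space (U, \<phi>)) (model_space (V, \<psi>))
        ((\<psi> \<circ> f) \<circ> inv_into U \<phi>) (\<phi> y)" if "y \<in> U" "f y \<in> V" for y
    proof (rule submersive_at_max_atlas[OF N _ _ that(1)])
      show "submersive_at N (model_space (V, \<psi>)) (\<psi> \<circ> f) y"
        using sub[OF _ V that(2)] that(1) UN by auto
      show "(U, \<phi>) \<in> max_atlas N"
        using atlas_subset_max_atlas[OF N] U by auto
    qed
    have "smooth_on T (\<psi> \<circ> f \<circ> inv_into U \<phi>)"
    proof (rule smooth_on_local[OF subspace_model_space T])
      fix a assume "a \<in> T"
      then obtain y where "y \<in> U" "f y \<in> V" "a = \<phi> y"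
        by (auto simp: T_def)
      then show "\<exists>S. openin (top_of_set (model_space (U, \<phi>))) S \<and> a \<in> S \<and>
          smooth_on S (\<psi> \<circ> f \<circ> inv_into U \<phi>)"
        using l[of y] by (auto simp: local_submersion_def)
    qed
    moreover have "\<exists>D. ((\<psi> \<circ> f \<circ> inv_into U \<phi>) has_derivative D)
          (at (\<phi> y) within T) \<and> D ` model_space (U, \<phi>) = model_space (V, \<psi>)"
      if y: "y \<in> U \<inter> f -` V" for y
    proof -
      have "\<phi> y \<in> T"
        using y by (auto simp: T_def)
      then show ?thesis
        using l[of y] y at_within_openin_subspace[OF T] unfolding local_submersion_def by auto
    qed
    ultimately show ?thesis
      by (simp add: T_def)
  qed
  then show ?thesis
    using cont unfolding submersion_def smooth_map_def by blast
qed

text \<open>\<open>N\<close> and \<open>N'\<close> stand for an open submanifold and a product, so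
  only what is at hand for these is required: a chart around \<open>y\<close>, and the chart
  property for nonempty domains. In coordinates \<open>h\<close> has a smooth inverse and is
  therefore a local submersion.\<close>

lemma submersive_at_diffeomorphism:
  assumes cov: "y \<in> U" "(U, \<phi>) \<in> atlas N" and c: "is_chart n (top_space N) (U, \<phi>)"
    and N': "\<And>c. c \<in> atlas N' \<Longrightarrow> fst c \<noteq> {} \<Longrightarrow> is_chart n' (top_space N') c"
    and h: "diffeomorphism N N' h" and g: "submersive_at N' W g (h y)"
  shows "submersive_at N W (g \<circ> h) y"
proof -
  obtain V \<psi> where V: "(V, \<psi>) \<in> atlas N'" "h y \<in> V"
      and l: "local_submersion (model_space (V, \<psi>)) W (g \<circ> inv_into V \<psi>) (\<psi> (h y))"
    using g by (auto simp: submersive_at_def)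
  have c': "is_chart n' (top_space N') (V, \<psi>)"
    using N'[OF V(1)] V(2) by auto
  note inj = is_chart_inj[OF c] is_chart_inj[OF c']
  define h' where "h' = inv_into (points N) h"
  have sub: "U \<subseteq> points N" "V \<subseteq> points N'"
    using openin_subset[OF is_chart_openin[OF c]] openin_subset[OF is_chart_openin[OF c']] by auto
  have bij: "bij_betw h (points N) (points N')"
    using h by (simp add: diffeomorphism_def)
  have h'h: "h' (h z) = z" if "z \<in> points N" for z
    using bij that by (simp add: h'_def bij_betw_inv_into_left)
  have hh': "h (h' z) = z" "h' z \<in> points N" if "z \<in> points N'" for z
    using bij that by (auto simp: h'_def bij_betw_inv_into_right bij_betw_def inv_into_into)
  have sm: "smooth_map N N' h" "smooth_map N' N h'"
    using h by (auto simp: diffeomorphism_def h'_def)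
  define T where "T = \<phi> ` (U \<inter> h -` V)"
  define T' where "T' = \<psi> ` (V \<inter> h' -` U)"
  have "openin (top_space N) {x \<in> points N. h x \<in> V}"
    using sm by (intro openin_continuous_map_preimage[OF _ is_chart_openin[OF c']]) (simp add: smooth_map_def)
  moreover have "U \<inter> h -` V = U \<inter> {x \<in> points N. h x \<in> V}"
    using sub by auto
  ultimately have o: "openin (top_space N) (U \<inter> h -` V)"
    using is_chart_openin[OF c] by auto
  then have T: "openin (top_of_set (model_space (U, \<phi>))) T"
    unfolding T_def by (intro is_chart_openin_image[OF c]) auto
  have "openin (top_space N') {x \<in> points N'. h' x \<in> U}"
    using sm by (intro openin_continuous_map_preimage[OF _ is_chart_openin[OF c]]) (simp add: smooth_map_def)
  moreover have "V \<inter> h' -` U = V \<inter> {x \<in> points N'. h' x \<in> U}"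
    using sub by auto
  ultimately have T': "openin (top_of_set (model_space (V, \<psi>))) T'"
    unfolding T'_def using is_chart_openin[OF c'] by (intro is_chart_openin_image[OF c']) auto
  have "local_submersion (model_space (U, \<phi>)) (model_space (V, \<psi>)) (\<psi> \<circ> h \<circ> inv_into U \<phi>) (\<phi> y)"
  proof (rule local_submersion_inverse[OF _ _ T T', where g = "\<phi> \<circ> h' \<circ> inv_into V \<psi>"])
    show "smooth_on T (\<psi> \<circ> h \<circ> inv_into U \<phi>)" "smooth_on T' (\<phi> \<circ> h' \<circ> inv_into V \<psi>)"
      using sm V(1) cov(2) by (auto simp: smooth_map_def T_def T'_def)
    show "(\<psi> \<circ> h \<circ> inv_into U \<phi>) ` T \<subseteq> T'"
      using inj h'h sub by (auto simp: T_def T'_def)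
    show "(\<phi> \<circ> h' \<circ> inv_into V \<psi>) ` T' \<subseteq> T"
      using inj hh' sub by (auto simp: T_def T'_def)
    show "(\<phi> \<circ> h' \<circ> inv_into V \<psi>) ((\<psi> \<circ> h \<circ> inv_into U \<phi>) x) = x" if "x \<in> T" for x
      using that inj h'h sub by (auto simp: T_def)
    show "(\<psi> \<circ> h \<circ> inv_into U \<phi>) ((\<phi> \<circ> h' \<circ> inv_into V \<psi>) x) = x" if "x \<in> T'" for x
      using that inj hh' sub by (auto simp: T'_def)
  qed (use cov V in \<open>auto simp: T_def\<close>)
  moreover have "(\<psi> \<circ> h \<circ> inv_into U \<phi>) (\<phi> y) = \<psi> (h y)"
    using inj cov by simp
  ultimately have "local_submersion (model_space (U, \<phi>)) W
      ((g \<circ> inv_into V \<psi>) \<circ> (\<psi> \<circ> h \<circ> inv_into U \<phi>)) (\<phi> y)"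
    using local_submersion_compose l by metis
  then have "local_submersion (model_space (U, \<phi>)) W (g \<circ> h \<circ> inv_into U \<phi>) (\<phi> y)"
    by (rule local_submersion_cong[OF _ T]) (use cov V inj in \<open>auto simp: T_def\<close>)
  then show ?thesis
    using cov by (auto simp: submersive_at_def)
qed

section \<open>The leaf space\<close>

context
  fixes A :: "'a set" and F :: "'a set set"
  assumes F: "partition_on A F"
begin

lemma leaf_of_eq:
  assumes "L \<in> F" "x \<in> L"
  shows "leaf_of F x = L"
proof -
  have "L' = L" if "L' \<in> F" "x \<in> L'" for L'
  proof (rule ccontr)
    assume "L' \<noteq> L"
    from pairwiseD[OF partition_onD2[OF F] that(1) assms(1) this] show False
      using that(2) assms(2) by (simp add: disjnt_iff)
  qed
  then have "(THE L. L \<in> F \<and> x \<in> L) = L"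
    by (intro the_equality conjI assms) (elim conjE)
  then show ?thesis
    by (simp only: leaf_of_def)
qed

lemma leaf_of_in:
  assumes "x \<in> A"
  shows "leaf_of F x \<in> F" "x \<in> leaf_of F x"
proof -
  obtain L where "L \<in> F" "x \<in> L"
    using assms partition_onD1[OF F] by blast
  then show "leaf_of F x \<in> F" "x \<in> leaf_of F x"
    using leaf_of_eq by auto
qed

lemma leaf_of_vimage: "V \<subseteq> F \<Longrightarrow> {x \<in> A. leaf_of F x \<in> V} = \<Union>V"
proof -
  assume V: "V \<subseteq> F"
  have "x \<in> A" "leaf_of F x = L" if "x \<in> L" "L \<in> V" for x L
    using leaf_of_eq[of L x] that V partition_onD1[OF F] by auto
  then show ?thesis
    using leaf_of_in(2) by fastforce
qed

lemma leaf_of_image: "leaf_of F ` A = F"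
proof
  show "F \<subseteq> leaf_of F ` A"
  proof
    fix L assume L: "L \<in> F"
    then obtain x where x: "x \<in> L"
      using partition_onD3[OF F] by fastforce
    then have "x \<in> A"
      using L partition_onD1[OF F] by blast
    then show "L \<in> leaf_of F ` A"
      using leaf_of_eq[OF L x] by (intro image_eqI[of _ _ x]) simp_all
  qed
qed (simp add: image_subset_iff leaf_of_in(1))

lemma leaf_of_image_Union:
  assumes "V \<subseteq> F"
  shows "leaf_of F ` \<Union>V = V"
proof -
  have "L \<in> leaf_of F ` \<Union>V" if "L \<in> V" for L
  proof -
    have "L \<noteq> {}"
      using that assms partition_onD3[OF F] by auto
    then obtain x where "x \<in> L"
      by blast
    then show ?thesis
      using that leaf_of_eq[of L x] subsetD[OF assms that] by (intro image_eqI[of _ _ x]) auto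
  qed
  moreover have "leaf_of F x \<in> V" if "x \<in> \<Union>V" for x
  proof -
    obtain L where "L \<in> V" "x \<in> L"
      using \<open>x \<in> \<Union>V\<close> by blast
    then show ?thesis
      using leaf_of_eq[of L x] assms by auto
  qed
  ultimately show ?thesis
    by blast
qed

lemma Union_leaf_of_image:
  assumes "B \<subseteq> A" "\<And>x. x \<in> B \<Longrightarrow> leaf_of F x \<subseteq> B"
  shows "\<Union>(leaf_of F ` B) = B"
  using assms leaf_of_in(2) by blast

end

section \<open>Topology and charts of the leaf space\<close>

definition leaf_topology :: "('a, 'e) mfd \<Rightarrow> 'a set set \<Rightarrow> 'a set topology" where
  "leaf_topology N F = topology (\<lambda>V. V \<subseteq> F \<and> openin (top_space N) (\<Union>V))"

lemma openin_leaf_topology: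
  assumes "partition_on (points N) F"
  shows "openin (leaf_topology N F) V \<longleftrightarrow> V \<subseteq> F \<and> openin (top_space N) (\<Union>V)"
proof -
  have "istopology (\<lambda>V. V \<subseteq> F \<and> openin (top_space N) (\<Union>V))"
    unfolding istopology_def
  proof (intro conjI allI impI; (elim conjE)?)
    fix S T assume ST: "S \<subseteq> F" "T \<subseteq> F" and o: "openin (top_space N) (\<Union>S)" "openin (top_space N) (\<Union>T)"
    \<comment> \<open>Forming unions of sets of leaves commutes with intersection because distinct
      leaves are disjoint.\<close>
    have "K = L" if "x \<in> K" "x \<in> L" "K \<in> S" "L \<in> T" for x K L
      using leaf_of_eq[OF assms] that ST by (metis subsetD)
    then have "\<Union>(S \<inter> T) = \<Union>S \<inter> \<Union>T"
      by blast
    then show "openin (top_space N) (\<Union>(S \<inter> T))"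
      using o by auto
  next
    fix \<K> assume "\<forall>K\<in>\<K>. K \<subseteq> F \<and> openin (top_space N) (\<Union>K)"
    moreover have "\<Union>(\<Union>\<K>) = \<Union>(Union ` \<K>)"
      by auto
    ultimately show "openin (top_space N) (\<Union>(\<Union>\<K>))"
      by auto
  qed blast+
  then show ?thesis
    by (simp add: leaf_topology_def)
qed

lemma topspace_leaf_topology:
  assumes "partition_on (points N) F"
  shows "topspace (leaf_topology N F) = F"
proof -
  have "openin (leaf_topology N F) F"
    using openin_topspace[of "top_space N"] partition_onD1[OF assms]
    by (simp add: openin_leaf_topology[OF assms])
  then show ?thesis
    using openin_leaf_topology[OF assms] openin_subset openin_topspace by (metis subset_antisym)
qed

definition leaf_atlas :: "nat \<Rightarrow> ('a, 'e::euclidean_space) mfd \<Rightarrow> 'a set set \<Rightarrow> ('a set, 'e) chart set" where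
  "leaf_atlas d N F = {(V, \<psi>). openin (leaf_topology N F) V \<and> inj_on \<psi> V \<and>
     (\<exists>W. subspace W \<and> dim W = d \<and> (\<forall>y\<in>\<Union>V. submersive_at N W (\<psi> \<circ> leaf_of F) y))}"

context
  fixes n d :: nat and N :: "('a, 'e::euclidean_space) mfd" and F :: "'a set set"
  assumes N: "smooth_manifold n N" and F: "partition_on (points N) F"
begin

lemma leaf_chart_openin_image:
  assumes "openin (leaf_topology N F) B"
    and "\<And>y. y \<in> \<Union>B \<Longrightarrow> submersive_at N W (\<psi> \<circ> leaf_of F) y"
  shows "openin (top_of_set W) (\<psi> ` B)"
proof -
  have B: "B \<subseteq> F" "openin (top_space N) (\<Union>B)"
    using assms(1) openin_leaf_topology[OF F] by auto
  have "openin (top_of_set W) ((\<psi> \<circ> leaf_of F) ` \<Union>B)"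
    using submersive_on_openin_image[OF N B(2) assms(2)] .
  then show ?thesis
    using leaf_of_image_Union[OF F B(1)] by (simp only: flip: image_comp)
qed

text \<open>The union of a set of leaves is its preimage in \<open>N\<close>. So
  \<open>\<psi>\<close> is open because the submersion \<open>\<psi> \<circ> leaf_of F\<close> is,
  and continuous because preimages under that submersion are open unions of leaves.\<close>

lemma leaf_atlas_chart:
  assumes "(V, \<psi>) \<in> leaf_atlas d N F"
  shows "is_chart d (leaf_topology N F) (V, \<psi>)"
    and "y \<in> \<Union>V \<Longrightarrow> submersive_at N (model_space (V, \<psi>)) (\<psi> \<circ> leaf_of F) y"
proof -
  obtain W where V: "openin (leaf_topology N F) V" "inj_on \<psi> V"
    and W: "subspace W" "dim W = d" "\<And>y. y \<in> \<Union>V \<Longrightarrow> submersive_at N W (\<psi> \<circ> leaf_of F) y"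
    using assms by (auto simp: leaf_atlas_def)
  have VF: "V \<subseteq> F" "openin (top_space N) (\<Union>V)"
    using V(1) openin_leaf_topology[OF F] by auto
  have op: "openin (top_of_set W) (\<psi> ` B)" if "openin (leaf_topology N F) B" "B \<subseteq> V" for B
    using that W(3) by (intro leaf_chart_openin_image) blast+
  show "is_chart d (leaf_topology N F) (V, \<psi>)"
  proof (rule is_chartI[OF V(1) W(1,2) V(2) _ op])
    fix S :: "'e set" assume "open S"
    then have "openin (top_space N) {z \<in> \<Union>V. (\<psi> \<circ> leaf_of F) z \<in> W \<inter> S}"
      by (intro submersive_on_openin_vimage[OF N VF(2) W(3)]) auto
    moreover have "{z \<in> \<Union>V. (\<psi> \<circ> leaf_of F) z \<in> W \<inter> S} = \<Union>{L \<in> V. \<psi> L \<in> S}"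
    proof -
      have "leaf_of F z = L" if "z \<in> L" "L \<in> V" for z L
        using leaf_of_eq[OF F] that VF(1) by blast
      moreover have "\<psi> L \<in> W" if "L \<in> V" for L
        using op[OF V(1)] openin_imp_subset that by blast
      ultimately show ?thesis
        by auto
    qed
    ultimately show "openin (leaf_topology N F) {L \<in> V. \<psi> L \<in> S}"
      using VF(1) openin_leaf_topology[OF F] by auto
  qed
  have "model_space (V, \<psi>) = W" if "V \<noteq> {}"
    using model_space_eq[OF W(1) op[OF V(1)] that] by simp
  then show "submersive_at N (model_space (V, \<psi>)) (\<psi> \<circ> leaf_of F) y" if "y \<in> \<Union>V"
    using W(3) that by (metis UnionE empty_iff)
qed

text \<open>The transition map \<open>k\<close> satisfies \<open>\<psi>' \<circ> leaf_of F = k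
  \<circ> (\<psi> \<circ> leaf_of F)\<close> over the common domain. Both composites are submersions
  on \<open>N\<close>, so \<open>submersive_at_factor\<close> makes \<open>k\<close> smooth.\<close>

lemma leaf_atlas_smooth:
  assumes V: "(V, \<psi>) \<in> leaf_atlas d N F" and V': "(V', \<psi>') \<in> leaf_atlas d N F"
  shows "smooth_on (\<psi> ` (V \<inter> V')) (\<psi>' \<circ> inv_into V \<psi>)"
proof (rule smooth_on_local)
  note c = leaf_atlas_chart[OF V] and c' = leaf_atlas_chart[OF V']
  note o = is_chart_openin[OF c(1)] is_chart_openin[OF c'(1)]
  show "openin (top_of_set (model_space (V, \<psi>))) (\<psi> ` (V \<inter> V'))"
    using o by (intro is_chart_openin_image[OF c(1)]) auto
  have VF: "V \<inter> V' \<subseteq> F" "openin (top_space N) (\<Union>(V \<inter> V'))"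
    using openin_Int[OF o] openin_leaf_topology[OF F] by auto
  fix a assume "a \<in> \<psi> ` (V \<inter> V')"
  then obtain L where L: "L \<in> V \<inter> V'" "a = \<psi> L"
    by blast
  then obtain y where y: "y \<in> L"
    using VF(1) partition_onD3[OF F] by (metis all_not_in_conv subsetD)
  have leaf: "leaf_of F z = L" if "z \<in> L" "L \<in> V \<inter> V'" for z L
    using leaf_of_eq[OF F] that VF(1) by blast
  have "local_submersion (model_space (V, \<psi>)) (model_space (V', \<psi>')) (\<psi>' \<circ> inv_into V \<psi>) ((\<psi> \<circ> leaf_of F) y)"
  proof (rule submersive_at_factor[OF N _ _ VF(2)])
    show "submersive_at N (model_space (V, \<psi>)) (\<psi> \<circ> leaf_of F) y"
        "submersive_at N (model_space (V', \<psi>')) (\<psi>' \<circ> leaf_of F) y"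
      using c(2) c'(2) y L by auto
    show "y \<in> \<Union>(V \<inter> V')"
      using y L by blast
    show "(\<psi>' \<circ> leaf_of F) z = (\<psi>' \<circ> inv_into V \<psi>) ((\<psi> \<circ> leaf_of F) z)" if "z \<in> \<Union>(V \<inter> V')" for z
      using that leaf is_chart_inj[OF c(1)] by auto
  qed
  then show "\<exists>T. openin (top_of_set (model_space (V, \<psi>))) T \<and> a \<in> T \<and> smooth_on T (\<psi>' \<circ> inv_into V \<psi>)"
    using leaf[OF y] L by (auto simp: local_submersion_def)
qed simp

text \<open>The hypotheses speak of \<open>N\<close> only: saturated open sets of \<open>N\<close>
  are the open sets of the leaf space, so the first one is the Hausdorff property and the second one
  provides charts. A single \<open>d\<close> for all points keeps the dimension constant.\<close>

lemma strictly_simpleI: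
  assumes separated: "\<And>L L'. L \<in> F \<Longrightarrow> L' \<in> F \<Longrightarrow> L \<noteq> L' \<Longrightarrow> \<exists>A A'.
        openin (top_space N) A \<and> openin (top_space N) A' \<and> A \<inter> A' = {} \<and> L \<subseteq> A \<and> L' \<subseteq> A' \<and>
        (\<forall>x\<in>A. leaf_of F x \<subseteq> A) \<and> (\<forall>x\<in>A'. leaf_of F x \<subseteq> A')"
    and local_quotient: "\<And>y. y \<in> points N \<Longrightarrow> \<exists>A g W. openin (top_space N) A \<and> y \<in> A \<and>
        (\<forall>x\<in>A. leaf_of F x \<subseteq> A) \<and> dim (W :: 'e set) = d \<and> (\<forall>z\<in>A. submersive_at N W g z) \<and>
        (\<forall>a\<in>A. \<forall>b\<in>A. g a = g b \<longleftrightarrow> leaf_of F a = leaf_of F b)"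
  shows "strictly_simple N F"
proof -
  let ?X = "leaf_topology N F"
  define Q where "Q = \<lparr>top_space = ?X, atlas = leaf_atlas d N F\<rparr>"
  have Qs [simp]: "top_space Q = ?X" "atlas Q = leaf_atlas d N F"
    by (simp_all add: Q_def)
  note openX = openin_leaf_topology[OF F] and topX = topspace_leaf_topology[OF F]
  have saturated: "openin ?X (leaf_of F ` A)" "\<Union>(leaf_of F ` A) = A"
    if "openin (top_space N) A" "\<forall>x\<in>A. leaf_of F x \<subseteq> A" for A
  proof -
    have A: "A \<subseteq> points N"
      using that openin_subset by blast
    show "\<Union>(leaf_of F ` A) = A"
      using Union_leaf_of_image[OF F A] that(2) by blast
    then show "openin ?X (leaf_of F ` A)"
      using A that leaf_of_in[OF F] by (auto simp: openX)
  qed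
  have quot: "quotient_map (top_space N) ?X (leaf_of F)"
    unfolding quotient_map_def using leaf_of_image[OF F] leaf_of_vimage[OF F]
    by (auto simp: topX openX)
  have cover: "\<exists>(V, \<psi>) \<in> leaf_atlas d N F. leaf_of F y \<in> V" if y: "y \<in> points N" for y
  proof -
    obtain A g W where A: "openin (top_space N) A" "y \<in> A" "\<forall>x\<in>A. leaf_of F x \<subseteq> A"
      and W: "dim (W :: 'e set) = d" and g: "\<forall>z\<in>A. submersive_at N W g z"
      and eq: "\<forall>a\<in>A. \<forall>b\<in>A. g a = g b \<longleftrightarrow> leaf_of F a = leaf_of F b"
      using local_quotient[OF y] by blast
    note sat = saturated[OF A(1,3)]
    \<comment> \<open>\<open>g\<close> is constant on each leaf in \<open>A\<close>, so any
      representative may be used to let it descend to the leaves.\<close>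
    define \<psi> where "\<psi> L = g (SOME z. z \<in> L)" for L
    have AN: "A \<subseteq> points N"
      using A openin_subset by blast
    have \<psi>: "\<psi> (leaf_of F z) = g z" if "z \<in> A" for z
    proof -
      have "(SOME w. w \<in> leaf_of F z) \<in> leaf_of F z"
        using leaf_of_in(2)[OF F] AN that by (metis someI subsetD)
      then show ?thesis
        unfolding \<psi>_def using eq that A(3) leaf_of_eq[OF F] leaf_of_in(1)[OF F] AN
        by (metis subsetD)
    qed
    have "inj_on \<psi> (leaf_of F ` A)"
      using \<psi> eq by (auto simp: inj_on_def)
    moreover have "submersive_at N W (\<psi> \<circ> leaf_of F) z" if "z \<in> A" for z
      by (rule submersive_at_cong[OF N bspec[OF g that] A(1) that]) (simp add: \<psi>)
    moreover have "subspace W"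
      using submersive_at_point(3)[OF N bspec[OF g A(2)]] .
    ultimately have "(leaf_of F ` A, \<psi>) \<in> leaf_atlas d N F"
      by (simp only: leaf_atlas_def mem_Collect_eq split sat) (use W in blast)
    then show ?thesis
      using A(2) by blast
  qed
  \<comment> \<open>Second countability does not pass to arbitrary quotients, but it passes along
    open surjections. Openness is checked in a chart \<open>\<psi>\<close>, where
    \<open>\<psi> \<circ> leaf_of F\<close> is a submersion and hence open.\<close>
  have "open_map (top_space N) ?X (leaf_of F)"
    unfolding open_map_def
  proof (intro allI impI)
    fix B assume B: "openin (top_space N) B"
    have BN: "B \<subseteq> points N"
      using B openin_subset by blast
    show "openin ?X (leaf_of F ` B)"
    proof (subst openin_subopen, intro ballI)
      fix L assume "L \<in> leaf_of F ` B"
      then obtain y where y: "y \<in> B" "L = leaf_of F y"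
        by blast
      obtain V \<psi> where V: "(V, \<psi>) \<in> leaf_atlas d N F" "L \<in> V"
        using cover BN y by blast
      note c = leaf_atlas_chart[OF V(1)]
      have VF: "V \<subseteq> F" "openin (top_space N) (\<Union>V)"
        using is_chart_openin[OF c(1)] by (auto simp: openX)
      have "openin (top_of_set (model_space (V, \<psi>))) ((\<psi> \<circ> leaf_of F) ` (B \<inter> \<Union>V))"
        using B VF c(2) by (intro submersive_on_openin_image[OF N]) auto
      then have "openin ?X {M \<in> V. \<psi> M \<in> (\<psi> \<circ> leaf_of F) ` (B \<inter> \<Union>V)}"
        by (rule is_chart_openin_vimage[OF c(1)])
      moreover have "{M \<in> V. \<psi> M \<in> (\<psi> \<circ> leaf_of F) ` (B \<inter> \<Union>V)} \<subseteq> leaf_of F ` B"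
      proof
        fix M assume "M \<in> {M \<in> V. \<psi> M \<in> (\<psi> \<circ> leaf_of F) ` (B \<inter> \<Union>V)}"
        then obtain z where z: "M \<in> V" "\<psi> M = \<psi> (leaf_of F z)" "z \<in> B" "z \<in> \<Union>V"
          by auto
        have "leaf_of F z \<in> V"
          using z(4) VF leaf_of_image_Union[OF F VF(1)] by blast
        then have "M = leaf_of F z"
          using z is_chart_inj[OF c(1)] by (auto dest: inj_onD)
        then show "M \<in> leaf_of F ` B"
          using z by blast
      qed
      moreover have "L \<in> {M \<in> V. \<psi> M \<in> (\<psi> \<circ> leaf_of F) ` (B \<inter> \<Union>V)}"
        using V y leaf_of_in(2)[OF F, of y] BN by auto
      ultimately show "\<exists>T. openin ?X T \<and> L \<in> T \<and> T \<subseteq> leaf_of F ` B"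
        by blast
    qed
  qed
  then have sc: "second_countable ?X"
    by (rule second_countable_open_map_image[OF quotient_imp_continuous_map[OF quot] _
        quotient_imp_surjective_map[OF quot]]) (use N in \<open>simp add: smooth_manifold_def\<close>)
  have haus: "Hausdorff_space ?X"
    unfolding Hausdorff_space_def topX
  proof (intro allI impI, elim conjE)
    fix L L' assume L: "L \<in> F" "L' \<in> F" "L \<noteq> L'"
    obtain A A' where A: "openin (top_space N) A" "openin (top_space N) A'" "A \<inter> A' = {}"
        "L \<subseteq> A" "L' \<subseteq> A'" "\<forall>x\<in>A. leaf_of F x \<subseteq> A" "\<forall>x\<in>A'. leaf_of F x \<subseteq> A'"
      using separated[OF L] by blast
    have mem: "K \<in> leaf_of F ` B" if "K \<in> F" "K \<subseteq> B" for K B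
    proof -
      have "K \<in> leaf_of F ` K"
        using leaf_of_image_Union[OF F, of "{K}"] that(1) by simp
      then show ?thesis
        using that(2) by blast
    qed
    have "disjnt (leaf_of F ` A) (leaf_of F ` A')"
    proof -
      have "False" if "a \<in> A" "a' \<in> A'" "leaf_of F a = leaf_of F a'" for a a'
      proof -
        have "a \<in> leaf_of F a"
          using leaf_of_in(2)[OF F] openin_subset[OF A(1)] that(1) by blast
        also have "\<dots> \<subseteq> A'"
          using A(7) that(2,3) by simp
        finally show False
          using A(3) that(1) by blast
      qed
      then show ?thesis
        unfolding disjnt_iff by (metis imageE)
    qed
    then show "\<exists>U V. openin ?X U \<and> openin ?X V \<and> L \<in> U \<and> L' \<in> V \<and> disjnt U V"
      using saturated(1)[OF A(1,6)] saturated(1)[OF A(2,7)] mem[OF L(1) A(4)] mem[OF L(2) A(5)]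
      by blast
  qed
  have comp: "compatible c c'" if "c \<in> leaf_atlas d N F" "c' \<in> leaf_atlas d N F" for c c'
  proof -
    obtain V \<psi> V' \<psi>' where eq: "c = (V, \<psi>)" "c' = (V', \<psi>')"
      by (cases c, cases c') simp
    show ?thesis
      using leaf_atlas_smooth[of V \<psi> V' \<psi>'] leaf_atlas_smooth[of V' \<psi>' V \<psi>] that
      by (simp add: compatible_def eq Int_commute)
  qed
  have cov: "(\<Union>(V, \<psi>) \<in> leaf_atlas d N F. V) = F"
  proof
    show "(\<Union>(V, \<psi>) \<in> leaf_atlas d N F. V) \<subseteq> F"
      by (auto simp: leaf_atlas_def openX)
    show "F \<subseteq> (\<Union>(V, \<psi>) \<in> leaf_atlas d N F. V)"
    proof
      fix L assume "L \<in> F"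
      then obtain y where "y \<in> points N" "L = leaf_of F y"
        using leaf_of_image[OF F] by (metis imageE)
      then show "L \<in> (\<Union>(V, \<psi>) \<in> leaf_atlas d N F. V)"
        using cover[of y] by auto
    qed
  qed
  have "is_chart d ?X c" if "c \<in> leaf_atlas d N F" for c
    using leaf_atlas_chart(1) that by (cases c) simp
  then have Q: "smooth_manifold d Q"
    unfolding smooth_manifold_def Qs topX using sc haus comp cov by blast
  have "submersion N Q (leaf_of F)"
  proof (rule submersionI[OF N Q])
    show "continuous_map (top_space N) (top_space Q) (leaf_of F)"
      using quotient_imp_continuous_map[OF quot] by simp
    fix y V \<psi> assume "y \<in> points N" "(V, \<psi>) \<in> atlas Q" "leaf_of F y \<in> V"
    then show "submersive_at N (model_space (V, \<psi>)) (\<psi> \<circ> leaf_of F) y"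
      using leaf_of_in(2)[OF F] by (intro leaf_atlas_chart(2)) auto
  qed
  then show ?thesis
    unfolding strictly_simple_def using Q quot topX by (intro exI[of _ Q] exI[of _ d]) simp
qed

end

section \<open>Submanifolds, products and fibres\<close>

text \<open>Rank and nullity relative to a subspace: \<open>V\<close> is the direct sum of the
  kernel and the image of a right inverse \<open>R\<close>, by the splitting
  \<open>v = (v - R (f v)) + R (f v)\<close>.\<close>

lemma dim_kernel:
  fixes f :: "'a::euclidean_space \<Rightarrow> 'b::euclidean_space"
  assumes f: "linear f" and V: "subspace V"
  shows "dim (V \<inter> {v. f v = 0}) + dim (f ` V) = dim V"
proof -
  obtain R where R: "range R \<subseteq> V" "linear R" "\<And>w. w \<in> f ` V \<Longrightarrow> f (R w) = w"
    using linear_exists_right_inverse_on[OF f V] by auto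
  let ?K = "V \<inter> {v. f v = 0}" and ?T = "R ` f ` V"
  have fV: "subspace (f ` V)"
    using f V by (rule linear_subspace_image)
  have K: "subspace ?K"
    by (intro subspace_inter V linear_subspace_kernel f)
  have T: "subspace ?T"
    using R(2) fV by (rule linear_subspace_image)
  have "{x + y |x y. x \<in> ?K \<and> y \<in> ?T} = V"
  proof
    show "V \<subseteq> {x + y |x y. x \<in> ?K \<and> y \<in> ?T}"
    proof
      fix v assume v: "v \<in> V"
      have "v = (v - R (f v)) + R (f v)" "v - R (f v) \<in> ?K"
        using v R V by (auto simp: linear_diff[OF f] intro: subspace_diff)
      then show "v \<in> {x + y |x y. x \<in> ?K \<and> y \<in> ?T}"
        using v by blast
    qed
  qed (use R(1) V subspace_add in blast)
  moreover have "?K \<inter> ?T = {0}"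
  proof
    show "?K \<inter> ?T \<subseteq> {0}"
      using R(3) linear_0[OF R(2)] by force
    show "{0} \<subseteq> ?K \<inter> ?T"
      using subspace_0[OF K] subspace_0[OF T] by blast
  qed
  moreover have "dim ?T = dim (f ` V)"
  proof (rule dim_image_eq[OF R(2)])
    show "inj_on R (span (f ` V))"
      using R(3) fV by (metis inj_on_inverseI span_eq_iff)
  qed
  ultimately show ?thesis
    using dim_sums_Int[OF K T] by simp
qed

section \<open>Charts of open subsets, products and slices\<close>

lemma is_chart_subtopology:
  assumes c: "is_chart d X (U, \<phi>)" and "U \<subseteq> A"
  shows "is_chart d (subtopology X A) (U, \<phi>)"
proof -
  have "openin (subtopology X A) U"
    using is_chart_openin[OF c] assms(2) by (metis inf.absorb_iff2 openin_subtopology_Int2)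
  moreover have "subtopology (subtopology X A) U = subtopology X U"
    using assms(2) by (simp add: subtopology_subtopology Int_absorb1)
  ultimately show ?thesis
    using c by (simp add: is_chart_def)
qed

lemma atlas_submanifoldE:
  assumes "(V, \<psi>) \<in> atlas (submanifold N S)"
  obtains U W where "(U, \<psi>) \<in> max_atlas N" "V = U \<inter> S" "subspace W" "\<psi> ` (U \<inter> S) = \<psi> ` U \<inter> W"
  using assms by (auto simp: submanifold_def)

lemma atlas_submanifold_open:
  assumes N: "smooth_manifold n N" and A: "openin (top_space N) A"
    and c: "(V, \<psi>) \<in> atlas (submanifold N A)"
  shows "(V, \<psi>) \<in> max_atlas N" "V \<noteq> {} \<Longrightarrow> is_chart n (top_space (submanifold N A)) (V, \<psi>)"
proof -
  obtain U where U: "(U, \<psi>) \<in> max_atlas N" "V = U \<inter> A"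
    using atlas_submanifoldE[OF c] by metis
  have "openin (top_space N) U"
    using U(1) is_chart_openin by (auto simp: max_atlas_def)
  then show V: "(V, \<psi>) \<in> max_atlas N"
    using max_atlas_restrict[OF N U(1)] A U(2) by auto
  show "is_chart n (top_space (submanifold N A)) (V, \<psi>)" if "V \<noteq> {}"
    using is_chart_subtopology[OF max_atlas_is_chart[OF N V that]] U(2) by (simp add: submanifold_def)
qed

lemma submanifold_open_chart_at:
  assumes N: "smooth_manifold n N" and A: "openin (top_space N) A" "y \<in> A"
  obtains V \<psi> where "(V, \<psi>) \<in> atlas (submanifold N A)" "y \<in> V"
proof -
  have "y \<in> points N"
    using A openin_subset by blast
  then obtain U \<phi> where U: "(U, \<phi>) \<in> atlas N" "y \<in> U"
    using smooth_manifold_chart_at[OF N] by metis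
  have "(U \<inter> A, \<phi>) \<in> max_atlas N"
    using max_atlas_restrict[OF N subsetD[OF atlas_subset_max_atlas[OF N] U(1)]] A
      is_chart_openin[OF smooth_manifold_is_chart[OF N U(1)]] by auto
  \<comment> \<open>An open set meets the slice condition with the whole space \<open>UNIV\<close>
    as the subspace.\<close>
  then have "(U \<inter> A \<inter> A, \<phi>) \<in> atlas (submanifold N A)"
    unfolding submanifold_def mfd.simps mem_Collect_eq
    by (intro exI[of _ "U \<inter> A"] exI[of _ \<phi>] conjI exI[of _ UNIV]) auto
  then show ?thesis
    using that U A by auto
qed

lemma submersive_at_submanifold_open:
  assumes N: "smooth_manifold n N" and A: "openin (top_space N) A" "y \<in> A"
  shows "submersive_at (submanifold N A) W g y \<longleftrightarrow> submersive_at N W g y"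
proof
  assume "submersive_at (submanifold N A) W g y"
  then obtain V \<psi> where V: "(V, \<psi>) \<in> atlas (submanifold N A)" "y \<in> V"
      "local_submersion (model_space (V, \<psi>)) W (g \<circ> inv_into V \<psi>) (\<psi> y)"
    by (auto simp: submersive_at_def)
  show "submersive_at N W g y"
    using submersive_atI[OF N atlas_submanifold_open(1)[OF N A(1) V(1)] V(2,3)] .
next
  assume g: "submersive_at N W g y"
  obtain V \<psi> where V: "(V, \<psi>) \<in> atlas (submanifold N A)" "y \<in> V"
    using submanifold_open_chart_at[OF N A] by metis
  show "submersive_at (submanifold N A) W g y"
    using submersive_at_max_atlas[OF N g atlas_submanifold_open(1)[OF N A(1) V(1)] V(2)] V
    by (auto simp: submersive_at_def)
qed

lemma is_chart_map_prod:
  assumes c: "is_chart d X (U, \<phi>)" "is_chart d' Y (V, \<psi>)"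
  shows "is_chart (d + d') (prod_topology X Y) (U \<times> V, map_prod \<phi> \<psi>)"
proof -
  obtain A where A: "subspace A" "dim A = d" "openin (top_of_set A) (\<phi> ` U)"
      "homeomorphic_map (subtopology X U) (top_of_set (\<phi> ` U)) \<phi>"
    using c(1) by (auto simp: is_chart_def)
  obtain B where B: "subspace B" "dim B = d'" "openin (top_of_set B) (\<psi> ` V)"
      "homeomorphic_map (subtopology Y V) (top_of_set (\<psi> ` V)) \<psi>"
    using c(2) by (auto simp: is_chart_def)
  have im: "map_prod \<phi> \<psi> ` (U \<times> V) = \<phi> ` U \<times> \<psi> ` V"
    by (simp add: map_prod_image)
  obtain \<phi>' where \<phi>': "homeomorphic_maps (subtopology X U) (top_of_set (\<phi> ` U)) \<phi> \<phi>'"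
    using A(4) by (auto simp: homeomorphic_map_maps)
  obtain \<psi>' where \<psi>': "homeomorphic_maps (subtopology Y V) (top_of_set (\<psi> ` V)) \<psi> \<psi>'"
    using B(4) by (auto simp: homeomorphic_map_maps)
  have "homeomorphic_maps (prod_topology (subtopology X U) (subtopology Y V))
      (prod_topology (top_of_set (\<phi> ` U)) (top_of_set (\<psi> ` V)))
      (\<lambda>(x, y). (\<phi> x, \<psi> y)) (\<lambda>(x, y). (\<phi>' x, \<psi>' y))"
    using \<phi>' \<psi>' unfolding homeomorphic_maps_prod by blast
  then have "homeomorphic_map (subtopology (prod_topology X Y) (U \<times> V)) (top_of_set (\<phi> ` U \<times> \<psi> ` V))
      (map_prod \<phi> \<psi>)"
    unfolding homeomorphic_map_maps subtopology_Times map_prod_def by auto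
  moreover have "openin (top_of_set (A \<times> B)) (\<phi> ` U \<times> \<psi> ` V)"
    using A(3) B(3) by (rule openin_Times)
  moreover have "openin (prod_topology X Y) (U \<times> V)"
    using is_chart_openin[OF c(1)] is_chart_openin[OF c(2)] by (simp add: openin_prod_Times_iff)
  moreover have "subspace (A \<times> B)" "dim (A \<times> B) = d + d'"
    using A B by (auto simp: subspace_Times dim_Times)
  ultimately show ?thesis
    unfolding is_chart_def split im by blast
qed

lemma model_space_map_prod:
  assumes c: "is_chart d X (U, \<phi>)" "is_chart d' Y (V, \<psi>)" and ne: "U \<noteq> {}" "V \<noteq> {}"
  shows "model_space (U \<times> V, map_prod \<phi> \<psi>) = model_space (U, \<phi>) \<times> model_space (V, \<psi>)"
proof (rule model_space_eq)
  have "openin (top_of_set (model_space (U, \<phi>))) (\<phi> ` U)"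
      "openin (top_of_set (model_space (V, \<psi>))) (\<psi> ` V)"
    using c is_chart_openin_image is_chart_openin by blast+
  then show "openin (top_of_set (model_space (U, \<phi>) \<times> model_space (V, \<psi>))) (map_prod \<phi> \<psi> ` (U \<times> V))"
    by (simp add: map_prod_image openin_Times)
qed (use ne in \<open>auto simp: subspace_Times\<close>)

lemma submersive_at_prod:
  assumes N: "\<And>c. c \<in> atlas N \<Longrightarrow> fst c \<noteq> {} \<Longrightarrow> is_chart n (top_space N) c"
    and M: "\<And>c. c \<in> atlas M \<Longrightarrow> fst c \<noteq> {} \<Longrightarrow> is_chart m (top_space M) c"
    and g: "submersive_at N W g a" and h: "submersive_at M V h b"
  shows "submersive_at (prod_mfd N M) (W \<times> V) (map_prod g h) (a, b)"
proof -
  obtain A \<alpha> where A: "(A, \<alpha>) \<in> atlas N" "a \<in> A"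
      and l: "local_submersion (model_space (A, \<alpha>)) W (g \<circ> inv_into A \<alpha>) (\<alpha> a)"
    using g by (auto simp: submersive_at_def)
  obtain B \<beta> where B: "(B, \<beta>) \<in> atlas M" "b \<in> B"
      and l': "local_submersion (model_space (B, \<beta>)) V (h \<circ> inv_into B \<beta>) (\<beta> b)"
    using h by (auto simp: submersive_at_def)
  have c: "is_chart n (top_space N) (A, \<alpha>)" "is_chart m (top_space M) (B, \<beta>)"
    using N[OF A(1)] A(2) M[OF B(1)] B(2) by auto
  note cp = is_chart_map_prod[OF c]
  have model: "model_space (A \<times> B, map_prod \<alpha> \<beta>) = model_space (A, \<alpha>) \<times> model_space (B, \<beta>)"
    using model_space_map_prod[OF c] A B by blast
  have "local_submersion (model_space (A \<times> B, map_prod \<alpha> \<beta>)) (W \<times> V)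
      (map_prod (g \<circ> inv_into A \<alpha>) (h \<circ> inv_into B \<beta>)) (map_prod \<alpha> \<beta> (a, b))"
    using local_submersion_map_prod[OF l l'] by (simp add: model)
  then have "local_submersion (model_space (A \<times> B, map_prod \<alpha> \<beta>)) (W \<times> V)
      (map_prod g h \<circ> inv_into (A \<times> B) (map_prod \<alpha> \<beta>)) (map_prod \<alpha> \<beta> (a, b))"
  proof (rule local_submersion_cong)
    show "openin (top_of_set (model_space (A \<times> B, map_prod \<alpha> \<beta>))) (map_prod \<alpha> \<beta> ` (A \<times> B))"
      using is_chart_openin_image[OF cp is_chart_openin[OF cp]] by simp
    fix x assume "x \<in> map_prod \<alpha> \<beta> ` (A \<times> B)"
    then obtain u v where u: "u \<in> A" "v \<in> B" "x = map_prod \<alpha> \<beta> (u, v)"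
      by auto
    have "inv_into (A \<times> B) (map_prod \<alpha> \<beta>) x = (u, v)"
      unfolding u(3) by (rule inv_into_f_f[OF is_chart_inj[OF cp]]) (use u in auto)
    then show "map_prod (g \<circ> inv_into A \<alpha>) (h \<circ> inv_into B \<beta>) x =
        (map_prod g h \<circ> inv_into (A \<times> B) (map_prod \<alpha> \<beta>)) x"
      using u is_chart_inj[OF c(1)] is_chart_inj[OF c(2)] by simp
  qed (use A B in auto)
  moreover have "(A \<times> B, map_prod \<alpha> \<beta>) \<in> atlas (prod_mfd N M)"
    using A B by (auto simp: prod_mfd_def)
  ultimately show ?thesis
    unfolding submersive_at_def using A(2) B(2) by (intro bexI[of _ "(A \<times> B, map_prod \<alpha> \<beta>)"]) auto
qed

text \<open>The span of a nonempty relatively open subset of a subspace is the whole subspace, which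
  identifies the model space of the slice as the intersection.\<close>

lemma slice_chart:
  assumes c: "is_chart d X (U, \<phi>)" and W: "subspace W" and S: "\<phi> ` (U \<inter> S) = \<phi> ` U \<inter> W"
    and ne: "U \<inter> S \<noteq> {}"
  shows "model_space (U \<inter> S, \<phi>) = model_space (U, \<phi>) \<inter> W"
    and "is_chart (dim (model_space (U, \<phi>) \<inter> W)) (subtopology X S) (U \<inter> S, \<phi>)"
proof -
  have sub: "subspace (model_space (U, \<phi>) \<inter> W)"
    using W by (simp add: subspace_inter)
  have "openin (top_of_set (model_space (U, \<phi>))) (\<phi> ` U)"
    using is_chart_openin_image[OF c] is_chart_openin[OF c] by blast
  then have op: "openin (top_of_set (model_space (U, \<phi>) \<inter> W)) (\<phi> ` (U \<inter> S))"
    unfolding S by (auto simp: openin_open)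
  show "model_space (U \<inter> S, \<phi>) = model_space (U, \<phi>) \<inter> W"
    by (rule model_space_eq[OF sub op ne])
  have U: "openin X U"
    by (rule is_chart_openin[OF c])
  have "homeomorphic_map (subtopology X U) (top_of_set (\<phi> ` U)) \<phi>"
    using c by (auto simp: is_chart_def)
  then have "homeomorphic_map (subtopology (subtopology X U) S) (subtopology (top_of_set (\<phi> ` U)) W) \<phi>"
    by (rule homeomorphic_map_subtopologies)
      (use S openin_subset[OF U] in \<open>simp add: Int_absorb1\<close>)
  moreover have "subtopology (subtopology X U) S = subtopology (subtopology X S) (U \<inter> S)"
    by (simp add: subtopology_subtopology Int_ac)
  moreover have "subtopology (top_of_set (\<phi> ` U)) W = top_of_set (\<phi> ` (U \<inter> S))"
    by (simp add: subtopology_subtopology S)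
  moreover have "openin (subtopology X S) (U \<inter> S)"
    using U openin_subtopology by blast
  ultimately show "is_chart (dim (model_space (U, \<phi>) \<inter> W)) (subtopology X S) (U \<inter> S, \<phi>)"
    unfolding is_chart_def using sub op by auto
qed

lemma submanifold_atlas_compatible:
  assumes N: "smooth_manifold n N"
    and c: "c \<in> atlas (submanifold N S)" "c' \<in> atlas (submanifold N S)"
  shows "compatible c c'"
proof -
  have *: "smooth_on (\<phi> ` (U \<inter> S \<inter> (V \<inter> S))) (\<psi> \<circ> inv_into (U \<inter> S) \<phi>)"
    if U: "(U, \<phi>) \<in> max_atlas N" and V: "(V, \<psi>) \<in> max_atlas N" for U \<phi> V \<psi>
  proof -
    have inj: "inj_on \<phi> U"
      using U is_chart_inj by (auto simp: max_atlas_def)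
    have "smooth_on (\<phi> ` (U \<inter> S \<inter> (V \<inter> S))) (\<psi> \<circ> inv_into U \<phi>)"
      using compatible_smooth[OF max_atlas_compatible[OF N U V]] by (rule smooth_on_subset) auto
    then show ?thesis
    proof (rule smooth_on_cong)
      fix x assume "x \<in> \<phi> ` (U \<inter> S \<inter> (V \<inter> S))"
      then obtain z where z: "z \<in> U \<inter> S" "x = \<phi> z"
        by blast
      have "inv_into (U \<inter> S) \<phi> x = z"
        unfolding z(2) by (rule inv_into_f_f[OF inj_on_subset[OF inj] z(1)]) simp
      then show "(\<psi> \<circ> inv_into U \<phi>) x = (\<psi> \<circ> inv_into (U \<inter> S) \<phi>) x"
        using z inj by simp
    qed
  qed
  obtain V \<phi> V' \<psi> where eq: "c = (V, \<phi>)" "c' = (V', \<psi>)"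
    by (cases c, cases c') simp
  obtain A where A: "(A, \<phi>) \<in> max_atlas N" "V = A \<inter> S"
    using atlas_submanifoldE[OF c(1)[unfolded eq]] by metis
  obtain B where B: "(B, \<psi>) \<in> max_atlas N" "V' = B \<inter> S"
    using atlas_submanifoldE[OF c(2)[unfolded eq]] by metis
  have "smooth_on (\<psi> ` (V \<inter> V')) (\<phi> \<circ> inv_into V' \<psi>)"
    using *[OF B(1) A(1)] A(2) B(2) by (metis Int_commute)
  then show ?thesis
    using *[OF A(1) B(1)] A(2) B(2) by (simp add: compatible_def eq)
qed

lemma submanifold_atlas_is_chart:
  assumes N: "smooth_manifold n N" and c: "(V, \<psi>) \<in> atlas (submanifold N S)" and ne: "V \<noteq> {}"
  shows "is_chart (dim (model_space (V, \<psi>))) (top_space (submanifold N S)) (V, \<psi>)"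
proof -
  obtain U W where U: "(U, \<psi>) \<in> max_atlas N" "V = U \<inter> S" "subspace W" "\<psi> ` (U \<inter> S) = \<psi> ` U \<inter> W"
    using atlas_submanifoldE[OF c] by metis
  have "is_chart n (top_space N) (U, \<psi>)"
    using max_atlas_is_chart[OF N U(1)] ne U(2) by blast
  from slice_chart[OF this U(3,4)] ne U(2) show ?thesis
    by (simp add: submanifold_def)
qed

text \<open>One chart of dimension \<open>k\<close> around each point decides the dimension: any
  further chart there has mutually inverse smooth transition maps with it.\<close>

lemma smooth_manifold_submanifold:
  assumes N: "smooth_manifold n N" and S: "S \<subseteq> points N" "S \<noteq> {}"
    and charts: "\<And>y. y \<in> S \<Longrightarrow> \<exists>(V, \<psi>) \<in> atlas (submanifold N S). y \<in> V \<and> dim (model_space (V, \<psi>)) = k"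
  shows "smooth_manifold k (submanifold N S)"
proof -
  let ?X = "top_space (submanifold N S)"
  have X: "?X = subtopology (top_space N) S"
    by (simp add: submanifold_def)
  have chart: "is_chart k ?X c" if c: "c \<in> atlas (submanifold N S)" for c
  proof (cases "fst c = {}")
    case True
    \<comment> \<open>A chart with empty domain still asks for some \<open>k\<close>-dimensional
      subspace; it is borrowed from a chart around a point of \<open>S\<close>.\<close>
    obtain V \<psi> where "dim (model_space (V, \<psi> :: 'a \<Rightarrow> 'b)) = k"
      using S(2) charts by fastforce
    moreover have "homeomorphic_map (subtopology ?X {}) (top_of_set ({} :: 'b set)) (snd c)"
      by (simp add: homeomorphic_map_def quotient_map_def)
    ultimately show ?thesis
      using True unfolding is_chart_def by (cases c) (auto intro!: exI[of _ "model_space (V, \<psi>)"])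
  next
    case False
    obtain V \<psi> where eq: "c = (V, \<psi>)"
      by (cases c)
    then obtain y where y: "y \<in> V"
      using False by auto
    then have "y \<in> S"
      using atlas_submanifoldE[OF c[unfolded eq]] by blast
    then obtain V' \<psi>' where V': "(V', \<psi>') \<in> atlas (submanifold N S)" "y \<in> V'" "dim (model_space (V', \<psi>')) = k"
      using charts by blast
    have c1: "is_chart (dim (model_space (V, \<psi>))) ?X (V, \<psi>)"
      using submanifold_atlas_is_chart[OF N c[unfolded eq]] y by blast
    have c2: "is_chart k ?X (V', \<psi>')"
      using submanifold_atlas_is_chart[OF N V'(1)] V' by blast
    note comp = submanifold_atlas_compatible[OF N c[unfolded eq] V'(1)]
      submanifold_atlas_compatible[OF N V'(1) c[unfolded eq]]
    from local_submersion_dim_le[OF local_submersion_transition[OF c1 c2 comp(1) y V'(2)]]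
      local_submersion_dim_le[OF local_submersion_transition[OF c2 c1 comp(2) V'(2) y]]
    show ?thesis
      using c1 V'(3) eq by simp
  qed
  have "(\<Union>(V, \<psi>) \<in> atlas (submanifold N S). V) = S"
  proof
    show "(\<Union>(V, \<psi>) \<in> atlas (submanifold N S). V) \<subseteq> S"
      by (auto simp: submanifold_def)
    show "S \<subseteq> (\<Union>(V, \<psi>) \<in> atlas (submanifold N S). V)"
    proof
      fix y assume "y \<in> S"
      then show "y \<in> (\<Union>(V, \<psi>) \<in> atlas (submanifold N S). V)"
        using charts[of y] by auto
    qed
  qed
  then show ?thesis
    using chart submanifold_atlas_compatible[OF N] N S(1) unfolding smooth_manifold_def
    by (simp add: X Hausdorff_space_subtopology second_countable_subtopology Int_absorb1)
qed

text \<open>In a chart with \<open>g z = G (\<phi> z) + g y\<close> the condition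
  \<open>P (g z) = P (g y)\<close> becomes \<open>P (G (\<phi> z)) = 0\<close>, so \<open>S\<close>
  is a linear slice. With \<open>P = id\<close> the set \<open>S\<close> is locally a level set of
  \<open>g\<close>; a general \<open>P\<close> covers a fibre of the bundle described through
  coordinates of the leaf space.\<close>

lemma submersive_at_slice_chart:
  assumes N: "smooth_manifold n N" and g: "submersive_at N W g y"
    and A: "openin (top_space N) A" "y \<in> A" and y: "y \<in> S" and P: "linear P"
    and S: "\<And>z. z \<in> A \<Longrightarrow> z \<in> S \<longleftrightarrow> P (g z) = P (g y)"
  obtains U \<phi> G where "(U \<inter> S, \<phi>) \<in> atlas (submanifold N S)" "is_chart n (top_space N) (U, \<phi>)"
    "y \<in> U" "\<phi> y = 0" "linear G" "G ` model_space (U, \<phi>) = W" "\<forall>z\<in>U. g z = G (\<phi> z) + g y"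
    "model_space (U \<inter> S, \<phi>) = model_space (U, \<phi>) \<inter> {v. P (G v) = 0}"
proof -
  obtain U \<phi> G where U: "(U, \<phi>) \<in> max_atlas N" "y \<in> U" "U \<subseteq> A" "\<phi> y = 0"
    and G: "linear G" "G ` model_space (U, \<phi>) = W" "\<And>z. z \<in> U \<Longrightarrow> g z = G (\<phi> z) + g y"
    using submersive_at_adapted_chart[OF N g A] by metis
  have c: "is_chart n (top_space N) (U, \<phi>)"
    using max_atlas_is_chart[OF N U(1)] U(2) by blast
  have K: "subspace {v. P (G v) = 0}"
    using linear_subspace_kernel[OF linear_compose[OF G(1) P]] by simp
  have "z \<in> S \<longleftrightarrow> P (G (\<phi> z)) = 0" if "z \<in> U" for z
    using S[of z] that U(3) G(3)[OF that] by (auto simp: linear_add[OF P])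
  then have slice: "\<phi> ` (U \<inter> S) = \<phi> ` U \<inter> {v. P (G v) = 0}"
    by blast
  have "(U \<inter> S, \<phi>) \<in> atlas (submanifold N S)"
    unfolding submanifold_def mfd.simps mem_Collect_eq using U(1) K slice by blast
  moreover have "U \<inter> S \<noteq> {}"
    using y U(2) by blast
  ultimately show ?thesis
    using that[of U \<phi> G] c U G slice_chart(1)[OF c K slice] by blast
qed

text \<open>On \<open>S\<close> the values of \<open>g\<close> near \<open>y\<close> stay in the
  coset of \<open>{w. P w = 0}\<close> through \<open>c\<close>, hence the subtraction, and
  \<open>G\<close> maps the kernel of \<open>P \<circ> G\<close> in the model space onto that of
  \<open>P\<close> in \<open>W\<close>. As \<open>c\<close> is independent of \<open>y\<close>, one
  function serves for all points of \<open>A \<inter> S\<close>.\<close>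

lemma submersive_at_submanifold:
  assumes N: "smooth_manifold n N" and g: "submersive_at N W g y"
    and A: "openin (top_space N) A" "y \<in> A" and y: "y \<in> S" and P: "linear P"
    and S: "\<And>z. z \<in> A \<Longrightarrow> z \<in> S \<longleftrightarrow> P (g z) = P c" and c: "c \<in> W"
  shows "submersive_at (submanifold N S) (W \<inter> {w. P w = 0}) (\<lambda>z. g z - c) y"
proof -
  have Pc: "P (g y) = P c"
    using S A(2) y by blast
  obtain U \<phi> G where U: "(U \<inter> S, \<phi>) \<in> atlas (submanifold N S)" "is_chart n (top_space N) (U, \<phi>)"
      "y \<in> U" "\<phi> y = 0"
    and G: "linear G" "G ` model_space (U, \<phi>) = W" "\<forall>z\<in>U. g z = G (\<phi> z) + g y"
    and model: "model_space (U \<inter> S, \<phi>) = model_space (U, \<phi>) \<inter> {v. P (G v) = 0}"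
    by (rule submersive_at_slice_chart[OF N g A y P]) (use S Pc in simp)
  note W = submersive_at_point(2,3)[OF N g]
  let ?M = "model_space (U \<inter> S, \<phi>)"
  have ne: "U \<inter> S \<noteq> {}"
    using U(3) y by blast
  note c' = submanifold_atlas_is_chart[OF N U(1) ne]
  have "G ` ?M = W \<inter> {w. P w = 0}"
    unfolding model using G(2) by blast
  then have "local_submersion ?M (W \<inter> {w. P w = 0}) (\<lambda>v. G v + (g y - c)) (\<phi> y)"
  proof (rule local_submersion_affine[OF G(1)])
    show "\<phi> y \<in> ?M"
      using U(3) y by (auto simp: model_space_def intro: span_base)
    show "g y - c \<in> W \<inter> {w. P w = 0}"
      using W c Pc by (simp add: subspace_diff linear_diff[OF P])
  qed simp
  then have "local_submersion ?M (W \<inter> {w. P w = 0}) ((\<lambda>z. g z - c) \<circ> inv_into (U \<inter> S) \<phi>) (\<phi> y)"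
  proof (rule local_submersion_cong)
    show "openin (top_of_set ?M) (\<phi> ` (U \<inter> S))"
      using is_chart_openin_image[OF c' is_chart_openin[OF c']] by simp
    show "G x + (g y - c) = ((\<lambda>z. g z - c) \<circ> inv_into (U \<inter> S) \<phi>) x" if "x \<in> \<phi> ` (U \<inter> S)" for x
      using that G(3) is_chart_inj[OF c'] by auto
  qed (use U(3) y in auto)
  then show ?thesis
    unfolding submersive_at_def using U(1,3) y by (intro bexI[of _ "(U \<inter> S, \<phi>)"]) auto
qed

lemma smooth_manifold_fibre:
  assumes N: "smooth_manifold n N" and M: "smooth_manifold m M" and s: "submersion N M s"
    and ne: "fibre N s x \<noteq> {}"
  shows "smooth_manifold (n - m) (fibre_mfd N s x)"
  unfolding fibre_mfd_def
proof (rule smooth_manifold_submanifold[OF N _ ne])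
  show "fibre N s x \<subseteq> points N"
    by (auto simp: fibre_def)
  fix y assume y: "y \<in> fibre N s x"
  then have yN: "y \<in> points N" "s y = x"
    by (auto simp: fibre_def)
  have cont: "continuous_map (top_space N) (top_space M) s"
    using s by (simp add: submersion_def smooth_map_def)
  have "x \<in> points M"
    using continuous_map_image_subset_topspace[OF cont] yN by blast
  then obtain B \<beta> where B: "(B, \<beta>) \<in> atlas M" "x \<in> B"
    using smooth_manifold_chart_at[OF M] by metis
  note cB = smooth_manifold_is_chart[OF M B(1)]
  have g: "submersive_at N (model_space (B, \<beta>)) (\<beta> \<circ> s) y"
    using submersion_imp_submersive_at[OF N M s yN(1) B(1)] B(2) yN(2) by simp
  define A where "A = {z \<in> points N. s z \<in> B}"
  have A: "openin (top_space N) A" "y \<in> A"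
    using openin_continuous_map_preimage[OF cont is_chart_openin[OF cB]] yN B(2)
    by (auto simp: A_def)
  \<comment> \<open>\<open>\<beta>\<close> is injective on \<open>B\<close>, so inside
    \<open>A\<close> the fibre is a level set of \<open>\<beta> \<circ> s\<close>, and the slice is
    cut out with \<open>P = id\<close>.\<close>
  have S: "z \<in> fibre N s x \<longleftrightarrow> id ((\<beta> \<circ> s) z) = id ((\<beta> \<circ> s) y)" if "z \<in> A" for z
    using that yN B(2) inj_onD[OF is_chart_inj[OF cB]] by (auto simp: A_def fibre_def)
  obtain U \<phi> G where U: "(U \<inter> fibre N s x, \<phi>) \<in> atlas (submanifold N (fibre N s x))"
      "is_chart n (top_space N) (U, \<phi>)" "y \<in> U" "\<phi> y = 0"
    and G: "linear G" "G ` model_space (U, \<phi>) = model_space (B, \<beta>)"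
      "\<forall>z\<in>U. (\<beta> \<circ> s) z = G (\<phi> z) + (\<beta> \<circ> s) y"
    and model: "model_space (U \<inter> fibre N s x, \<phi>) = model_space (U, \<phi>) \<inter> {v. id (G v) = 0}"
    by (rule submersive_at_slice_chart[OF N g A y linear_id S])
  have "dim (model_space (U, \<phi>)) = n" "dim (model_space (B, \<beta>)) = m"
    using is_chart_dim[OF U(2)] is_chart_dim[OF cB] U(3) B(2) by auto
  \<comment> \<open>The dimension of the kernel plus \<open>m\<close> equals \<open>n\<close>, so
    the subtraction of natural numbers is not truncated.\<close>
  then have "dim (model_space (U \<inter> fibre N s x, \<phi>)) = n - m"
    using dim_kernel[OF G(1) subspace_model_space[of "(U, \<phi>)"]] by (simp add: G(2) model)
  then show "\<exists>(V, \<psi>) \<in> atlas (submanifold N (fibre N s x)). y \<in> V \<and> dim (model_space (V, \<psi>)) = n - m"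
    using U(1,3) y by (intro bexI[of _ "(U \<inter> fibre N s x, \<phi>)"]) auto
qed

section \<open>Bundles of foliations\<close>

text \<open>A coset of a subspace does not depend on its representative, so a plaque is the same
  seen from each of its points. This makes the generating relation symmetric; since the charts
  cover, its transitive closure is an equivalence.\<close>

lemma foliation_partition:
  assumes "foliation p N F"
  shows "partition_on (points N) F"
proof -
  obtain \<A> where A: "foliation_atlas p N \<A>" "F = leaves N \<A>"
    using assms by (auto simp: foliation_def)
  let ?X = "top_space N"
  define r where "r = (\<Union>c \<in> \<A>. plaque_rel ?X c)"
  have subspace: "subspace B" if "(U, \<phi>, B) \<in> \<A>" for U \<phi> B
    using bspec[OF conjunct1[OF A(1)[unfolded foliation_atlas_def]] that] by simp
  have cover: "\<exists>U \<phi> B. (U, \<phi>, B) \<in> \<A> \<and> x \<in> U" if "x \<in> points N" for x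
  proof -
    have "x \<in> (\<Union>(U, \<phi>, B) \<in> \<A>. U)"
      using conjunct1[OF conjunct2[OF A(1)[unfolded foliation_atlas_def]]] that by (simp only:)
    then show ?thesis
      by auto
  qed
  have r_iff: "(x, y) \<in> r \<longleftrightarrow> (\<exists>U \<phi> B. (U, \<phi>, B) \<in> \<A> \<and> x \<in> U \<and>
      connected_component_of (subtopology ?X {z \<in> U. \<phi> z - \<phi> x \<in> B}) x y)" for x y
    by (fastforce simp: r_def plaque_rel_def)
  have "r \<subseteq> points N \<times> points N"
  proof
    fix xy assume "xy \<in> r"
    then obtain x y where xy: "xy = (x, y)" "(x, y) \<in> r"
      by (cases xy) auto
    then obtain U \<phi> B where "(U, \<phi>, B) \<in> \<A>"
      and con: "connected_component_of (subtopology ?X {z \<in> U. \<phi> z - \<phi> x \<in> B}) x y"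
      using r_iff by blast
    from connected_component_in_topspace[OF con] show "xy \<in> points N \<times> points N"
      using xy(1) by (simp add: topspace_subtopology)
  qed
  then have sub: "r\<^sup>+ \<subseteq> points N \<times> points N"
    by (rule trancl_subset_Sigma)
  have "sym r"
  proof (rule symI)
    fix x y assume "(x, y) \<in> r"
    then obtain U \<phi> B where U: "(U, \<phi>, B) \<in> \<A>" "x \<in> U"
      and con: "connected_component_of (subtopology ?X {z \<in> U. \<phi> z - \<phi> x \<in> B}) x y"
      using r_iff by blast
    have y: "y \<in> U" "\<phi> y - \<phi> x \<in> B"
      using connected_component_in_topspace[OF con] by auto
    have "\<phi> z - \<phi> y \<in> B \<longleftrightarrow> \<phi> z - \<phi> x \<in> B" for z
    proof
      assume "\<phi> z - \<phi> y \<in> B"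
      from subspace_add[OF subspace[OF U(1)] this y(2)] show "\<phi> z - \<phi> x \<in> B"
        by simp
    next
      assume "\<phi> z - \<phi> x \<in> B"
      from subspace_diff[OF subspace[OF U(1)] this y(2)] show "\<phi> z - \<phi> y \<in> B"
        by simp
    qed
    then have "connected_component_of (subtopology ?X {z \<in> U. \<phi> z - \<phi> y \<in> B}) y x"
      using con by (simp add: connected_component_of_sym)
    then show "(y, x) \<in> r"
      using U y r_iff by blast
  qed
  moreover have "refl_on (points N) (r\<^sup>+)"
  proof (rule refl_onI)
    fix x assume x: "x \<in> points N"
    then obtain U \<phi> B where U: "(U, \<phi>, B) \<in> \<A>" "x \<in> U"
      using cover by blast
    then have "connected_component_of (subtopology ?X {z \<in> U. \<phi> z - \<phi> x \<in> B}) x x"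
      using x subspace_0[OF subspace[OF U(1)]]
      by (simp add: connected_component_of_refl topspace_subtopology)
    then show "(x, x) \<in> r\<^sup>+"
      using U r_iff by blast
  qed
  ultimately have "equiv (points N) (r\<^sup>+)"
    using sub by (intro equivI sym_trancl trans_trancl)
  then show ?thesis
    unfolding A(2) leaves_def r_def by (rule partition_on_quotient)
qed

lemma submersive_at_chart_map:
  assumes N: "smooth_manifold n N" and U: "(U, \<phi>) \<in> max_atlas N" "y \<in> U"
  shows "submersive_at N (model_space (U, \<phi>)) \<phi> y"
proof (rule submersive_atI[OF N U])
  have c: "is_chart n (top_space N) (U, \<phi>)"
    using max_atlas_is_chart[OF N U(1)] U(2) by blast
  have op: "openin (top_of_set (model_space (U, \<phi>))) (\<phi> ` U)"
    using is_chart_openin_image[OF c is_chart_openin[OF c]] by simp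
  have "local_submersion (model_space (U, \<phi>)) (model_space (U, \<phi>)) id (\<phi> y)"
    by (rule local_submersion_linear[OF linear_id]) (use U(2) in \<open>auto simp: model_space_def span_base\<close>)
  then show "local_submersion (model_space (U, \<phi>)) (model_space (U, \<phi>)) (\<phi> \<circ> inv_into U \<phi>) (\<phi> y)"
    by (rule local_submersion_cong[OF _ op]) (use U(2) is_chart_inj[OF c] in auto)
qed

text \<open>The derivative at \<open>y\<close> maps a subspace of \<open>'e\<close> onto
  \<open>W\<close>, and a linear right inverse of it embeds \<open>W\<close> back into
  \<open>'e\<close>. The source of a submersion thus has room for the target.\<close>

lemma submersive_at_embedding:
  fixes N :: "('a, 'e::euclidean_space) mfd" and W :: "'g::euclidean_space set"
  assumes "submersive_at N W g y"
  obtains E :: "'g \<Rightarrow> 'e" where "linear E" "inj_on E W"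
proof -
  obtain V \<psi> where l: "local_submersion (model_space (V, \<psi> :: 'a \<Rightarrow> 'e)) W (g \<circ> inv_into V \<psi>) (\<psi> y)"
    using assms by (auto simp: submersive_at_def)
  then obtain D where D: "linear D" "D ` model_space (V, \<psi>) = W"
    unfolding local_submersion_def using has_derivative_linear by blast
  obtain R where "linear R" "\<And>w. w \<in> D ` model_space (V, \<psi>) \<Longrightarrow> D (R w) = w"
    using linear_exists_right_inverse_on[OF D(1) subspace_model_space] by metis
  then show ?thesis
    using that D(2) by (metis inj_on_inverseI)
qed

context
  fixes n m :: nat and N :: "('a, 'e::euclidean_space) mfd" and M :: "('b, 'f::euclidean_space) mfd"
    and F :: "'a set set" and s :: "'a \<Rightarrow> 'b"
  assumes N: "smooth_manifold n N" and M: "smooth_manifold m M" and s: "submersion N M s"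
    and F: "partition_on (points N) F" and leaf_fibre: "\<forall>L\<in>F. \<exists>x \<in> points M. L \<subseteq> fibre N s x"
begin

section \<open>Leaves in the fibres of the bundle map\<close>

lemma leaf_of_subset_fibre:
  assumes "y \<in> points N"
  shows "leaf_of F y \<subseteq> fibre N s (s y)"
proof -
  obtain x where x: "leaf_of F y \<subseteq> fibre N s x"
    using leaf_fibre leaf_of_in(1)[OF F assms] by blast
  then have "s y = x"
    using leaf_of_in(2)[OF F assms] by (auto simp: fibre_def)
  then show ?thesis
    using x by simp
qed

lemma leaf_of_eqD:
  assumes "y \<in> points N" "z \<in> leaf_of F y"
  shows "z \<in> points N" "s z = s y" "leaf_of F z = leaf_of F y"
  using leaf_of_subset_fibre[OF assms(1)] assms leaf_of_eq[OF F leaf_of_in(1)[OF F assms(1)] assms(2)]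
  by (auto simp: fibre_def)

lemma continuous_bundle_map: "continuous_map (top_space N) (top_space M) s"
  using s by (simp add: submersion_def smooth_map_def)

lemma openin_bundle_vimage: "openin (top_space M) V \<Longrightarrow> openin (top_space N) {z \<in> points N. s z \<in> V}"
  using openin_continuous_map_preimage[OF continuous_bundle_map] .

lemma points_fibre_mfd: "points (fibre_mfd N s x) = fibre N s x"
  by (auto simp: fibre_mfd_def submanifold_def fibre_def)

lemma fibre_fol_partition: "partition_on (fibre N s x) (fibre_fol N F s x)"
proof (rule partition_onI)
  show "\<Union>(fibre_fol N F s x) = fibre N s x"
  proof
    show "fibre N s x \<subseteq> \<Union>(fibre_fol N F s x)"
    proof
      fix y assume "y \<in> fibre N s x"
      then have y: "y \<in> points N" "s y = x"
        by (auto simp: fibre_def)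
      then have "leaf_of F y \<in> fibre_fol N F s x"
        using leaf_of_subset_fibre[OF y(1)] leaf_of_in(1)[OF F y(1)]
        by (auto simp: fibre_fol_def fol_restrict_def)
      then show "y \<in> \<Union>(fibre_fol N F s x)"
        using leaf_of_in(2)[OF F y(1)] by blast
    qed
  qed (auto simp: fibre_fol_def fol_restrict_def)
  show "disjnt p q" if "p \<in> fibre_fol N F s x" "q \<in> fibre_fol N F s x" "p \<noteq> q" for p q
    using that pairwiseD(1)[OF partition_onD2[OF F], of p q] by (simp add: fibre_fol_def fol_restrict_def)
  show "{} \<notin> fibre_fol N F s x"
    using partition_onD3[OF F] by (simp add: fibre_fol_def fol_restrict_def)
qed

lemma leaf_of_fibre_fol:
  assumes "y \<in> fibre N s x"
  shows "leaf_of (fibre_fol N F s x) y = leaf_of F y"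
proof (rule leaf_of_eq[OF fibre_fol_partition])
  have y: "y \<in> points N" "s y = x"
    using assms by (auto simp: fibre_def)
  then show "leaf_of F y \<in> fibre_fol N F s x" "y \<in> leaf_of F y"
    using leaf_of_subset_fibre[OF y(1)] leaf_of_in[OF F y(1)]
    by (auto simp: fibre_fol_def fol_restrict_def)
qed

lemma openin_fibre_mfd: "openin (top_space N) A \<Longrightarrow> openin (top_space (fibre_mfd N s x)) (A \<inter> fibre N s x)"
  by (auto simp: fibre_mfd_def submanifold_def openin_subtopology)

lemma strictly_simple_fibre:
  assumes simple: "strictly_simple N F" and ne: "fibre N s x \<noteq> {}"
  shows "strictly_simple (fibre_mfd N s x) (fibre_fol N F s x)"
proof -
  let ?\<pi> = "leaf_of F" and ?S = "fibre N s x" and ?Fx = "fibre_fol N F s x"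
  obtain Q :: "('a set, 'e) mfd" and d where Q: "smooth_manifold d Q" and pQ: "points Q = F"
    and quot: "quotient_map (top_space N) (top_space Q) ?\<pi>" and sub: "submersion N Q ?\<pi>"
    using simple by (auto simp: strictly_simple_def)
  have op: "openin (top_space N) {z \<in> points N. ?\<pi> z \<in> V}" if "openin (top_space Q) V" for V
    using openin_continuous_map_preimage[OF quotient_imp_continuous_map[OF quot] that] .
  have SN: "?S \<subseteq> points N"
    by (auto simp: fibre_def)
  have leaf_S: "?\<pi> z \<subseteq> ?S" if "z \<in> ?S" for z
    using leaf_of_subset_fibre[of z] that by (auto simp: fibre_def)
  have part: "partition_on (points (fibre_mfd N s x)) ?Fx"
    using fibre_fol_partition by (simp add: points_fibre_mfd)
  show ?thesis
  proof (rule strictly_simpleI[OF smooth_manifold_fibre[OF N M s ne] part, of "d - m"])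
    fix L L' assume L: "L \<in> ?Fx" "L' \<in> ?Fx" "L \<noteq> L'"
    then have LF: "L \<in> F" "L' \<in> F" "L \<subseteq> ?S" "L' \<subseteq> ?S"
      by (auto simp: fibre_fol_def fol_restrict_def)
    have "Hausdorff_space (top_space Q)"
      using Q by (simp add: smooth_manifold_def)
    \<comment> \<open>Preimages of separating open sets of the leaf space of \<open>N\<close>, cut
      with the fibre, are saturated for the restricted foliation.\<close>
    then obtain V V' where V: "openin (top_space Q) V" "openin (top_space Q) V'" "L \<in> V" "L' \<in> V'" "disjnt V V'"
      using LF L(3) pQ unfolding Hausdorff_space_def by metis
    let ?A = "\<lambda>V. {z \<in> points N. ?\<pi> z \<in> V} \<inter> ?S"
    have sat: "\<forall>z\<in>?A V. leaf_of ?Fx z \<subseteq> ?A V" for V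
    proof (intro ballI subsetI)
      fix z w assume z: "z \<in> ?A V" and w: "w \<in> leaf_of ?Fx z"
      then have w: "w \<in> ?\<pi> z"
        using leaf_of_fibre_fol by simp
      show "w \<in> ?A V"
        using leaf_of_eqD[of z w] leaf_S[of z] z w by auto
    qed
    have in_A: "K \<subseteq> ?A V" if "K \<in> F" "K \<subseteq> ?S" "K \<in> V" for K V
    proof
      fix z assume z: "z \<in> K"
      show "z \<in> ?A V"
        using leaf_of_eq[OF F that(1) z] that z SN by auto
    qed
    have "?A V \<inter> ?A V' = {}"
      using V(5) by (auto simp: disjnt_iff)
    then show "\<exists>A A'. openin (top_space (fibre_mfd N s x)) A \<and> openin (top_space (fibre_mfd N s x)) A' \<and>
        A \<inter> A' = {} \<and> L \<subseteq> A \<and> L' \<subseteq> A' \<and> (\<forall>z\<in>A. leaf_of ?Fx z \<subseteq> A) \<and> (\<forall>z\<in>A'. leaf_of ?Fx z \<subseteq> A')"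
      using openin_fibre_mfd[OF op[OF V(1)]] openin_fibre_mfd[OF op[OF V(2)]] sat
        in_A[OF LF(1,3) V(3)] in_A[OF LF(2,4) V(4)]
      by (intro exI[of _ "?A V"] exI[of _ "?A V'"] conjI)
  next
    fix y assume "y \<in> points (fibre_mfd N s x)"
    then have y: "y \<in> ?S" "y \<in> points N" "s y = x"
      by (auto simp: points_fibre_mfd fibre_def)
    have "?\<pi> y \<in> points Q"
      using leaf_of_in(1)[OF F y(2)] pQ by simp
    then obtain V \<psi> where V: "(V, \<psi>) \<in> atlas Q" "?\<pi> y \<in> V"
      using smooth_manifold_chart_at[OF Q] by metis
    note cV = smooth_manifold_is_chart[OF Q V(1)]
    have "x \<in> points M"
      using continuous_map_image_subset_topspace[OF continuous_bundle_map] y by blast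
    then obtain B \<beta> where B: "(B, \<beta>) \<in> atlas M" "x \<in> B"
      using smooth_manifold_chart_at[OF M] by metis
    note cB = smooth_manifold_is_chart[OF M B(1)]
    let ?W = "model_space (V, \<psi>)" and ?W' = "model_space (B, \<beta>)"
    define g where "g = \<psi> \<circ> ?\<pi>"
    define A1 where "A1 = {z \<in> points N. ?\<pi> z \<in> V} \<inter> {z \<in> points N. s z \<in> B}"
    have A1: "openin (top_space N) A1" "y \<in> A1" "A1 \<subseteq> points N"
      using op[OF is_chart_openin[OF cV]] openin_bundle_vimage[OF is_chart_openin[OF cB]] y V B
      by (auto simp: A1_def)
    have g: "submersive_at N ?W g z" if "z \<in> A1" for z
      using submersion_imp_submersive_at[OF N Q sub _ V(1)] that by (auto simp: A1_def g_def)
    have g_eq: "g a = g b \<longleftrightarrow> ?\<pi> a = ?\<pi> b" if "a \<in> A1" "b \<in> A1" for a b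
      using that inj_on_eq_iff[OF is_chart_inj[OF cV]] by (auto simp: A1_def g_def)
    have s_eq: "s a = s b" if "a \<in> A1" "b \<in> A1" "?\<pi> a = ?\<pi> b" for a b
      using leaf_of_eqD(2)[of b a] leaf_of_in(2)[OF F, of a] that A1(3) by auto
    \<comment> \<open>\<open>s\<close> is constant on leaves and \<open>g\<close> separates them on
      \<open>A1\<close>, so \<open>\<beta> \<circ> s\<close> factors through \<open>g\<close>. The
      choice picks a preimage in \<open>A1\<close>; off the image of \<open>A1\<close> the value is
      arbitrary.\<close>
    define k where "k w = \<beta> (s (SOME z. z \<in> A1 \<and> g z = w))" for w
    have k: "(\<beta> \<circ> s) z = k (g z)" if "z \<in> A1" for z
    proof -
      have "(SOME w. w \<in> A1 \<and> g w = g z) \<in> A1 \<and> g (SOME w. w \<in> A1 \<and> g w = g z) = g z"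
        by (rule someI[of _ z]) (use that in simp)
      then show ?thesis
        using s_eq g_eq that unfolding k_def comp_def by metis
    qed
    have "submersive_at N ?W' (\<beta> \<circ> s) y"
      using submersion_imp_submersive_at[OF N M s y(2) B(1)] B(2) y(3) by simp
    \<comment> \<open>Both \<open>g\<close> and \<open>\<beta> \<circ> s\<close> are submersions, so
      their factor \<open>k\<close>, though defined by choice, is a local submersion and has a
      normal form.\<close>
    from submersive_at_factor[OF N g[OF A1(2)] this A1(1,2) k]
    have "local_submersion ?W ?W' k (g y)" .
    then obtain P T T' \<theta> \<theta>' where P: "linear P" "P ` ?W = ?W'"
      and T: "openin (top_of_set ?W) T" "g y \<in> T" "openin (top_of_set ?W) T'"
      and hom: "homeomorphism T T' \<theta> \<theta>'" and sm: "smooth_on T \<theta>" "smooth_on T' \<theta>'"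
      and kP: "\<And>w. w \<in> T \<Longrightarrow> k w = P (\<theta> w)"
      using local_submersion_normal_form[OF subspace_model_space] by metis
    have \<theta>: "local_submersion ?W ?W \<theta> w" if "w \<in> T" for w
      by (rule local_submersion_inverse[OF _ _ T(1,3) that sm(1) _ sm(2)])
        (use hom in \<open>auto simp: homeomorphism_def\<close>)
    have \<theta>_eq: "\<theta> v = \<theta> w \<longleftrightarrow> v = w" if "v \<in> T" "w \<in> T" for v w
      using hom that unfolding homeomorphism_def by metis
    define A where "A = {z \<in> A1. g z \<in> T}"
    have A: "openin (top_space N) A" "y \<in> A"
      using submersive_on_openin_vimage[OF N A1(1) g T(1)] A1(2) T(2) by (auto simp: A_def)
    have A_A1: "z \<in> A1" "g z \<in> T" if "z \<in> A" for z
      using that by (auto simp: A_def)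
    \<comment> \<open>In the coordinates \<open>\<theta> \<circ> g\<close> the base coordinate
      \<open>\<beta> \<circ> s\<close> is the linear function \<open>P\<close>, so within
      \<open>A\<close> the fibre over \<open>x\<close> is where \<open>P\<close> takes the value
      \<open>P c\<close>.\<close>
    define c where "c = (\<theta> \<circ> g) y"
    have \<theta>g: "submersive_at N ?W (\<theta> \<circ> g) z" if "z \<in> A" for z
      using submersive_at_compose[OF N g \<theta>] A_A1[OF that] by blast
    have c: "c \<in> ?W"
      unfolding c_def by (rule submersive_at_point(2)[OF N \<theta>g[OF A(2)]])
    have fib: "z \<in> ?S \<longleftrightarrow> P ((\<theta> \<circ> g) z) = P c" if z: "z \<in> A" for z
    proof -
      have "\<beta> (s w) = P ((\<theta> \<circ> g) w)" if "w \<in> A" for w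
        using k[OF A_A1(1)[OF that]] kP[OF A_A1(2)[OF that]] by simp
      then have "P ((\<theta> \<circ> g) z) = P c \<longleftrightarrow> \<beta> (s z) = \<beta> x"
        using z A(2) y(3) unfolding c_def by metis
      also have "\<dots> \<longleftrightarrow> s z = x"
        using inj_on_eq_iff[OF is_chart_inj[OF cB]] A_A1(1)[OF z] B(2) by (auto simp: A1_def)
      finally show ?thesis
        using A_A1(1)[OF z] A1(3) by (auto simp: fibre_def)
    qed
    have "submersive_at (fibre_mfd N s x) (?W \<inter> {w. P w = 0}) (\<lambda>z. (\<theta> \<circ> g) z - c) z" if "z \<in> A \<inter> ?S" for z
      unfolding fibre_mfd_def
      by (rule submersive_at_submanifold[OF N \<theta>g A(1) _ _ P(1) fib c]) (use that in auto)
    \<comment> \<open>\<open>P\<close> maps \<open>?W\<close> of dimension \<open>d\<close> onto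
      \<open>?W'\<close> of dimension \<open>m\<close>, so \<open>d - m\<close> is a genuine
      difference.\<close>
    moreover have "dim (?W \<inter> {w. P w = 0}) = d - m"
      using dim_kernel[OF P(1) subspace_model_space[of "(V, \<psi>)"]] is_chart_dim[OF cV] is_chart_dim[OF cB] V B P(2)
      by fastforce
    moreover have "leaf_of ?Fx z \<subseteq> A \<inter> ?S" if z: "z \<in> A \<inter> ?S" for z
    proof
      fix w assume "w \<in> leaf_of ?Fx z"
      then have w: "w \<in> ?\<pi> z"
        using leaf_of_fibre_fol z by simp
      have zN: "z \<in> points N"
        using z SN by blast
      have "w \<in> A1" "g w = g z"
        using leaf_of_eqD[OF zN w] z A_A1(1)[of z] by (auto simp: A1_def g_def)
      then show "w \<in> A \<inter> ?S"
        using A_A1(2)[of z] z w leaf_S by (auto simp: A_def)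
    qed
    moreover have "(\<theta> \<circ> g) a - c = (\<theta> \<circ> g) b - c \<longleftrightarrow> leaf_of ?Fx a = leaf_of ?Fx b"
      if "a \<in> A \<inter> ?S" "b \<in> A \<inter> ?S" for a b
      using that \<theta>_eq g_eq A_A1 by (simp add: leaf_of_fibre_fol)
    ultimately show "\<exists>A g W. openin (top_space (fibre_mfd N s x)) A \<and> y \<in> A \<and>
        (\<forall>z\<in>A. leaf_of ?Fx z \<subseteq> A) \<and> dim (W :: 'e set) = d - m \<and>
        (\<forall>z\<in>A. submersive_at (fibre_mfd N s x) W g z) \<and>
        (\<forall>a\<in>A. \<forall>b\<in>A. g a = g b \<longleftrightarrow> leaf_of ?Fx a = leaf_of ?Fx b)"
      using openin_fibre_mfd[OF A(1)] A(2) y(1)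
      by (intro exI[of _ "A \<inter> ?S"] exI[of _ "\<lambda>z. (\<theta> \<circ> g) z - c"] exI[of _ "?W \<inter> {w. P w = 0}"]) blast
  qed
qed

text \<open>A leaf in \<open>S\<close> goes to some \<open>L \<times> {u}\<close>; evaluating at its
  point \<open>a\<close> identifies \<open>L\<close> as the leaf of \<open>fst (h a)\<close> and
  \<open>u\<close> as \<open>s a\<close>. Injectivity of \<open>h\<close> turns equality of leaves
  into equality of these pairs.\<close>

lemma trivialization_leaves:
  fixes x\<^sub>0 :: 'b and U :: "'b set" and h :: "'a \<Rightarrow> 'a \<times> 'b"
  defines "S \<equiv> {y \<in> points N. s y \<in> U}"
  assumes U: "openin (top_space M) U"
    and h: "diffeomorphism (submanifold N S) (prod_mfd (fibre_mfd N s x\<^sub>0) (submanifold M U)) h"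
    and snd: "\<forall>y\<in>S. snd (h y) = s y"
    and leaves: "(`) h ` fol_restrict F S = {L \<times> {u} | L u. L \<in> fibre_fol N F s x\<^sub>0 \<and> u \<in> U}"
  shows "y \<in> S \<Longrightarrow> fst (h y) \<in> fibre N s x\<^sub>0"
    and "a \<in> S \<Longrightarrow> b \<in> S \<Longrightarrow> leaf_of F a = leaf_of F b \<longleftrightarrow>
      leaf_of (fibre_fol N F s x\<^sub>0) (fst (h a)) = leaf_of (fibre_fol N F s x\<^sub>0) (fst (h b)) \<and> s a = s b"
    and "openin (top_space (fibre_mfd N s x\<^sub>0)) V \<Longrightarrow> openin (top_space N) {z \<in> S. fst (h z) \<in> V}"
proof -
  let ?F0 = "fibre_fol N F s x\<^sub>0"
  have SN: "S \<subseteq> points N"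
    by (auto simp: S_def)
  have pS: "points (submanifold N S) = S"
    using SN by (auto simp: submanifold_def)
  have bij: "bij_betw h S (fibre N s x\<^sub>0 \<times> (points M \<inter> U))"
    using h points_fibre_mfd[of x\<^sub>0] unfolding diffeomorphism_def pS
    by (simp add: prod_mfd_def submanifold_def)
  show fst: "fst (h y) \<in> fibre N s x\<^sub>0" if "y \<in> S" for y
    using bij_betwE[OF bij] that by fastforce
  have image: "h ` leaf_of F a = leaf_of ?F0 (fst (h a)) \<times> {s a}" "leaf_of F a \<subseteq> S" if a: "a \<in> S" for a
  proof -
    have aN: "a \<in> points N"
      using a SN by blast
    show leaf: "leaf_of F a \<subseteq> S"
      using leaf_of_subset_fibre[OF aN] a by (auto simp: S_def fibre_def)
    then have "leaf_of F a \<in> fol_restrict F S"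
      using leaf_of_in(1)[OF F aN] by (simp add: fol_restrict_def)
    then have "h ` leaf_of F a \<in> {L \<times> {u} | L u. L \<in> ?F0 \<and> u \<in> U}"
      using leaves by blast
    then obtain L u where L: "L \<in> ?F0" "h ` leaf_of F a = L \<times> {u}"
      by blast
    have "h a \<in> L \<times> {u}"
      using L(2) leaf_of_in(2)[OF F aN] by blast
    then have "fst (h a) \<in> L" "snd (h a) = u"
      by auto
    then show "h ` leaf_of F a = leaf_of ?F0 (fst (h a)) \<times> {s a}"
      using leaf_of_eq[OF fibre_fol_partition L(1)] L(2) bspec[OF snd a] by simp
  qed
  show "leaf_of F a = leaf_of F b \<longleftrightarrow>
      leaf_of ?F0 (fst (h a)) = leaf_of ?F0 (fst (h b)) \<and> s a = s b" if a: "a \<in> S" and b: "b \<in> S"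
  proof -
    have "leaf_of F a = leaf_of F b \<longleftrightarrow> h ` leaf_of F a = h ` leaf_of F b"
      using inj_on_image_eq_iff[OF bij_betw_imp_inj_on[OF bij] image(2)[OF a] image(2)[OF b]] by simp
    moreover have "fst (h a) \<in> leaf_of ?F0 (fst (h a))"
      by (rule leaf_of_in(2)[OF fibre_fol_partition fst[OF a]])
    ultimately show ?thesis
      unfolding image(1)[OF a] image(1)[OF b] times_eq_iff by auto
  qed
  show "openin (top_space N) {z \<in> S. fst (h z) \<in> V}" if V: "openin (top_space (fibre_mfd N s x\<^sub>0)) V"
  proof -
    have "continuous_map (subtopology (top_space N) S)
        (prod_topology (top_space (fibre_mfd N s x\<^sub>0)) (top_space (submanifold M U))) h"
      using h by (simp add: diffeomorphism_def smooth_map_def submanifold_def prod_mfd_def)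
    from continuous_map_compose[OF this continuous_map_fst]
    have "openin (subtopology (top_space N) S) {z \<in> topspace (subtopology (top_space N) S). (fst \<circ> h) z \<in> V}"
      using V by (rule openin_continuous_map_preimage)
    moreover have "openin (top_space N) S"
      unfolding S_def by (rule openin_bundle_vimage[OF U])
    ultimately have "openin (top_space N) {z \<in> topspace (subtopology (top_space N) S). (fst \<circ> h) z \<in> V}"
      using openin_trans_full by blast
    moreover have "topspace (subtopology (top_space N) S) = S"
      using SN by auto
    ultimately show ?thesis
      by (simp only: comp_apply)
  qed
qed

text \<open>On \<open>S\<close> the map is \<open>map_prod g \<beta> \<circ> h\<close>, because the
  second component of \<open>h\<close> is \<open>s\<close>. It is thus a product of submersions
  preceded by a diffeomorphism, and being submersive at a point is the same in an open
  submanifold.\<close>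

lemma trivialization_submersive:
  fixes x\<^sub>0 :: 'b and U :: "'b set" and h :: "'a \<Rightarrow> 'a \<times> 'b"
  defines "S \<equiv> {y \<in> points N. s y \<in> U}"
  assumes U: "openin (top_space M) U"
    and h: "diffeomorphism (submanifold N S) (prod_mfd (fibre_mfd N s x\<^sub>0) (submanifold M U)) h"
    and snd: "\<forall>y\<in>S. snd (h y) = s y"
    and N0: "smooth_manifold k (fibre_mfd N s x\<^sub>0)"
    and y: "y \<in> S" and g: "submersive_at (fibre_mfd N s x\<^sub>0) W g (fst (h y))"
    and B: "(B, \<beta>) \<in> atlas M" "s y \<in> B"
  shows "submersive_at N (W \<times> model_space (B, \<beta>)) (\<lambda>z. (g (fst (h z)), \<beta> (s z))) y"
proof -
  have S: "openin (top_space N) S"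
    unfolding S_def by (rule openin_bundle_vimage[OF U])
  have sU: "s y \<in> U"
    using y by (simp add: S_def)
  have "submersive_at M (model_space (B, \<beta>)) \<beta> (s y)"
    using submersive_at_chart_map[OF M _ B(2)] atlas_subset_max_atlas[OF M] B(1) by blast
  then have \<beta>: "submersive_at (submanifold M U) (model_space (B, \<beta>)) \<beta> (s y)"
    by (simp only: submersive_at_submanifold_open[OF M U sU])
  have atlasU: "is_chart m (top_space (submanifold M U)) c" if "c \<in> atlas (submanifold M U)" "fst c \<noteq> {}" for c
    using atlas_submanifold_open(2)[OF M U] that by (cases c) auto
  have "submersive_at (prod_mfd (fibre_mfd N s x\<^sub>0) (submanifold M U)) (W \<times> model_space (B, \<beta>))
      (map_prod g \<beta>) (fst (h y), s y)"
    using submersive_at_prod[OF smooth_manifold_is_chart[OF N0] atlasU g \<beta>] .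
  then have prod: "submersive_at (prod_mfd (fibre_mfd N s x\<^sub>0) (submanifold M U)) (W \<times> model_space (B, \<beta>))
      (map_prod g \<beta>) (h y)"
    using bspec[OF snd y] by (metis prod.collapse)
  have atlas: "is_chart (k + m) (top_space (prod_mfd (fibre_mfd N s x\<^sub>0) (submanifold M U))) c"
    if in_atlas: "c \<in> atlas (prod_mfd (fibre_mfd N s x\<^sub>0) (submanifold M U))" and "fst c \<noteq> {}" for c
  proof -
    obtain A \<phi> A' \<phi>' where c: "c = (A \<times> A', map_prod \<phi> \<phi>')" "(A, \<phi>) \<in> atlas (fibre_mfd N s x\<^sub>0)"
        "(A', \<phi>') \<in> atlas (submanifold M U)"
      using in_atlas by (auto simp: prod_mfd_def)
    then have "A' \<noteq> {}"
      using that(2) by auto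
    then show ?thesis
      using is_chart_map_prod[OF smooth_manifold_is_chart[OF N0 c(2)] atlasU[OF c(3)]]
      by (simp add: c(1) prod_mfd_def)
  qed
  obtain V \<psi> where V: "(V, \<psi>) \<in> atlas (submanifold N S)" "y \<in> V"
    using submanifold_open_chart_at[OF N S y] by metis
  have cV: "is_chart n (top_space (submanifold N S)) (V, \<psi>)"
    using atlas_submanifold_open(2)[OF N S V(1)] V(2) by blast
  have "submersive_at (submanifold N S) (W \<times> model_space (B, \<beta>)) (map_prod g \<beta> \<circ> h) y"
    using submersive_at_diffeomorphism[OF V(2,1) cV atlas h prod] .
  then have "submersive_at N (W \<times> model_space (B, \<beta>)) (map_prod g \<beta> \<circ> h) y"
    using submersive_at_submanifold_open[OF N S y] by blast
  then show ?thesis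
    by (rule submersive_at_cong[OF N _ S y]) (simp add: snd map_prod_def split_beta)
qed

text \<open>
  Working with one fixed fibre makes the dimension of the leaf space constant.  The charts obtained
  from a trivialization take values in \<open>'e \<times> 'f\<close>, and the linear map \<open>E\<close> moves them into \<open>'e\<close>.
\<close>

lemma strictly_simple_total:
  assumes simple: "strictly_simple (fibre_mfd N s x\<^sub>0) (fibre_fol N F s x\<^sub>0)"
    and ne: "fibre N s x\<^sub>0 \<noteq> {}"
    and triv: "\<And>x. x \<in> points M \<Longrightarrow> \<exists>U h. openin (top_space M) U \<and> x \<in> U \<and>
        diffeomorphism (submanifold N {y \<in> points N. s y \<in> U})
          (prod_mfd (fibre_mfd N s x\<^sub>0) (submanifold M U)) h \<and>
        (\<forall>y \<in> points N. s y \<in> U \<longrightarrow> snd (h y) = s y) \<and>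
        (`) h ` fol_restrict F {y \<in> points N. s y \<in> U} =
          {L \<times> {u} | L u. L \<in> fibre_fol N F s x\<^sub>0 \<and> u \<in> U}"
  shows "strictly_simple N F"
proof -
  let ?N0 = "fibre_mfd N s x\<^sub>0"
  let ?\<pi> = "leaf_of F" and ?\<rho> = "leaf_of (fibre_fol N F s x\<^sub>0)"
  obtain Q :: "('a set, 'e) mfd" and d where Q: "smooth_manifold d Q" and pQ: "points Q = fibre_fol N F s x\<^sub>0"
    and quot: "quotient_map (top_space ?N0) (top_space Q) ?\<rho>" and sub: "submersion ?N0 Q ?\<rho>"
    using simple by (auto simp: strictly_simple_def)
  have N0: "smooth_manifold (n - m) ?N0"
    by (rule smooth_manifold_fibre[OF N M s ne])
  have op0: "openin (top_space ?N0) {z \<in> points ?N0. ?\<rho> z \<in> V}" if "openin (top_space Q) V" for V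
    using openin_continuous_map_preimage[OF quotient_imp_continuous_map[OF quot] that] .
  \<comment> \<open>The trivialization is condensed into a map \<open>q\<close> from the preimage of
    \<open>U\<close> to the leaf space \<open>Q\<close> of the fixed fibre. The pair
    \<open>(q, s)\<close> separates the leaves over \<open>U\<close>, and its composite with charts
    of \<open>Q\<close> and of the base is a submersion. Only these facts enter below.\<close>
  have trivial: "\<exists>U q. openin (top_space M) U \<and> s y \<in> U \<and>
      (\<forall>z. z \<in> points N \<longrightarrow> s z \<in> U \<longrightarrow> q z \<in> points Q) \<and>
      (\<forall>a b. a \<in> points N \<longrightarrow> s a \<in> U \<longrightarrow> b \<in> points N \<longrightarrow> s b \<in> U \<longrightarrow>
          (?\<pi> a = ?\<pi> b \<longleftrightarrow> q a = q b \<and> s a = s b)) \<and>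
      (\<forall>V. openin (top_space Q) V \<longrightarrow> openin (top_space N) {z \<in> points N. s z \<in> U \<and> q z \<in> V}) \<and>
      (\<forall>V \<psi> B \<beta> z. (V, \<psi>) \<in> atlas Q \<longrightarrow> (B, \<beta>) \<in> atlas M \<longrightarrow> z \<in> points N \<longrightarrow> s z \<in> U \<longrightarrow>
          s z \<in> B \<longrightarrow> q z \<in> V \<longrightarrow>
          submersive_at N (model_space (V, \<psi>) \<times> model_space (B, \<beta>)) (\<lambda>z. (\<psi> (q z), \<beta> (s z))) z)"
    if y: "y \<in> points N" for y
  proof -
    have "s y \<in> points M"
      using continuous_map_image_subset_topspace[OF continuous_bundle_map] y by blast
    from triv[OF this] obtain U h where U: "openin (top_space M) U" "s y \<in> U"
      and h: "diffeomorphism (submanifold N {y \<in> points N. s y \<in> U}) (prod_mfd ?N0 (submanifold M U)) h"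
      and snd: "\<forall>y\<in>{y \<in> points N. s y \<in> U}. snd (h y) = s y"
      and leaves: "(`) h ` fol_restrict F {y \<in> points N. s y \<in> U} =
          {L \<times> {u} | L u. L \<in> fibre_fol N F s x\<^sub>0 \<and> u \<in> U}"
      by auto
    note tl = trivialization_leaves[OF U(1) h snd leaves]
    have f1: "?\<rho> (fst (h z)) \<in> points Q" if "z \<in> points N" "s z \<in> U" for z
      using leaf_of_in(1)[OF fibre_fol_partition tl(1)] that pQ by simp
    have f2: "?\<pi> a = ?\<pi> b \<longleftrightarrow> ?\<rho> (fst (h a)) = ?\<rho> (fst (h b)) \<and> s a = s b"
      if "a \<in> points N" "s a \<in> U" "b \<in> points N" "s b \<in> U" for a b
      using tl(2)[of a b] that by blast
    have f3: "openin (top_space N) {z \<in> points N. s z \<in> U \<and> ?\<rho> (fst (h z)) \<in> V}"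
      if V: "openin (top_space Q) V" for V
    proof -
      have "{z \<in> {y \<in> points N. s y \<in> U}. fst (h z) \<in> {z \<in> points ?N0. ?\<rho> z \<in> V}} =
          {z \<in> points N. s z \<in> U \<and> ?\<rho> (fst (h z)) \<in> V}"
        using tl(1) points_fibre_mfd by blast
      then show ?thesis
        using tl(3)[OF op0[OF V]] by metis
    qed
    have f4: "submersive_at N (model_space (V, \<psi>) \<times> model_space (B, \<beta>))
          (\<lambda>z. (\<psi> (?\<rho> (fst (h z))), \<beta> (s z))) z"
      if V: "(V, \<psi>) \<in> atlas Q" and B: "(B, \<beta>) \<in> atlas M" and z: "z \<in> points N" "s z \<in> U" "s z \<in> B"
        and zV: "?\<rho> (fst (h z)) \<in> V" for V \<psi> B \<beta> z
    proof -
      have "fst (h z) \<in> points ?N0"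
        using tl(1) z points_fibre_mfd by simp
      from submersion_imp_submersive_at[OF N0 Q sub this V zV]
      have g: "submersive_at ?N0 (model_space (V, \<psi>)) (\<psi> \<circ> ?\<rho>) (fst (h z))" .
      have zS: "z \<in> {y \<in> points N. s y \<in> U}"
        using z by simp
      from trivialization_submersive[OF U(1) h snd N0 zS g B z(3)] show ?thesis
        by (simp only: comp_apply)
    qed
    show ?thesis
      by (rule exI[of _ U], rule exI[of _ "\<lambda>z. ?\<rho> (fst (h z))"],
          intro conjI U; intro allI impI; rule f1 f2 f3 f4; assumption)
  qed
  show ?thesis
  proof (rule strictly_simpleI[OF N F, of "d + m"])
    fix L L' assume L: "L \<in> F" "L' \<in> F" "L \<noteq> L'"
    obtain y where y: "y \<in> points N" "L = ?\<pi> y"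
      using leaf_of_image[OF F] L(1) by (metis imageE)
    obtain y' where y': "y' \<in> points N" "L' = ?\<pi> y'"
      using leaf_of_image[OF F] L(2) by (metis imageE)
    show "\<exists>A A'. openin (top_space N) A \<and> openin (top_space N) A' \<and> A \<inter> A' = {} \<and> L \<subseteq> A \<and> L' \<subseteq> A' \<and>
        (\<forall>x\<in>A. ?\<pi> x \<subseteq> A) \<and> (\<forall>x\<in>A'. ?\<pi> x \<subseteq> A')"
    \<comment> \<open>Leaves over different points are separated by the base. Over the same point
      both lie in one trivialization, where the Hausdorff property of \<open>Q\<close> separates
      them.\<close>
    proof (cases "s y = s y'")
      case False
      have "Hausdorff_space (top_space M)" "s y \<in> points M" "s y' \<in> points M"
        using M continuous_map_image_subset_topspace[OF continuous_bundle_map] y y'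
        by (auto simp: smooth_manifold_def)
      then obtain V V' where V: "openin (top_space M) V" "openin (top_space M) V'" "s y \<in> V" "s y' \<in> V'" "disjnt V V'"
        using False unfolding Hausdorff_space_def by metis
      let ?A = "\<lambda>V. {z \<in> points N. s z \<in> V}"
      have sat: "?\<pi> z \<subseteq> ?A V" if "z \<in> ?A V" for z V
        using leaf_of_eqD(1,2) that by auto
      have "?A V \<inter> ?A V' = {}"
        using V(5) by (auto simp: disjnt_iff)
      moreover have "y \<in> ?A V" "y' \<in> ?A V'"
        using y y' V by auto
      ultimately show ?thesis
        using openin_bundle_vimage[OF V(1)] openin_bundle_vimage[OF V(2)] sat y(2) y'(2) by meson
    next
      case True
      from trivial[OF y(1)] obtain U q where U: "openin (top_space M) U" "s y \<in> U"
        and Q': "\<forall>z. z \<in> points N \<longrightarrow> s z \<in> U \<longrightarrow> q z \<in> points Q"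
        and eq': "\<forall>a b. a \<in> points N \<longrightarrow> s a \<in> U \<longrightarrow> b \<in> points N \<longrightarrow> s b \<in> U \<longrightarrow>
          (?\<pi> a = ?\<pi> b \<longleftrightarrow> q a = q b \<and> s a = s b)"
        and op': "\<forall>V. openin (top_space Q) V \<longrightarrow>
          openin (top_space N) {z \<in> points N. s z \<in> U \<and> q z \<in> V}"
        by (elim exE conjE) (rule that)
      note tQ = Q'[rule_format] and t_eq = eq'[rule_format] and t_op = op'[rule_format]
      have "q y \<noteq> q y'"
        using t_eq[of y y'] True y y' U(2) L(3) by auto
      moreover have "Hausdorff_space (top_space Q)"
        using Q by (simp add: smooth_manifold_def)
      ultimately obtain V V' where V: "openin (top_space Q) V" "openin (top_space Q) V'"
          "q y \<in> V" "q y' \<in> V'" "disjnt V V'"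
        using tQ[OF y(1) U(2)] tQ[OF y'(1)] U(2) True unfolding Hausdorff_space_def by metis
      let ?A = "\<lambda>V. {z \<in> points N. s z \<in> U \<and> q z \<in> V}"
      have sat: "?\<pi> z \<subseteq> ?A V" if z: "z \<in> ?A V" for z V
      proof
        fix w assume w: "w \<in> ?\<pi> z"
        have zN: "z \<in> points N" "s z \<in> U"
          using z by auto
        note w' = leaf_of_eqD[OF zN(1) w]
        then show "w \<in> ?A V"
          using t_eq[of w z] zN z by auto
      qed
      have "?A V \<inter> ?A V' = {}"
        using V(5) by (auto simp: disjnt_iff)
      moreover have "y \<in> ?A V" "y' \<in> ?A V'"
        using y y' V U True by auto
      ultimately show ?thesis
        using t_op[OF V(1)] t_op[OF V(2)] sat y(2) y'(2) by meson
    qed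
  next
    fix y assume y: "y \<in> points N"
    from trivial[OF y] obtain U q where U: "openin (top_space M) U" "s y \<in> U"
      and Q': "\<forall>z. z \<in> points N \<longrightarrow> s z \<in> U \<longrightarrow> q z \<in> points Q"
      and eq': "\<forall>a b. a \<in> points N \<longrightarrow> s a \<in> U \<longrightarrow> b \<in> points N \<longrightarrow> s b \<in> U \<longrightarrow>
        (?\<pi> a = ?\<pi> b \<longleftrightarrow> q a = q b \<and> s a = s b)"
      and op': "\<forall>V. openin (top_space Q) V \<longrightarrow>
        openin (top_space N) {z \<in> points N. s z \<in> U \<and> q z \<in> V}"
      and sub': "\<forall>V \<psi> B \<beta> z. (V, \<psi>) \<in> atlas Q \<longrightarrow> (B, \<beta>) \<in> atlas M \<longrightarrow> z \<in> points N \<longrightarrow>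
        s z \<in> U \<longrightarrow> s z \<in> B \<longrightarrow> q z \<in> V \<longrightarrow>
        submersive_at N (model_space (V, \<psi>) \<times> model_space (B, \<beta>)) (\<lambda>z. (\<psi> (q z), \<beta> (s z))) z"
      by (elim exE conjE) (rule that)
    note tQ = Q'[rule_format] and t_eq = eq'[rule_format] and t_op = op'[rule_format]
      and t_sub = sub'[rule_format]
    obtain V \<psi> where V: "(V, \<psi>) \<in> atlas Q" "q y \<in> V"
      using smooth_manifold_chart_at[OF Q tQ[OF y U(2)]] by metis
    have "s y \<in> points M"
      using U openin_subset by blast
    then obtain B \<beta> where B: "(B, \<beta>) \<in> atlas M" "s y \<in> B"
      using smooth_manifold_chart_at[OF M] by metis
    note cV = smooth_manifold_is_chart[OF Q V(1)] and cB = smooth_manifold_is_chart[OF M B(1)]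
    \<comment> \<open>The local model of the leaf space is the product of leaf coordinates of the
      fixed fibre and coordinates of the base, of dimension \<open>d + m\<close> at every
      point.\<close>
    define W where "W = model_space (V, \<psi>) \<times> model_space (B, \<beta>)"
    define f where "f z = (\<psi> (q z), \<beta> (s z))" for z
    define A where "A = {z \<in> points N. s z \<in> U \<and> q z \<in> V} \<inter> {z \<in> points N. s z \<in> B}"
    have A: "openin (top_space N) A" "y \<in> A"
      using t_op[OF is_chart_openin[OF cV]] openin_bundle_vimage[OF is_chart_openin[OF cB]] y U V B
      by (auto simp: A_def)
    have f: "submersive_at N W f z" if "z \<in> A" for z
      unfolding W_def f_def using that by (intro t_sub[OF V(1) B(1)]) (auto simp: A_def)
    obtain E :: "'e \<times> 'f \<Rightarrow> 'e" where E: "linear E" "inj_on E W"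
      using submersive_at_embedding[OF f[OF A(2)]] by metis
    have W: "subspace W" "dim W = d + m"
      using is_chart_dim[OF cV] is_chart_dim[OF cB] V(2) B(2)
      by (auto simp: W_def subspace_Times dim_Times)
    have "dim (E ` W) = d + m"
    proof -
      have "inj_on E (span W)"
        using E(2) W(1) by (metis span_eq_iff)
      then show ?thesis
        using dim_image_eq[OF E(1)] W(2) by simp
    qed
    moreover have Ef: "submersive_at N (E ` W) (E \<circ> f) z" if "z \<in> A" for z
      by (rule submersive_at_compose[OF N f[OF that] local_submersion_linear[OF E(1) refl W(1)]])
        (rule submersive_at_point(2)[OF N f[OF that]])
    moreover have "?\<pi> z \<subseteq> A" if z: "z \<in> A" for z
    proof
      fix w assume w: "w \<in> ?\<pi> z"
      have zN: "z \<in> points N" "s z \<in> U" "s z \<in> B" "q z \<in> V"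
        using z by (auto simp: A_def)
      note w' = leaf_of_eqD[OF zN(1) w]
      then show "w \<in> A"
        using t_eq[of w z] zN by (auto simp: A_def)
    qed
    moreover have "(E \<circ> f) a = (E \<circ> f) b \<longleftrightarrow> ?\<pi> a = ?\<pi> b" if a: "a \<in> A" and b: "b \<in> A" for a b
    proof -
      have "(E \<circ> f) a = (E \<circ> f) b \<longleftrightarrow> f a = f b"
        using inj_on_eq_iff[OF E(2) submersive_at_point(2)[OF N f[OF a]] submersive_at_point(2)[OF N f[OF b]]]
        by simp
      also have "\<dots> \<longleftrightarrow> q a = q b \<and> s a = s b"
        using inj_on_eq_iff[OF is_chart_inj[OF cV]] inj_on_eq_iff[OF is_chart_inj[OF cB]] a b
        by (auto simp: A_def f_def)
      also have "\<dots> \<longleftrightarrow> ?\<pi> a = ?\<pi> b"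
        using t_eq[of a b] a b by (auto simp: A_def)
      finally show ?thesis .
    qed
    ultimately show "\<exists>A g W. openin (top_space N) A \<and> y \<in> A \<and> (\<forall>x\<in>A. ?\<pi> x \<subseteq> A) \<and>
        dim (W :: 'e set) = d + m \<and> (\<forall>z\<in>A. submersive_at N W g z) \<and>
        (\<forall>a\<in>A. \<forall>b\<in>A. g a = g b \<longleftrightarrow> ?\<pi> a = ?\<pi> b)"
      using A by (intro exI[of _ A] exI[of _ "E \<circ> f"] exI[of _ "E ` W"]) blast
  qed
qed

end

theorem proposition3p2:
  fixes N :: "('a, 'e::euclidean_space) mfd"
    and M :: "('b, 'f::euclidean_space) mfd"
    and F :: "'a set set"
    and s :: "'a \<Rightarrow> 'b"
    and n m p :: nat
  assumes "smooth_manifold n N"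
    and "smooth_manifold m M"
    and "locally_trivial_bundle p N F M s"
    and "\<forall>x \<in> points M. connectedin (top_space N) (fibre N s x)"
  shows "strictly_simple N F \<longleftrightarrow>
    (\<forall>x \<in> points M. strictly_simple (fibre_mfd N s x) (fibre_fol N F s x))"
proof -
  note N = assms(1) and M = assms(2)
  have s: "submersion N M s" and surj: "s ` points N = points M"
    and leaf_fibre: "\<forall>L\<in>F. \<exists>x \<in> points M. L \<subseteq> fibre N s x" and fol: "foliation p N F"
    using assms(3) by (simp_all add: locally_trivial_bundle_def)
  note triv = assms(3)[unfolded locally_trivial_bundle_def, THEN conjunct2, THEN conjunct2,
      THEN conjunct2, THEN conjunct2]
  note F = foliation_partition[OF fol]
  have ne: "fibre N s x \<noteq> {}" if "x \<in> points M" for x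
    using that unfolding surj[symmetric] by (auto simp: fibre_def)
  show ?thesis
  proof
    assume "strictly_simple N F"
    then show "\<forall>x \<in> points M. strictly_simple (fibre_mfd N s x) (fibre_fol N F s x)"
      using strictly_simple_fibre[OF N M s F leaf_fibre] ne by blast
  next
    assume fibres: "\<forall>x \<in> points M. strictly_simple (fibre_mfd N s x) (fibre_fol N F s x)"
    show "strictly_simple N F"
    \<comment> \<open>An empty base offers no fibre to start from; \<open>N\<close> and
      \<open>F\<close> are then empty as well, and dimension \<open>0\<close> will do.\<close>
    proof (cases "points M = {}")
      case True
      then have empty: "points N = {}" "F = {}"
        using surj F by (auto simp: partition_on_empty)
      show ?thesis
        by (rule strictly_simpleI[OF N F, of 0]) (use empty in auto)
    next
      case False
      \<comment> \<open>Local triviality allows any fibre as the model around any point, so a single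
        \<open>x\<^sub>0\<close> serves for the whole base.\<close>
      then obtain x\<^sub>0 where x0: "x\<^sub>0 \<in> points M"
        by blast
      show ?thesis
        by (rule strictly_simple_total[OF N M s F leaf_fibre bspec[OF fibres x0] ne[OF x0]
              bspec[OF bspec[OF triv x0]]])
    qed
  qed
qed

end
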